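(* Let $k\in\mathbb N$ and let $P_1,P_2$ be two monic centred polynomials of degree $k+1$. If the two vector fields $\overline{P_1}\frac{\partial}{\partial z}$ and $\overline{P_2}\frac{\partial}{\partial z}$ are generic and have the same combinatorial and analytic invariants, then they are analytically equivalent.
   Context: Analytic equivalence means that there is a holomorphic bijection $h:\mathbb C\to\mathbb C$ whose push-forward sends the first vector field to the second. Vector fields. $P(z)=a_{k+1}z^{k+1}+\cdots+a_0$ is monic if $a_{k+1}=1$ and centred if $a_k=0$. $\overline P\frac{\partial}{\partial z}$ denotes the ODE $\dot z=\overline{P(z)}$ on $\mathbb C$ (real time). Every singular point (zero of $P$) is a saddle. A heteroclinic connection is an orbit tending to singular points in both forward and backward time. The vector field is generic if all zeros of $P$ are simple and there is no heteroclinic connection. Marked points at infinity. Let $\overline{\mathbb C}=\mathbb C\sqcup S^1$ be $\mathbb C$ compactified by the circle of directions at infinity (so $\overline{\mathbb C}\cong\overline{\mathbb D}$). On $S^1$ there are $k+2$ attracting points $\exp(2\pi i m/(2k+4))$, $m$ even, and $k+2$ repelling points, $m$ odd: orbits going to infinity in forward (resp. backward) time do so in the direction of an attracting (resp. repelling) point. The $j$-th vertex ($j$ mod $k+2$) is the repelling point $\exp\bigl(2\pi i(2j-1)/(2(k+2))\bigr)$. Separatrices and zones. An incoming (resp. outgoing) separatrix is the orbit of a nonsingular point on the boundary of the basin of attraction (resp. repulsion) of infinity. For generic $P$, each zero has two incoming separatrices (orbits coming from infinity and tending to the zero) and two outgoing ones. The separatrix graph $\Gamma_P\subset\mathbb C$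 is the union of zeros and separatrices. A component of $\mathbb C\setminus\Gamma_P$ is a sepal zone if its boundary has two connected components; in the generic case there are $k$ sepal zones, and each boundary component of a sepal zone contains exactly one zero. Noncrossing trees. A noncrossing tree of order $n$ ($n$-nc tree) is a rooted tree with $n$ vertices and $n-1$ edges embedded in $\overline{\mathbb D}$ such that all vertices lie on $\partial\mathbb D$ and no two edges cross; isomorphisms fix the root and preserve the cyclic order of the vertices. Vertices are labelled $1,\dots,n$ anticlockwise starting at the root, so such a tree is determined by its set of edges $\{a,b\}\subset\{1,\dots,n\}$. Combinatorial invariant. For generic $P$, each zero of $P$ together with its two incoming separatrices is regarded as an edge joining the two repelling marked points from which these separatrices emanate. This gives a $(k+2)$-nc tree in $\overline{\mathbb C}$ with vertices the repelling marked points and root the vertex $1$, at $\exp(2\pi i/(2(k+2)))$. It is the combinatorial invariant $G$ of $\overline P\frac{\partial}{\partial z}$. Analytic invariant. The edges at vertex $j$ are ordered by $\{j,m\}<\{j,\ell\}$ if $j<m<\ell$, with representatives $m,\ell\in\{j+1,\dots,j+k+1\}$ (anticlockwise starting from $j$). Let $n_j$ be the degree of vertex $j$ and $e_1<\cdots<e_{n_j}$ its edges, and let $z_{e}$ be the zero of $P$ on the edge $e$. To vertex $j$ are associated $n_j-1$ sepal zones, the $\ell$-th one ($1\le\ell\le n_j-1$) being adjacent to $z_{e_\ell}$ and $z_{e_{\ell+1}}$. For $1\le m\le k$, there are unique $1\le j\le k+2$ and $1\le\ell\le n_j-1$ with $m=(n_1-1)+\cdots+(n_{j-1}-1)+\ell$;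 the $m$-th sepal zone is the $\ell$-th one of vertex $j$, and $a_m$ is the oriented segment $[z_{e_\ell},z_{e_{\ell+1}}]$. The analytic invariant is $\eta=(\eta_1,\dots,\eta_k)\in\mathbb H^k$, $\mathbb H$ the upper half-plane, with $\eta_m=\int_{a_m}P(z)\,dz$. *)

theory Defs
  imports "HOL-Complex_Analysis.Complex_Analysis" "HOL-Computational_Algebra.Polynomial"
begin

section \<open>Real-time integral curves of planar vector fields\<close>

text \<open>A solution may blow up in finite time, so it always comes with its open interval of
  definition \<open>I\<close>, bounded or not.\<close>

definition integral_curve :: "(complex \<Rightarrow> complex) \<Rightarrow> real set \<Rightarrow> (real \<Rightarrow> complex) \<Rightarrow> bool" where
  "integral_curve X I \<gamma> \<longleftrightarrow>
     I \<noteq> {} \<and> open I \<and> is_interval I \<and>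
     (\<forall>t\<in>I. (\<gamma> has_vector_derivative X (\<gamma> t)) (at t))"

definition maximal_curve :: "(complex \<Rightarrow> complex) \<Rightarrow> real set \<Rightarrow> (real \<Rightarrow> complex) \<Rightarrow> bool" where
  "maximal_curve X I \<gamma> \<longleftrightarrow>
     integral_curve X I \<gamma> \<and>
     (\<forall>J \<delta>. integral_curve X J \<delta> \<and> I \<subseteq> J \<and> (\<forall>t\<in>I. \<delta> t = \<gamma> t) \<longrightarrow> J = I)"

text \<open>The filters \<open>t \<longrightarrow> sup I\<close> and \<open>t \<longrightarrow> inf I\<close> inside an open interval \<open>I\<close>, whether the
  endpoint is finite or not.\<close>

definition forward_end :: "real set \<Rightarrow> real filter" where
  "forward_end I = (INF s\<in>I. principal {t\<in>I. s \<le> t})"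

definition backward_end :: "real set \<Rightarrow> real filter" where
  "backward_end I = (INF s\<in>I. principal {t\<in>I. t \<le> s})"

lemma eventually_forward_end:
  assumes "I \<noteq> {}"
  shows "eventually Q (forward_end I) \<longleftrightarrow> (\<exists>s\<in>I. \<forall>t\<in>I. s \<le> t \<longrightarrow> Q t)"
  unfolding forward_end_def
proof (subst eventually_INF_base)
  fix a b assume "a \<in> I" "b \<in> I"
  then show "\<exists>x\<in>I. principal {t\<in>I. x \<le> t} \<le> inf (principal {t\<in>I. a \<le> t}) (principal {t\<in>I. b \<le> t})"
    by (intro bexI[of _ "max a b"]) (auto simp: max_def)
qed (use assms in \<open>auto simp: eventually_principal\<close>)

lemma eventually_backward_end:
  assumes "I \<noteq> {}"
  shows "eventually Q (backward_end I) \<longleftrightarrow> (\<exists>s\<in>I. \<forall>t\<in>I. t \<le> s \<longrightarrow> Q t)"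
  unfolding backward_end_def
proof (subst eventually_INF_base)
  fix a b assume "a \<in> I" "b \<in> I"
  then show "\<exists>x\<in>I. principal {t\<in>I. t \<le> x} \<le> inf (principal {t\<in>I. t \<le> a}) (principal {t\<in>I. t \<le> b})"
    by (intro bexI[of _ "min a b"]) (auto simp: min_def)
qed (use assms in \<open>auto simp: eventually_principal\<close>)

text \<open>The push-forward of \<open>X\<close> by \<open>h\<close> is the field whose value at \<open>h z\<close> is \<open>h'(z) X(z)\<close>.\<close>

definition analytically_equivalent :: "(complex \<Rightarrow> complex) \<Rightarrow> (complex \<Rightarrow> complex) \<Rightarrow> bool" where
  "analytically_equivalent X Y \<longleftrightarrow>
     (\<exists>h. h holomorphic_on UNIV \<and> bij h \<and> (\<forall>z. deriv h z * X z = Y (h z)))"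

section \<open>Anti-polynomial vector fields\<close>

definition monic_centred :: "nat \<Rightarrow> complex poly \<Rightarrow> bool" where
  "monic_centred k P \<longleftrightarrow> degree P = k + 1 \<and> coeff P (k + 1) = 1 \<and> coeff P k = 0"

definition vfield :: "complex poly \<Rightarrow> complex \<Rightarrow> complex" where
  "vfield P z = cnj (poly P z)"

text \<open>The nonvanishing clause excludes the constant orbits at the singular points.\<close>

definition heteroclinic_connection :: "complex poly \<Rightarrow> real set \<Rightarrow> (real \<Rightarrow> complex) \<Rightarrow> bool" where
  "heteroclinic_connection P I \<gamma> \<longleftrightarrow>
     maximal_curve (vfield P) I \<gamma> \<and> (\<forall>t\<in>I. poly P (\<gamma> t) \<noteq> 0) \<and>
     (\<exists>a. poly P a = 0 \<and> (\<gamma> \<longlongrightarrow> a) (backward_end I)) \<and>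
     (\<exists>b. poly P b = 0 \<and> (\<gamma> \<longlongrightarrow> b) (forward_end I))"

definition generic :: "complex poly \<Rightarrow> bool" where
  "generic P \<longleftrightarrow>
     (\<forall>z. poly P z = 0 \<longrightarrow> order z P = 1) \<and> (\<nexists>I \<gamma>. heteroclinic_connection P I \<gamma>)"

definition attraction_basin_infinity :: "complex poly \<Rightarrow> complex set" where
  "attraction_basin_infinity P =
     {z. \<exists>I \<gamma>. maximal_curve (vfield P) I \<gamma> \<and> z \<in> \<gamma> ` I \<and>
               filterlim \<gamma> at_infinity (forward_end I)}"

definition incoming_separatrix :: "complex poly \<Rightarrow> real set \<Rightarrow> (real \<Rightarrow> complex) \<Rightarrow> bool" where
  "incoming_separatrix P I \<gamma> \<longleftrightarrow>
     maximal_curve (vfield P) I \<gamma> \<and>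
     (\<exists>z \<in> \<gamma> ` I. poly P z \<noteq> 0 \<and> z \<in> frontier (attraction_basin_infinity P))"

section \<open>The combinatorial invariant\<close>

text \<open>The \<open>j\<close>-th repelling point on the circle of directions at infinity.\<close>

definition repelling_vertex :: "nat \<Rightarrow> nat \<Rightarrow> complex" where
  "repelling_vertex k j = cis (2 * pi * (2 * real j - 1) / (2 * (real k + 2)))"

text \<open>Convergence, in the compactification of the plane by the circle of directions, to the
  point \<open>v\<close> of that circle: \<open>\<gamma>\<close> leaves every compact set and \<open>\<gamma> / |\<gamma>|\<close> tends to \<open>v\<close>.\<close>

definition emanates_from :: "real set \<Rightarrow> (real \<Rightarrow> complex) \<Rightarrow> complex \<Rightarrow> bool" where
  "emanates_from I \<gamma> v \<longleftrightarrow>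
     filterlim \<gamma> at_infinity (backward_end I) \<and> ((\<lambda>t. sgn (\<gamma> t)) \<longlongrightarrow> v) (backward_end I)"

definition edge_of_zero :: "nat \<Rightarrow> complex poly \<Rightarrow> complex \<Rightarrow> nat set" where
  "edge_of_zero k P z =
     {j \<in> {1..k + 2}. \<exists>I \<gamma>. incoming_separatrix P I \<gamma> \<and> (\<gamma> \<longlongrightarrow> z) (forward_end I) \<and>
                             emanates_from I \<gamma> (repelling_vertex k j)}"

text \<open>A noncrossing tree with vertices labelled \<open>1, \<dots>, k + 2\<close> anticlockwise from the root is
  determined by its set of edges, and an isomorphism (fixing the root and preserving the cyclic
  order) preserves the labels. So the tree is given by its edge set, and two such trees are
  isomorphic iff these sets are equal.\<close>

definition combinatorial_invariant :: "nat \<Rightarrow> complex poly \<Rightarrow> nat set set" where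
  "combinatorial_invariant k P = edge_of_zero k P ` {z. poly P z = 0}"

section \<open>The analytic invariant\<close>

text \<open>The edges at vertex \<open>j\<close> of a graph on \<open>{1..n}\<close> with edge set \<open>E\<close>, in increasing order: the
  other endpoint runs anticlockwise through the representatives \<open>j + 1, \<dots>, j + n - 1\<close> modulo
  \<open>n\<close>.\<close>

definition edges_at :: "nat \<Rightarrow> nat set set \<Rightarrow> nat \<Rightarrow> nat set list" where
  "edges_at n E j =
     filter (\<lambda>e. e \<in> E) (map (\<lambda>l. {j, if l \<le> n then l else l - n}) [j + 1..<j + n])"

definition zero_on_edge :: "nat \<Rightarrow> complex poly \<Rightarrow> nat set \<Rightarrow> complex" where
  "zero_on_edge k P e = (THE z. poly P z = 0 \<and> edge_of_zero k P z = e)"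

text \<open>The integrals along the segments joining the zeros on consecutive edges at vertex \<open>j\<close>.\<close>

definition vertex_periods :: "nat \<Rightarrow> complex poly \<Rightarrow> nat \<Rightarrow> complex list" where
  "vertex_periods k P j =
     (let es = edges_at (k + 2) (combinatorial_invariant k P) j in
      map (\<lambda>l. contour_integral
                 (linepath (zero_on_edge k P (es ! l)) (zero_on_edge k P (es ! Suc l))) (poly P))
          [0..<length es - 1])"

text \<open>The tuple \<open>(\<eta>\<^sub>1, \<dots>, \<eta>\<^sub>k)\<close>. Concatenating over \<open>j = 1, \<dots>, k + 2\<close> puts the \<open>l\<close>-th
  integral of vertex \<open>j\<close> at position \<open>m = (n\<^sub>1 - 1) + \<dots> + (n\<^sub>j\<^sub>-\<^sub>1 - 1) + l\<close>,
  where \<open>n\<^sub>i\<close> is the degree of vertex \<open>i\<close>.\<close>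

definition analytic_invariant :: "nat \<Rightarrow> complex poly \<Rightarrow> complex list" where
  "analytic_invariant k P = concat (map (vertex_periods k P) [1..<k + 3])"

end

theory Submission
  imports Defs "HOL-Computational_Algebra.Fundamental_Theorem_Algebra"
begin

text \<open>The proof shows that the two polynomials are equal. Let \<open>F\<close> be a primitive of \<open>P\<close>, of degree
  \<open>d = k + 2\<close>. Along an orbit the imaginary part of \<open>F\<close> is constant and its real part increases, so
  orbits are lifts through \<open>F\<close> of pieces of horizontal lines, and infinity is repelling exactly in the
  \<open>d\<close> valleys where \<open>F\<close> tends to minus infinity.

  Cut the plane along the horizontal rays going to the right from the critical values. This slit plane is
  simply connected, and over it \<open>F\<close> is a covering, so it has \<open>d\<close> inverse branches. Far to the left each
  of them lies in one valley (lemma \<open>ex_inverse_branch_from_valley\<close>), which labels the branches by the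
  vertices \<open>1, ..., d\<close>. Moving to the right along a horizontal line, the branch \<open>a\<close> follows an orbit out of
  the valley \<open>a\<close>; it reaches a zero \<open>z\<close> of \<open>P\<close> exactly when an incoming separatrix of \<open>z\<close> comes from the
  vertex \<open>a\<close> (lemma \<open>edge_eq\<close>). Since the zeros are simple, exactly two branches meet at \<open>z\<close>. This
  is the edge of \<open>z\<close>. Since there is no heteroclinic connection, a horizontal line meets at most one zero
  on each branch.

  Hence the behaviour of the branches across the slits is known (lemma \<open>sides_partner\<close>): to the right of
  the critical value of an edge \<open>{a, b}\<close>, the upper side of the branch \<open>a\<close> is glued to the lower side of
  the branch \<open>b\<close> and conversely, and all other branches continue unchanged. The edges together with the
  critical values determine this gluing completely.

  A symmetric expression in the branches that is invariant under the gluing is an entire function. This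
  principle, combined with the fact that the branches grow like the \<open>d\<close>-th root, is used twice. Applied
  to the product of the branches over a set of vertices closed under edges, it shows that the graph is
  connected (lemma \<open>edges_connected\<close>). Therefore distinct zeros have distinct edges, and the periods,
  which are differences of critical values of consecutive edges at a vertex, determine all critical
  values up to one additive constant. That constant is absorbed in the choice of the primitives.

  Now let \<open>F\<close> and \<open>G\<close> be primitives of the two polynomials, with the same edges and critical values. The
  product over all vertices \<open>a\<close> of the difference of the two branches labelled \<open>a\<close> is entire for
  the same reason, and it grows at most linearly. As the polynomials are monic and centred, corresponding
  branches differ by a quantity that tends to 0 far to the left (lemma \<open>branches_asymptotic\<close>). So the
  product vanishes identically, \<open>F\<close> and \<open>G\<close> have a common preimage of every point, and \<open>F = G\<close>.\<close>

section \<open>Preimages of points under a polynomial\<close>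

text \<open>If every root were at distance at least \<open>e\<close> from \<open>x\<close>, the factorisation of \<open>Q\<close> into linear
  factors would bound \<open>Q x\<close> from below. This one estimate serves as continuity of the roots and as
  the source of all asymptotics.\<close>

lemma poly_near_root:
  fixes Q :: "complex poly"
  assumes n: "degree Q > 0" and small: "norm (poly Q x) < norm (lead_coeff Q) * e ^ degree Q" and e: "e > 0"
  shows "\<exists>z. poly Q z = 0 \<and> norm (x - z) < e"
proof (rule ccontr)
  assume far: "\<not> ?thesis"
  obtain root where root: "smult (lead_coeff Q) (\<Prod>i<degree Q. [:-root i, 1:]) = Q"
    using complex_poly_decompose' by blast
  have ev: "poly Q y = lead_coeff Q * (\<Prod>i<degree Q. y - root i)" for y
    by (subst root[symmetric]) (simp add: poly_prod)
  have "norm (x - root i) \<ge> e" if "i < degree Q" for i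
  proof -
    have "poly Q (root i) = 0" using that ev[of "root i"] by (auto intro!: bexI[of _ i])
    then show ?thesis using far by force
  qed
  then have "e ^ degree Q \<le> (\<Prod>i<degree Q. norm (x - root i))"
    using prod_mono[of "{..<degree Q}" "\<lambda>_. e" "\<lambda>i. norm (x - root i)"] e by auto
  then have "norm (lead_coeff Q) * e ^ degree Q \<le> norm (poly Q x)"
    by (simp only: ev[of x] norm_mult prod_norm[symmetric] mult_left_mono norm_ge_zero)
  with small show False by simp
qed

lemma poly_norm_le:
  fixes Q :: "complex poly"
  assumes "degree Q \<le> n"
  obtains C where "C > 0" "\<And>z. norm z \<ge> 1 \<Longrightarrow> norm (poly Q z) \<le> C * norm z ^ n"
proof
  let ?C = "(\<Sum>i\<le>degree Q. norm (coeff Q i)) + 1"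
  show "?C > 0" by (simp add: sum_nonneg add_nonneg_pos)
  fix z :: complex assume z: "norm z \<ge> 1"
  have "norm (poly Q z) \<le> (\<Sum>i\<le>degree Q. norm (coeff Q i * z ^ i))"
    unfolding poly_altdef by (rule norm_sum)
  also have "\<dots> \<le> (\<Sum>i\<le>degree Q. norm (coeff Q i) * norm z ^ n)"
    using assms z by (intro sum_mono) (auto simp: norm_mult norm_power intro!: mult_left_mono power_increasing)
  also have "\<dots> \<le> ?C * norm z ^ n"
    by (simp add: sum_distrib_right[symmetric] distrib_right)
  finally show "norm (poly Q z) \<le> ?C * norm z ^ n" .
qed

lemma poly_locally_invertible:
  fixes F :: "complex poly"
  assumes "poly (pderiv F) z \<noteq> 0"
  obtains r where "r > 0" "open (poly F ` ball z r)" "inj_on (poly F) (ball z r)"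
proof -
  have "poly F holomorphic_on UNIV" by (intro holomorphic_intros)
  moreover have "deriv (poly F) z \<noteq> 0"
    using assms poly_DERIV DERIV_imp_deriv by metis
  ultimately show ?thesis
    using has_complex_derivative_locally_invertible[of "poly F" UNIV z] that by auto
qed

text \<open>Two lifts of the same map through \<open>F\<close> can separate only at a critical point, since \<open>F\<close> is locally
  injective elsewhere. The domain is an arbitrary connected space because the lemma is applied to
  slit domains, to half-discs, to horizontal lines and to time intervals of orbits.\<close>

lemma poly_lift_unique:
  fixes F :: "complex poly" and g h :: "'a::topological_space \<Rightarrow> complex"
  assumes S: "connected S" and g: "continuous_on S g" and h: "continuous_on S h"
    and eq: "\<And>x. x \<in> S \<Longrightarrow> poly F (g x) = poly F (h x)"
    and nz: "\<And>x. x \<in> S \<Longrightarrow> poly (pderiv F) (g x) \<noteq> 0"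
    and a: "a \<in> S" "g a = h a" and x: "x \<in> S"
  shows "g x = h x"
proof -
  let ?E = "{x \<in> S. g x - h x = 0}"
  have "closedin (top_of_set S) ?E"
    by (intro continuous_closedin_preimage_constant continuous_intros g h)
  moreover have "openin (top_of_set S) ?E"
  proof (subst openin_subopen, safe)
    fix x assume x: "x \<in> S" "g x - h x = 0"
    obtain r where r: "r > 0" "inj_on (poly F) (ball (g x) r)"
      using poly_locally_invertible[OF nz[OF x(1)]] by metis
    let ?T = "(S \<inter> g -` ball (g x) r) \<inter> (S \<inter> h -` ball (g x) r)"
    have "openin (top_of_set S) ?T"
      by (intro openin_Int continuous_openin_preimage_gen g h) auto
    moreover have "x \<in> ?T" using x r by auto
    moreover have "?T \<subseteq> ?E"
      using inj_onD[OF r(2) eq] by auto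
    ultimately show "\<exists>T. openin (top_of_set S) T \<and> x \<in> T \<and> T \<subseteq> {x \<in> S. g x - h x = 0}" by blast
  qed
  ultimately have "?E = {} \<or> ?E = S" using S connected_clopen by blast
  with a x show ?thesis by auto
qed


lemma poly_minus_const:
  fixes F :: "complex poly"
  assumes "degree F > 0"
  shows "degree (F - [:w:]) = degree F" "lead_coeff (F - [:w:]) = lead_coeff F"
proof -
  have "F - [:w:] = F + [:- w:]" by simp
  then show d: "degree (F - [:w:]) = degree F"
    using assms by (metis degree_add_eq_left degree_pCons_0)
  show "lead_coeff (F - [:w:]) = lead_coeff F"
    using assms unfolding d by (simp add: coeff_pCons split: nat.splits)
qed

lemma poly_preimage_near:
  fixes F :: "complex poly"
  assumes n: "degree F > 0" and e: "e > 0"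
  obtains \<delta> where "\<delta> > 0" "\<And>z. norm (poly F z - w) < \<delta> \<Longrightarrow> \<exists>z0. poly F z0 = w \<and> norm (z - z0) < e"
proof
  have nz: "norm (lead_coeff F) > 0" using n by auto
  then show "norm (lead_coeff F) * e ^ degree F > 0" using e by simp
  show "\<exists>z0. poly F z0 = w \<and> norm (z - z0) < e" if "norm (poly F z - w) < norm (lead_coeff F) * e ^ degree F" for z
    using poly_near_root[of "F - [:w:]" z e] poly_minus_const[OF n, of w] that n e by simp
qed

lemma poly_surj:
  fixes F :: "complex poly"
  assumes "degree F > 0" shows "\<exists>z. poly F z = w"
  using alg_closed_imp_poly_has_root[of "F - [:w:]"] poly_minus_const[OF assms, of w] assms by auto

lemma finite_poly_fibre:
  fixes F :: "complex poly"
  assumes "degree F > 0" shows "finite {z. poly F z = w}"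
proof -
  have "F - [:w:] \<noteq> 0" using poly_minus_const(1)[OF assms, of w] assms by force
  then show ?thesis using poly_roots_finite[of "F - [:w:]"] by simp
qed

lemma finite_critical_points:
  fixes F :: "complex poly"
  assumes "degree F > 0" shows "finite {z. poly (pderiv F) z = 0}"
  by (metis assms poly_roots_finite pderiv_eq_0_iff less_irrefl)

lemma finite_set_separated:
  fixes Z :: "'a::heine_borel set"
  assumes "finite Z" shows "\<exists>e>0. \<forall>x\<in>Z. \<forall>y\<in>Z. dist x y < e \<longrightarrow> x = y"
  using assms uniform_discrete_finite_iff[of Z] by (simp add: uniform_discrete_def)

text \<open>Around a noncritical value \<open>w\<close>, small discs about the points of the fibre are mapped
  injectively, and no other point can map near \<open>w\<close>, because a point with value near \<open>w\<close> lies near a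
  root of \<open>F - w\<close>.\<close>

lemma poly_covering_space:
  fixes F :: "complex poly"
  assumes n: "degree F > 0"
  defines "S \<equiv> - poly F ` {z. poly (pderiv F) z = 0}"
  shows "covering_space (poly F -` S) (poly F) S"
proof
  show "continuous_on (poly F -` S) (poly F)" by (intro continuous_intros)
  show "poly F ` (poly F -` S) = S"
  proof
    show "S \<subseteq> poly F ` (poly F -` S)"
    proof
      fix w assume "w \<in> S"
      moreover obtain z where "poly F z = w" using poly_surj[OF n] by blast
      ultimately show "w \<in> poly F ` (poly F -` S)" by blast
    qed
  qed blast
  have "finite (poly F ` {z. poly (pderiv F) z = 0})"
    using finite_critical_points[OF n] by blast
  then have oS: "open S" unfolding S_def by (simp add: finite_imp_closed open_Compl)
  have oS': "open (poly F -` S)" by (intro open_vimage oS continuous_intros)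
  fix w assume w: "w \<in> S"
  let ?Z = "{z. poly F z = w}"
  have fin: "finite ?Z" by (rule finite_poly_fibre[OF n])
  have "\<exists>r. r > 0 \<and> inj_on (poly F) (ball z r)" if "z \<in> ?Z" for z
  proof -
    have "poly (pderiv F) z \<noteq> 0" using that w unfolding S_def by auto
    then obtain r where "r > 0" "inj_on (poly F) (ball z r)" by (rule poly_locally_invertible)
    then show ?thesis by (intro exI conjI)
  qed
  then have "\<forall>z\<in>?Z. \<exists>r. r > 0 \<and> inj_on (poly F) (ball z r)" by (intro ballI)
  then obtain r where "\<forall>z\<in>?Z. r z > 0 \<and> inj_on (poly F) (ball z (r z))"
    by (rule bchoice[THEN exE])
  then have r: "r z > 0 \<and> inj_on (poly F) (ball z (r z))" if "z \<in> ?Z" for z using that by (rule bspec)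
  from finite_set_separated[OF fin] obtain e0 where
    e0': "e0 > 0 \<and> (\<forall>x\<in>?Z. \<forall>y\<in>?Z. dist x y < e0 \<longrightarrow> x = y)" by (rule exE)
  note e0 = conjunct1[OF e0'] conjunct2[OF e0']
  define \<rho> where "\<rho> = Min (insert (e0 / 2) (r ` ?Z))"
  have \<rho>: "\<rho> > 0" "2 * \<rho> \<le> e0" "\<And>z. z \<in> ?Z \<Longrightarrow> \<rho> \<le> r z"
  proof -
    show "\<rho> > 0" unfolding \<rho>_def using fin e0(1) r by (subst Min_gr_iff) auto
    have "\<rho> \<le> e0 / 2" unfolding \<rho>_def using fin by (intro Min_le) auto
    then show "2 * \<rho> \<le> e0" by simp
    show "\<rho> \<le> r z" if "z \<in> ?Z" for z unfolding \<rho>_def using fin that by (intro Min_le) auto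
  qed
  have inj: "inj_on (poly F) (ball z \<rho>)" if "z \<in> ?Z" for z
    using r[OF that] \<rho>(3)[OF that] by (meson inj_on_subset subset_ball)
  have op: "open (poly F ` ball z \<rho>)" if "z \<in> ?Z" for z
    by (intro open_mapping_thm3 inj[OF that]) (auto intro!: holomorphic_intros)
  obtain \<delta> where \<delta>: "\<delta> > 0" "\<And>z. norm (poly F z - w) < \<delta> \<Longrightarrow> \<exists>z0. poly F z0 = w \<and> norm (z - z0) < \<rho>"
    using poly_preimage_near[OF n \<rho>(1)] by metis
  define T where "T = ball w \<delta> \<inter> S \<inter> (\<Inter>z\<in>?Z. poly F ` ball z \<rho>)"
  have oT: "open T" unfolding T_def using oS op fin by (intro open_Int open_INT) auto
  have wT: "w \<in> T" unfolding T_def using \<delta> w \<rho>(1) by auto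
  define v where "v = (\<lambda>z. ball z \<rho> \<inter> poly F -` T) ` ?Z"
  show "\<exists>T. w \<in> T \<and> openin (top_of_set S) T \<and>
      (\<exists>v. \<Union>v = poly F -` S \<inter> poly F -` T \<and> (\<forall>u\<in>v. openin (top_of_set (poly F -` S)) u) \<and>
           pairwise disjnt v \<and> (\<forall>u\<in>v. \<exists>q. homeomorphism u T (poly F) q))"
  proof (intro exI[of _ T] exI[of _ v] conjI ballI)
    show "w \<in> T" by (rule wT)
    have "T \<subseteq> S" unfolding T_def by (intro le_infI1 le_infI2 order_refl)
    then show "openin (top_of_set S) T" using oT oS by (simp add: openin_open_eq)
    have "\<exists>z0. poly F z0 = w \<and> z \<in> ball z0 \<rho>" if "poly F z \<in> T" for z
      using \<delta>(2)[of z] that by (auto simp: T_def dist_norm norm_minus_commute)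
    then show "\<Union> v = poly F -` S \<inter> poly F -` T"
      unfolding v_def by (auto simp: T_def)
    have ou: "open u" if "u \<in> v" for u
      using that oT unfolding v_def by (auto intro!: open_Int open_vimage continuous_intros)
    have uS: "u \<subseteq> poly F -` S" if "u \<in> v" for u
      using that unfolding v_def T_def by auto
    show "openin (top_of_set (poly F -` S)) u" if "u \<in> v" for u
      using ou[OF that] uS[OF that] oS' by (simp add: openin_open_eq)
    show "pairwise disjnt v"
    proof (rule pairwiseI)
      fix A B assume "A \<in> v" "B \<in> v" "A \<noteq> B"
      then obtain x y where xy: "x \<in> ?Z" "y \<in> ?Z" "x \<noteq> y"
          "A = ball x \<rho> \<inter> poly F -` T" "B = ball y \<rho> \<inter> poly F -` T"
        unfolding v_def by auto
      have "e0 \<le> dist x y" using e0(2) xy(1-3) by (metis not_le)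
      have "disjnt (ball x \<rho>) (ball y \<rho>)"
        unfolding disjnt_iff mem_ball
      proof safe
        fix z assume "dist x z < \<rho>" "dist y z < \<rho>"
        then have "dist x y < 2 * \<rho>" using dist_triangle2[of x y z] by linarith
        then show False using \<open>e0 \<le> dist x y\<close> \<rho>(2) by linarith
      qed
      then show "disjnt A B" using xy by (auto simp: disjnt_def)
    qed
    fix u assume u: "u \<in> v"
    then obtain z where z: "z \<in> ?Z" "u = ball z \<rho> \<inter> poly F -` T" unfolding v_def by auto
    have "T \<subseteq> poly F ` ball z \<rho>" unfolding T_def using z(1) by blast
    then have "poly F ` u = T" unfolding z(2) by blast
    moreover have "inj_on (poly F) u" using inj[OF z(1)] z(2) by (auto intro: inj_on_subset)
    moreover have "continuous_on u (poly F)" by (intro continuous_intros)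
    ultimately obtain q where "homeomorphism u T (poly F) q"
      using invariance_of_domain_homeomorphism[of u "poly F"] ou[OF u] by auto
    then show "\<exists>q. homeomorphism u T (poly F) q" by blast
  qed
qed

section \<open>The valleys of a polynomial\<close>

text \<open>With \<open>d = k + 2\<close>, these are the directions in which \<open>z ^ d\<close> tends to minus infinity, that is, the
  repelling points at infinity.\<close>

definition valley_dir :: "nat \<Rightarrow> nat \<Rightarrow> complex" where
  "valley_dir d a = cis (pi * (2 * real a - 1) / real d)"

definition far_left :: "complex filter" where
  "far_left = filtercomap Re at_bot"

text \<open>The scale \<open>r\<close> on which the fibre of \<open>w\<close> is seen when \<open>Re w\<close> is very negative: a root of
  \<open>- d * w\<close>, so that \<open>z ^ d / d = w\<close> has the solutions \<open>z = valley_dir d a * r\<close>. The principal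
  logarithm is smooth there because \<open>- d * w\<close> lies in the right half-plane.\<close>

definition left_root :: "nat \<Rightarrow> complex \<Rightarrow> complex" where
  "left_root d w = exp (Ln (- of_nat d * w) / of_nat d)"

lemma eventually_far_left: "eventually Q far_left \<longleftrightarrow> (\<exists>R. \<forall>w. Re w < R \<longrightarrow> Q w)"
  unfolding far_left_def eventually_filtercomap_at_bot_dense by blast

lemma far_left_neq_bot [simp]: "far_left \<noteq> bot"
proof
  assume "far_left = bot"
  then obtain R where R: "\<And>w. \<not> Re w < R"
    using eventually_far_left[of "\<lambda>_. False"] by auto
  show False using R[of "of_real (R - 1)"] by simp
qed

lemma left_root_power:
  assumes "d > 0" "w \<noteq> 0" shows "left_root d w ^ d = - of_nat d * w"
  using assms by (simp add: left_root_def exp_of_nat_mult[symmetric])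

lemma left_root_nz [simp]: "left_root d w \<noteq> 0"
  by (simp add: left_root_def)

lemma norm_left_root_power:
  assumes "d > 0" "w \<noteq> 0" shows "norm (left_root d w) ^ d = d * norm w"
  using left_root_power[OF assms] by (metis norm_minus_cancel norm_mult norm_of_nat norm_power mult_minus_left)

lemma continuous_left_root: "d > 0 \<Longrightarrow> continuous_on {w. Re w < 0} (left_root d)"
  unfolding left_root_def
  by (intro continuous_intros) (auto simp: complex_nonpos_Reals_iff zero_le_mult_iff)

lemma valley_dir_power: "d > 0 \<Longrightarrow> valley_dir d a ^ d = -1"
proof -
  assume d: "d > 0"
  have "valley_dir d a ^ d = cis (2 * pi * real a - pi)"
    using d unfolding valley_dir_def Complex.DeMoivre by (intro arg_cong[of _ _ cis]) (simp add: field_simps)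
  also have "\<dots> = -1"
    by (simp add: cis.ctr complex_eq_iff cos_diff sin_diff)
      (metis cos_2npi mult.commute sin_2npi mult.assoc)
  finally show ?thesis .
qed

lemma valley_dir_image:
  assumes d: "d > 0"
  shows "valley_dir d ` {1..d} = {z. z ^ d = -1}"
proof
  show "valley_dir d ` {1..d} \<subseteq> {z. z ^ d = -1}" using valley_dir_power[OF d] by auto
  show "{z. z ^ d = -1} \<subseteq> valley_dir d ` {1..d}"
  proof safe
    fix z :: complex assume z: "z ^ d = -1"
    have nz: "valley_dir d 1 \<noteq> 0" by (simp add: valley_dir_def)
    have "(z / valley_dir d 1) ^ d = 1" using z valley_dir_power[OF d] by (simp add: power_divide)
    then have "z / valley_dir d 1 \<in> {exp (2 * of_real pi * \<i> * of_nat j / of_nat d) | j. j < d}"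
      using complex_roots_unity[of d] d by auto
    then obtain j where j: "j < d" "z / valley_dir d 1 = exp (2 * of_real pi * \<i> * of_nat j / of_nat d)" by auto
    have "exp (2 * of_real pi * \<i> * of_nat j / of_nat d) = cis (2 * pi * real j / d)"
      by (simp add: cis_conv_exp mult_ac)
    then have "z = cis (2 * pi * real j / d) * valley_dir d 1"
      using j(2) nz by (simp add: field_simps)
    also have "\<dots> = valley_dir d (j + 1)"
      using d unfolding valley_dir_def cis_mult by (intro arg_cong[of _ _ cis]) (simp add: field_simps)
    finally show "z \<in> valley_dir d ` {1..d}" using j(1) by auto
  qed
qed

lemma inj_valley_dir: "d > 0 \<Longrightarrow> inj_on (valley_dir d) {1..d}"
  using valley_dir_image[of d] card_nth_roots[of "-1" d] by (intro eq_card_imp_inj_on) auto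

lemma norm_valley_dir [simp]: "norm (valley_dir d a) = 1"
  by (simp add: valley_dir_def)

lemma near_valley_dir:
  assumes d: "d > 0" and small: "norm (x ^ d + 1) < e ^ d" and e: "e > 0"
  shows "\<exists>a\<in>{1..d}. norm (x - valley_dir d a) < e"
proof -
  let ?Q = "monom 1 d + 1 :: complex poly"
  have deg: "degree ?Q = d"
    using d by (subst degree_add_eq_left) (auto simp: degree_monom_eq)
  have "lead_coeff ?Q = 1" unfolding deg using d by (simp add: coeff_eq_0)
  then obtain z where "poly ?Q z = 0" "norm (x - z) < e"
    using poly_near_root[of ?Q x e] deg d small e by (auto simp: poly_monom)
  moreover from this have "z ^ d = -1" by (simp add: poly_monom eq_neg_iff_add_eq_0)
  ultimately show ?thesis using valley_dir_image[OF d] by (metis (mono_tags, lifting) imageE mem_Collect_eq)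
qed

text \<open>A primitive of a monic polynomial of degree \<open>d - 1\<close>, with an arbitrary constant of integration.\<close>

locale normalized_poly =
  fixes F :: "complex poly" and d :: nat
  assumes d2: "d \<ge> 2" and deg: "degree F = d" and lead: "coeff F d = 1 / of_nat d"
begin

lemma dpos: "d > 0" using d2 by simp
lemma degpos: "degree F > 0" using d2 deg by simp

abbreviation rt where "rt \<equiv> left_root d"
abbreviation vd where "vd \<equiv> valley_dir d"

text \<open>The error in the approximation of \<open>d * F\<close> by \<open>z ^ d\<close>.\<close>

definition lower where "lower = monom 1 d - smult (of_nat d) F"

lemma lower_eq: "poly lower z = z ^ d - of_nat d * poly F z"
  by (simp add: lower_def poly_monom)

lemma degree_lower: "degree lower \<le> d - 1"
proof (rule degree_le, safe)
  fix i assume i: "d - 1 < i"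
  then consider "i = d" | "i > d" by linarith
  then show "coeff lower i = 0"
    by cases (use dpos lead deg in \<open>auto simp: lower_def coeff_eq_0\<close>)
qed

lemma lower_bound:
  obtains C where "C > 0" "\<And>z. norm z \<ge> 1 \<Longrightarrow> norm (poly lower z) \<le> C * norm z ^ (d - 1)"
  using poly_norm_le[OF degree_lower] by metis

lemma power_le_poly:
  obtains R where "R \<ge> 1" "\<And>z. norm z \<ge> R \<Longrightarrow> norm z ^ d \<le> 2 * d * norm (poly F z)"
proof -
  obtain C where C: "C > 0" "\<And>z. norm z \<ge> 1 \<Longrightarrow> norm (poly lower z) \<le> C * norm z ^ (d - 1)"
    using lower_bound by metis
  show ?thesis
  proof
    show "max 1 (2 * C) \<ge> 1" by simp
    fix z :: complex assume z: "norm z \<ge> max 1 (2 * C)"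
    have eq: "norm z ^ d = norm z * norm z ^ (d - 1)" using dpos by (metis power_eq_if less_irrefl)
    have "of_nat d * poly F z = z ^ d - poly lower z" by (simp add: lower_eq)
    then have "d * norm (poly F z) = norm (z ^ d - poly lower z)"
      by (metis norm_mult norm_of_nat)
    also have "\<dots> \<ge> norm z ^ d - C * norm z ^ (d - 1)"
      using C(2)[of z] z norm_triangle_ineq2[of "z ^ d" "poly lower z"] by (simp add: norm_power)
    finally have 1: "norm z ^ d - C * norm z ^ (d - 1) \<le> d * norm (poly F z)" .
    have "C * norm z ^ (d - 1) \<le> norm z ^ d / 2"
      unfolding eq using z mult_right_mono[of "2 * C" "norm z" "norm z ^ (d - 1)"] by simp
    with 1 show "norm z ^ d \<le> 2 * d * norm (poly F z)" by simp
  qed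
qed

lemma poly_bounded_on:
  obtains B where "\<And>z. norm z \<le> M \<Longrightarrow> norm (poly F z) \<le> B"
proof -
  have "compact (poly F ` cball 0 M)" by (intro compact_continuous_image continuous_intros compact_cball)
  then obtain B where "\<forall>x\<in>poly F ` cball 0 M. norm x \<le> B"
    using compact_imp_bounded bounded_iff by metis
  then show ?thesis by (intro that[of B]) (auto simp: image_iff)
qed

lemma preimage_at_infinity:
  assumes "filterlim (\<lambda>x. poly F (g x)) at_infinity \<F>"
  shows "filterlim g at_infinity \<F>"
  unfolding filterlim_at_infinity[OF order_refl]
proof safe
  fix M :: real
  obtain B where B: "\<And>z. norm z \<le> M \<Longrightarrow> norm (poly F z) \<le> B" using poly_bounded_on by metis
  have "eventually (\<lambda>x. norm (poly F (g x)) > B) \<F>"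
    using assms unfolding filterlim_at_infinity_conv_norm_at_top filterlim_at_top_dense by auto
  then show "eventually (\<lambda>x. M \<le> norm (g x)) \<F>"
    by eventually_elim (use B in \<open>metis linorder_not_less nle_le\<close>)
qed

text \<open>On the scale \<open>r = left_root d w\<close>, the equation \<open>F z = w\<close> says that \<open>(z / r) ^ d + 1\<close> is small, and
  the roots of \<open>x ^ d + 1\<close> are the valley directions.\<close>

lemma preimage_near_valley:
  assumes e: "e > 0"
  shows "\<forall>\<^sub>F w in far_left. \<forall>z. poly F z = w \<longrightarrow> (\<exists>a\<in>{1..d}. norm (z / rt w - vd a) < e)"
proof -
  obtain C where C: "C > 0" "\<And>z. norm z \<ge> 1 \<Longrightarrow> norm (poly lower z) \<le> C * norm z ^ (d - 1)"
    using lower_bound by metis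
  obtain R where R: "R \<ge> 1" "\<And>z. norm z \<ge> R \<Longrightarrow> norm z ^ d \<le> 2 * d * norm (poly F z)"
    using power_le_poly by metis
  define M where "M = max R (2 * C / e ^ d + 1)"
  obtain B where B: "\<And>z. norm z \<le> M \<Longrightarrow> norm (poly F z) \<le> B" using poly_bounded_on by metis
  show ?thesis unfolding eventually_far_left
  proof (intro exI[of _ "- (\<bar>B\<bar> + 1)"] allI impI)
    fix w z assume w: "Re w < - (\<bar>B\<bar> + 1)" and z: "poly F z = w"
    have "norm w > B" using w abs_Re_le_cmod[of w] by linarith
    then have zM: "norm z > M" using B[of z] z by force
    have w0: "w \<noteq> 0" using w by auto
    have z1: "norm z \<ge> 1" "norm z \<ge> R" "norm z > 2 * C / e ^ d" using zM R(1) unfolding M_def by auto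
    have nz: "norm z > 0" using z1 by linarith
    have "(z / rt w) ^ d + 1 = - poly lower z / (of_nat d * w)"
      using w0 dpos z by (simp add: power_divide left_root_power lower_eq field_simps)
    then have "norm ((z / rt w) ^ d + 1) = norm (poly lower z) / (d * norm w)"
      by (simp add: norm_divide norm_mult)
    also have "\<dots> \<le> C * norm z ^ (d - 1) / (norm z ^ d / 2)"
      using C z1 R(2)[of z] z nz by (intro frac_le) auto
    also have "\<dots> = 2 * C / norm z"
      using nz dpos by (cases d) (auto simp: field_simps)
    also have "\<dots> < e ^ d"
      using z1(3) nz e C(1) by (simp add: field_simps)
    finally show "\<exists>a\<in>{1..d}. norm (z / rt w - vd a) < e"
      by (intro near_valley_dir[OF dpos _ e])
  qed
qed

text \<open>Conversely \<open>valley_dir d a * left_root d w\<close> almost solves \<open>F z = w\<close>, so a true solution is near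
  it.\<close>

lemma ex_preimage_near_valley:
  assumes e: "e > 0"
  shows "\<forall>\<^sub>F w in far_left. \<forall>a. \<exists>z. poly F z = w \<and> norm (z / rt w - vd a) < e"
proof -
  obtain C where C: "C > 0" "\<And>z. norm z \<ge> 1 \<Longrightarrow> norm (poly lower z) \<le> C * norm z ^ (d - 1)"
    using lower_bound by metis
  define M where "M = max 1 (C / e ^ d + 1)"
  show ?thesis unfolding eventually_far_left
  proof (intro exI[of _ "- (M ^ d)"] allI impI)
    fix w a assume w: "Re w < - (M ^ d)"
    have M1: "M \<ge> 1" "M > C / e ^ d" unfolding M_def by auto
    have w0: "w \<noteq> 0" using w M1(1) by (auto simp: not_less)
    have "M ^ d \<le> norm w" using w abs_Re_le_cmod[of w] by linarith
    also have "\<dots> \<le> d * norm w" using dpos by (simp add: mult_right_mono[of 1 "real d", simplified])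
    also have "\<dots> = norm (rt w) ^ d" using norm_left_root_power[OF dpos w0] by simp
    finally have rM: "M \<le> norm (rt w)" using M1(1) dpos by (simp add: power_mono_iff)
    let ?x = "vd a * rt w"
    have nx: "norm ?x = norm (rt w)" by (simp add: norm_mult)
    have "?x ^ d = of_nat d * w"
      using left_root_power[OF dpos w0] by (simp add: power_mult_distrib valley_dir_power[OF dpos])
    then have "poly (F - [:w:]) ?x = - poly lower ?x / of_nat d"
      using dpos by (simp add: lower_eq field_simps)
    then have "norm (poly (F - [:w:]) ?x) = norm (poly lower ?x) / d" by (simp add: norm_divide)
    also have "\<dots> \<le> C * norm (rt w) ^ (d - 1) / d"
      using C(2)[of ?x] nx rM M1(1) by (intro divide_right_mono) auto
    also have "\<dots> < norm (rt w) * e ^ d * norm (rt w) ^ (d - 1) / d"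
    proof -
      have "C < norm (rt w) * e ^ d" using M1(2) rM e by (simp add: pos_divide_less_eq)
          (meson e less_le_trans mult_right_mono zero_less_power less_imp_le)
      then show ?thesis using dpos by (intro divide_strict_right_mono mult_strict_right_mono) auto
    qed
    also have "\<dots> = norm (1 / of_nat d :: complex) * (e * norm (rt w)) ^ d"
    proof -
      have "norm (1 / of_nat d :: complex) = 1 / d" by (simp add: norm_divide)
      moreover have "norm (rt w) ^ d = norm (rt w) * norm (rt w) ^ (d - 1)"
        using dpos by (metis power_eq_if less_irrefl)
      ultimately show ?thesis by (simp add: power_mult_distrib)
    qed
    finally have "norm (poly (F - [:w:]) ?x) < norm (lead_coeff (F - [:w:])) * (e * norm (rt w)) ^ degree (F - [:w:])"
      using poly_minus_const[OF degpos, of w] by (simp add: deg lead)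
    from poly_near_root[OF _ this] obtain z where z: "poly F z = w" "norm (?x - z) < e * norm (rt w)"
      using poly_minus_const[OF degpos, of w] degpos e by auto
    have "norm (z / rt w - vd a) = norm (z - ?x) / norm (rt w)"
      by (simp add: norm_divide[symmetric] diff_divide_distrib)
    also have "\<dots> < e" using z(2) by (simp add: norm_minus_commute divide_less_eq)
    finally show "\<exists>z. poly F z = w \<and> norm (z / rt w - vd a) < e" using z(1) by blast
  qed
qed

end

section \<open>Inverse branches over the slit plane\<close>

text \<open>The points of \<open>D\<close> whose image is nearest to a given element of \<open>Z\<close> form a clopen set.\<close>

lemma continuous_near_finite_set:
  fixes q :: "'a::topological_space \<Rightarrow> 'b::metric_space"
  assumes D: "connected D" "continuous_on D q" and Z: "\<forall>x\<in>Z. \<forall>y\<in>Z. dist x y < e \<longrightarrow> x = y"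
    and near: "\<And>v. v \<in> D \<Longrightarrow> \<exists>z\<in>Z. dist (q v) z < e / 2"
    and v0: "v0 \<in> D" "z0 \<in> Z" "dist (q v0) z0 < e / 2" and v: "v \<in> D"
  shows "dist (q v) z0 < e / 2"
proof -
  define U where "U z = D \<inter> q -` ball z (e / 2)" for z
  have oU: "openin (top_of_set D) (U z)" for z
    unfolding U_def by (rule continuous_openin_preimage_gen[OF D(2)]) auto
  have U: "v \<in> U z \<longleftrightarrow> v \<in> D \<and> dist (q v) z < e / 2" for v z
    unfolding U_def by (auto simp: dist_commute)
  have disj: "z = z0" if z: "z \<in> Z" "v \<in> U z" "v \<in> U z0" for z v
  proof -
    have "dist z z0 < e" using z(2,3) unfolding U by (metis dist_commute dist_triangle_half_l)
    then show ?thesis using Z[rule_format, OF z(1) v0(2)] by blast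
  qed
  have "D - U z0 = (\<Union>z\<in>Z - {z0}. U z)"
  proof (intro equalityI subsetI)
    fix v assume "v \<in> D - U z0"
    then show "v \<in> (\<Union>z\<in>Z - {z0}. U z)" using near[of v] U by blast
  next
    fix v assume "v \<in> (\<Union>z\<in>Z - {z0}. U z)"
    then obtain z where "z \<in> Z" "z \<noteq> z0" "v \<in> U z" by blast
    then show "v \<in> D - U z0" using disj U by blast
  qed
  then have "openin (top_of_set D) (D - U z0)" using oU by auto
  then have "closedin (top_of_set D) (U z0)" by (simp add: closedin_def U_def)
  then have "U z0 = {} \<or> U z0 = D" using oU D(1) connected_clopen by blast
  then show ?thesis using v0 v U by blast
qed

context normalized_poly begin

abbreviation dF where "dF \<equiv> pderiv F"

definition crit_values where "crit_values = poly F ` {z. poly dF z = 0}"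

text \<open>The plane cut along the horizontal rays going to the right from all critical values. Horizontal
  segments are images of pieces of orbits, and every point of the slit plane can be reached
  from the far left along such a segment.\<close>

definition slit_plane where
  "slit_plane = {w. \<forall>c\<in>crit_values. Im w = Im c \<longrightarrow> Re w < Re c}"

lemma finite_crit_values: "finite crit_values"
  unfolding crit_values_def using finite_critical_points[OF degpos] by blast

lemma crit_values_disjoint: "slit_plane \<inter> crit_values = {}"
  unfolding slit_plane_def by auto

lemma noncritical_over_slit_plane: "poly F z \<in> slit_plane \<Longrightarrow> poly dF z \<noteq> 0"
  using crit_values_disjoint unfolding crit_values_def by auto

lemma open_slit_plane: "open slit_plane"
proof -
  have "slit_plane = (\<Inter>c\<in>crit_values. - ({w. Im w = Im c} \<inter> {w. Re c \<le> Re w}))"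
    unfolding slit_plane_def by (auto simp: not_less not_le)
  moreover have "closed ({w. Im w = Im c} \<inter> {w. Re c \<le> Re w})" for c
    by (intro closed_Int closed_Collect_eq closed_Collect_le continuous_intros)
  ultimately show ?thesis using finite_crit_values by (metis (no_types, lifting) open_Compl open_INT)
qed

lemma slit_plane_left: "w \<in> slit_plane \<Longrightarrow> Im w' = Im w \<Longrightarrow> Re w' \<le> Re w \<Longrightarrow> w' \<in> slit_plane"
  unfolding slit_plane_def by force

lemma ex_left_half_plane: "\<exists>R. {w. Re w < R} \<subseteq> slit_plane"
proof -
  have "\<exists>R. \<forall>c\<in>Re ` crit_values. R \<le> c"
    using bdd_below_finite[of "Re ` crit_values"] finite_crit_values by (auto simp: bdd_below_def)
  then obtain R where "\<And>c. c \<in> crit_values \<Longrightarrow> R \<le> Re c" by auto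
  then have "{w. Re w < R} \<subseteq> slit_plane" unfolding slit_plane_def by force
  then show ?thesis by blast
qed

lemma contractible_slit_plane: "contractible slit_plane"
proof -
  obtain R where R: "{w. Re w < R} \<subseteq> slit_plane" using ex_left_half_plane by blast
  define w0 where "w0 = complex_of_real (R - 1)"
  \<comment> \<open>Sliding to the left stays in the slit plane, and \<open>p\<close> slides every point at least to the line
    \<open>Re w = R - 1\<close>, into a half-plane that can then be contracted linearly.\<close>
  define p where "p w = Complex (min (Re w) (R - 1)) (Im w)" for w
  have p: "p ` slit_plane \<subseteq> {w. Re w < R}" by (auto simp: p_def)
  have cp: "continuous_on S p" for S
    unfolding p_def Complex_eq by (intro continuous_intros)
  have 1: "homotopic_with_canon (\<lambda>_. True) slit_plane slit_plane id p"
  proof (rule homotopic_with_linear)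
    show "continuous_on slit_plane id" by (rule continuous_on_id')
    show "continuous_on slit_plane p" by (rule cp)
    fix w assume w: "w \<in> slit_plane"
    show "closed_segment (id w) (p w) \<subseteq> slit_plane"
    proof
      fix v assume "v \<in> closed_segment (id w) (p w)"
      then obtain u where u: "0 \<le> u" "u \<le> 1" "v = (1 - u) *\<^sub>R w + u *\<^sub>R p w"
        by (auto simp: in_segment)
      have "Im v = Im w" unfolding u(3) p_def by (simp add: algebra_simps)
      moreover have "Re v \<le> Re w"
      proof -
        have "u * min (Re w) (R - 1) \<le> u * Re w" using u by (intro mult_left_mono) auto
        then show ?thesis unfolding u(3) p_def by (simp add: algebra_simps)
      qed
      ultimately show "v \<in> slit_plane" using slit_plane_left w by blast
    qed
  qed
  have conv: "convex {w. Re w < R}" by (rule convex_halfspace_Re_lt)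
  have 2: "homotopic_with_canon (\<lambda>_. True) slit_plane slit_plane p (\<lambda>_. w0)"
  proof (rule homotopic_with_linear)
    show "continuous_on slit_plane p" by (rule cp)
    fix w assume w: "w \<in> slit_plane"
    have "closed_segment (p w) w0 \<subseteq> {w. Re w < R}"
      by (rule closed_segment_subset[OF _ _ conv]) (use p w in \<open>auto simp: w0_def\<close>)
    then show "closed_segment (p w) w0 \<subseteq> slit_plane" using R by blast
  qed auto
  show ?thesis unfolding contractible_def using homotopic_with_trans[OF 1 2] by blast
qed

lemma simply_connected_slit_plane: "simply_connected slit_plane"
  by (rule contractible_imp_simply_connected[OF contractible_slit_plane])

lemma connected_slit_plane: "connected slit_plane"
  by (rule simply_connected_imp_connected[OF simply_connected_slit_plane])

definition inverse_branch :: "(complex \<Rightarrow> complex) \<Rightarrow> bool" where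
  "inverse_branch g \<longleftrightarrow> continuous_on slit_plane g \<and> (\<forall>w\<in>slit_plane. poly F (g w) = w)"

lemma ex_inverse_branch:
  assumes "poly F z \<in> slit_plane"
  obtains g where "inverse_branch g" "g (poly F z) = z"
proof -
  let ?S = "- poly F ` {z. poly dF z = 0}"
  have sub: "slit_plane \<subseteq> ?S" using crit_values_disjoint unfolding crit_values_def by blast
  have cov: "covering_space (poly F -` ?S) (poly F) ?S" by (rule poly_covering_space[OF degpos])
  have z: "z \<in> poly F -` ?S" using assms sub by blast
  obtain g where g: "continuous_on slit_plane g" "\<And>y. y \<in> slit_plane \<Longrightarrow> poly F (g y) = id y"
      "g (poly F z) = z"
    using covering_space_lift_strong[OF cov z assms simply_connected_slit_plane
        open_imp_locally_path_connected[OF open_slit_plane] continuous_on_id'] sub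
    by (metis Pi_I id_apply subsetD)
  then show ?thesis by (intro that[of g]) (auto simp: inverse_branch_def)
qed

lemma inverse_branch_unique:
  assumes "inverse_branch g" "inverse_branch h" "w0 \<in> slit_plane" "g w0 = h w0" "w \<in> slit_plane"
  shows "g w = h w"
  by (rule poly_lift_unique[of slit_plane g h F w0 w])
    (use assms connected_slit_plane noncritical_over_slit_plane in \<open>auto simp: inverse_branch_def\<close>)

lemma inverse_branch_holomorphic:
  assumes "inverse_branch g" shows "g holomorphic_on slit_plane"
proof -
  let ?S = "- poly F ` {z. poly dF z = 0}"
  have sub: "slit_plane \<subseteq> ?S" using crit_values_disjoint unfolding crit_values_def by blast
  have cov: "covering_space (poly F -` ?S) (poly F) ?S" by (rule poly_covering_space[OF degpos])
  have "closed (poly F ` {z. poly dF z = 0})"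
    using finite_crit_values unfolding crit_values_def by (rule finite_imp_closed)
  then have op: "open (poly F -` ?S)" by (intro open_vimage open_Compl continuous_intros)
  show ?thesis
    by (rule covering_space_lift_is_holomorphic[OF cov op _ holomorphic_on_id])
      (use assms sub in \<open>auto simp: inverse_branch_def intro!: holomorphic_intros\<close>)
qed

text \<open>On the scale \<open>left_root\<close> the fibre of a point far to the left has \<open>d\<close> different limit positions, one for
  each valley, so this limit labels the branch by a vertex.\<close>

definition from_valley :: "nat \<Rightarrow> (complex \<Rightarrow> complex) \<Rightarrow> bool" where
  "from_valley a g \<longleftrightarrow> ((\<lambda>w. g w / rt w) \<longlongrightarrow> vd a) far_left"

lemma from_valley_unique:
  "from_valley a g \<Longrightarrow> from_valley b g \<Longrightarrow> a \<in> {1..d} \<Longrightarrow> b \<in> {1..d} \<Longrightarrow> a = b"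
  unfolding from_valley_def using tendsto_unique[OF far_left_neq_bot] inj_valley_dir[OF dpos]
  by (meson inj_onD)

text \<open>Start the branch, far to the left, at the preimage near the valley \<open>a\<close>. The nearest valley
  direction cannot change along a half-plane, and the approximation improves as \<open>Re w\<close> decreases.\<close>

lemma ex_inverse_branch_from_valley:
  assumes a: "a \<in> {1..d}" shows "\<exists>g. inverse_branch g \<and> from_valley a g"
proof -
  obtain e0 where e0: "e0 > 0" "\<forall>x\<in>vd ` {1..d}. \<forall>y\<in>vd ` {1..d}. dist x y < e0 \<longrightarrow> x = y"
    using finite_set_separated[of "vd ` {1..d}"] by auto
  define e where "e = e0 / 2"
  have e: "e > 0" using e0(1) by (simp add: e_def)
  obtain R1 where R1: "{w. Re w < R1} \<subseteq> slit_plane" using ex_left_half_plane by blast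
  obtain R2 where R2: "\<And>w z. Re w < R2 \<Longrightarrow> poly F z = w \<Longrightarrow> \<exists>a\<in>{1..d}. norm (z / rt w - vd a) < e"
    using preimage_near_valley[OF e] unfolding eventually_far_left by blast
  obtain R3 where R3: "\<And>w a. Re w < R3 \<Longrightarrow> \<exists>z. poly F z = w \<and> norm (z / rt w - vd a) < e"
    using ex_preimage_near_valley[OF e] unfolding eventually_far_left by blast
  define R where "R = min 0 (min R1 (min R2 R3))"
  let ?L = "{w. Re w < R}"
  have L: "?L \<subseteq> slit_plane" using R1 unfolding R_def by auto
  have conn: "connected ?L" by (rule convex_connected[OF convex_halfspace_Re_lt])
  define w where "w = complex_of_real (R - 1)"
  have w: "Re w < R" by (simp add: w_def)
  obtain z where z: "poly F z = w" "norm (z / rt w - vd a) < e"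
    using R3[of w a] w unfolding R_def by auto
  have "poly F z \<in> slit_plane" using z(1) w L by blast
  then obtain g where g: "inverse_branch g" "g (poly F z) = z" by (rule ex_inverse_branch)
  have near: "norm (g w / rt w - vd a) < e" using g z by simp
  have val: "from_valley a g"
  proof -
    define q where "q w = g w / rt w" for w
    have cq: "continuous_on ?L q"
      using g(1) L continuous_on_subset[OF continuous_left_root[OF dpos], of ?L]
      unfolding q_def inverse_branch_def R_def
      by (intro continuous_intros) (auto intro: continuous_on_subset)
    have gF: "poly F (g v) = v" if "Re v < R" for v using g(1) L that unfolding inverse_branch_def by auto
    have qa: "dist (q v) (vd a) < e" if v: "Re v < R" for v
      unfolding e_def
    proof (rule continuous_near_finite_set[OF conn cq e0(2)])
      fix v assume "v \<in> ?L"
      then show "\<exists>z\<in>vd ` {1..d}. dist (q v) z < e0 / 2"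
        using R2[of v "g v"] gF[of v] unfolding q_def R_def e_def dist_norm by auto
    qed (use a w near v in \<open>auto simp: q_def e_def dist_norm\<close>)
    show "from_valley a g" unfolding from_valley_def
    proof (rule tendstoI)
      fix \<eta> :: real assume \<eta>: "\<eta> > 0"
      have "\<forall>\<^sub>F w in far_left. \<forall>z. poly F z = w \<longrightarrow> (\<exists>a\<in>{1..d}. norm (z / rt w - vd a) < min \<eta> e)"
        by (rule preimage_near_valley) (use \<eta> e in auto)
      moreover have "\<forall>\<^sub>F w in far_left. Re w < R" unfolding eventually_far_left by blast
      ultimately show "\<forall>\<^sub>F w in far_left. dist (g w / rt w) (vd a) < \<eta>"
      proof eventually_elim
        case (elim w)
        obtain b where b: "b \<in> {1..d}" "norm (q w - vd b) < min \<eta> e"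
          using elim(1) gF[OF elim(2)] unfolding q_def by blast
        have "dist (vd a) (vd b) < e0"
          using qa[OF elim(2)] b(2)
          by (rule_tac dist_triangle_half_r[of "q w"]) (auto simp: e_def dist_norm)
        then have "vd a = vd b" using e0(2)[rule_format, of "vd a" "vd b"] a b(1) by simp
        then show ?case using b(2) unfolding q_def dist_norm by simp
      qed
    qed
  qed
  show ?thesis using g(1) val by blast
qed

text \<open>The values outside the slit plane are arbitrary; on the slits \<open>side_value\<close> below replaces them.\<close>

definition branch :: "nat \<Rightarrow> complex \<Rightarrow> complex" where
  "branch a = (SOME g. inverse_branch g \<and> from_valley a g)"

lemma branch:
  assumes "a \<in> {1..d}" shows "inverse_branch (branch a)" "from_valley a (branch a)"
  using someI_ex[OF ex_inverse_branch_from_valley[OF assms]] unfolding branch_def by auto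

lemma poly_branch: "a \<in> {1..d} \<Longrightarrow> w \<in> slit_plane \<Longrightarrow> poly F (branch a w) = w"
  using branch(1) unfolding inverse_branch_def by blast

lemma continuous_branch: "a \<in> {1..d} \<Longrightarrow> continuous_on slit_plane (branch a)"
  using branch(1) unfolding inverse_branch_def by blast

text \<open>Two branches that meet coincide, hence come out of the same valley.\<close>

lemma branch_inj:
  assumes "a \<in> {1..d}" "b \<in> {1..d}" "w \<in> slit_plane" "branch a w = branch b w"
  shows "a = b"
proof -
  have eq: "branch a v = branch b v" if "v \<in> slit_plane" for v
    using inverse_branch_unique[OF branch(1)[OF assms(1)] branch(1)[OF assms(2)] assms(3,4) that] .
  obtain R where R: "{w. Re w < R} \<subseteq> slit_plane" using ex_left_half_plane by blast
  have "\<forall>\<^sub>F w in far_left. branch a w / rt w = branch b w / rt w"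
    unfolding eventually_far_left using R eq by (intro exI[of _ R]) auto
  then have "from_valley b (branch a)"
    using branch(2)[OF assms(2)] unfolding from_valley_def by (rule tendsto_cong[THEN iffD2])
  then show ?thesis using from_valley_unique branch(2) assms by blast
qed

lemma branch_surj:
  assumes "poly F z \<in> slit_plane" shows "\<exists>a\<in>{1..d}. branch a (poly F z) = z"
proof -
  \<comment> \<open>The \<open>d\<close> branches take distinct values in a fibre, which has at most \<open>d\<close> points.\<close>
  let ?w = "poly F z" let ?Z = "{z'. poly F z' = ?w}"
  have "(\<lambda>b. branch b ?w) ` {1..d} = ?Z"
  proof (rule card_seteq[OF finite_poly_fibre[OF degpos]])
    show "(\<lambda>b. branch b ?w) ` {1..d} \<subseteq> ?Z" using poly_branch assms by auto
    have "inj_on (\<lambda>b. branch b ?w) {1..d}" using branch_inj assms by (intro inj_onI) blast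
    then have "card ((\<lambda>b. branch b ?w) ` {1..d}) = d" by (simp add: card_image)
    moreover have "card ?Z \<le> d"
    proof -
      have "F - [:?w:] \<noteq> 0" using poly_minus_const(1)[OF degpos, of ?w] degpos by force
      from card_poly_roots_bound[OF this] show ?thesis
        using poly_minus_const(1)[OF degpos, of ?w] deg by simp
    qed
    ultimately show "card ?Z \<le> card ((\<lambda>b. branch b ?w) ` {1..d})" by simp
  qed
  then show ?thesis by (auto simp: set_eq_iff image_iff) metis
qed

end

section \<open>Boundary values of the branches on the slits\<close>

text \<open>The sign \<open>s\<close>, which is always \<open>1\<close> or \<open>-1\<close>, selects the half-plane above or below the horizontal
  line through \<open>w\<close>.\<close>

definition open_side :: "real \<Rightarrow> complex \<Rightarrow> complex set" where
  "open_side s w = {v. s * (Im v - Im w) > 0}"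

definition closed_side :: "real \<Rightarrow> complex \<Rightarrow> complex set" where
  "closed_side s w = {v. s * (Im v - Im w) \<ge> 0}"

lemma convex_open_side: "convex (open_side s w)"
proof -
  have "open_side s w = {v. inner (Complex 0 s) v > s * Im w}"
    by (auto simp: open_side_def inner_complex_def algebra_simps)
  then show ?thesis by (simp add: convex_halfspace_gt)
qed

lemma open_side_point:
  assumes s: "s \<in> {1, -1}" and r: "r > 0"
  shows "\<exists>v\<in>open_side s w \<inter> ball w r. v \<noteq> w"
proof (intro bexI conjI)
  let ?v = "w + \<i> * of_real (s * r / 2)"
  show "?v \<noteq> w" using s r by auto
  show "?v \<in> open_side s w \<inter> ball w r"
    using s r by (auto simp: open_side_def dist_norm norm_mult)
qed

lemma open_side_neq_bot:
  assumes "s \<in> {1, -1}" shows "at w within open_side s w \<noteq> bot"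
proof -
  have "w islimpt open_side s w"
    unfolding islimpt_approachable
  proof (intro allI impI)
    fix e :: real assume "e > 0"
    then obtain v where "v \<in> open_side s w \<inter> ball w e" "v \<noteq> w" using open_side_point[OF assms] by blast
    then show "\<exists>v\<in>open_side s w. v \<noteq> w \<and> dist v w < e" by (auto simp: dist_commute)
  qed
  then show ?thesis by (simp add: trivial_limit_within)
qed

lemma open_side_subset: "v \<in> closed_side s w \<Longrightarrow> open_side s v \<subseteq> open_side s w"
  by (auto simp: open_side_def closed_side_def algebra_simps)

lemma open_side_closed_side: "open_side s w \<subseteq> closed_side s w"
  by (auto simp: open_side_def closed_side_def)

context normalized_poly begin

text \<open>There are finitely many critical heights, so a small disc meets the slits only on its horizontal
  diameter.\<close>

lemma half_disc_avoids_heights: "\<exists>r>0. \<forall>s. \<forall>v\<in>open_side s w \<inter> ball w r. Im v \<notin> Im ` crit_values"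
proof -
  have "finite (Im ` crit_values)" using finite_crit_values by simp
  then obtain r where r: "r > 0" "\<forall>x\<in>Im ` crit_values. x \<noteq> Im w \<longrightarrow> r \<le> dist (Im w) x"
    using finite_set_avoid by meson
  have "Im v \<notin> Im ` crit_values" if v: "v \<in> open_side s w" "v \<in> ball w r" for s v
  proof -
    have "Im v \<noteq> Im w" using v(1) by (auto simp: open_side_def)
    moreover have "dist (Im w) (Im v) < r"
      using v(2) abs_Im_le_cmod[of "w - v"] by (simp add: dist_norm)
    ultimately show ?thesis using r(2) by fastforce
  qed
  then show ?thesis using r(1) by blast
qed

lemma off_heights_slit_plane: "Im v \<notin> Im ` crit_values \<Longrightarrow> v \<in> slit_plane"
  unfolding slit_plane_def by auto

lemma half_disc_subset_slit_plane: "\<exists>r>0. \<forall>s. open_side s w \<inter> ball w r \<subseteq> slit_plane"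
  using half_disc_avoids_heights[of w] off_heights_slit_plane by (meson subsetI)

text \<open>The boundary value of the branch \<open>a\<close> at \<open>w\<close>, approached from above (\<open>s = 1\<close>) or from below
  (\<open>s = -1\<close>). Off the slits the two agree with the branch; on a slit they may differ, and
  how they differ is the gluing pattern that determines the polynomial.\<close>

definition side_value :: "real \<Rightarrow> nat \<Rightarrow> complex \<Rightarrow> complex" where
  "side_value s a w = Lim (at w within open_side s w) (branch a)"

text \<open>Near \<open>w\<close> the branch takes values near the finite fibre of \<open>w\<close>, and a half-disc is connected, so it
  stays near one point of the fibre. This works at critical values too.\<close>

lemma ex_side_limit:
  assumes a: "a \<in> {1..d}" and s: "s \<in> {1, -1}"
  shows "\<exists>z. poly F z = w \<and> (branch a \<longlongrightarrow> z) (at w within open_side s w)"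
proof -
  let ?Z = "{z. poly F z = w}"
  obtain e where e: "e > 0" "\<forall>x\<in>?Z. \<forall>y\<in>?Z. dist x y < e \<longrightarrow> x = y"
    using finite_set_separated[OF finite_poly_fibre[OF degpos]] by metis
  have e2: "e / 2 > 0" using e(1) by simp
  obtain r where r: "r > 0" "open_side s w \<inter> ball w r \<subseteq> slit_plane"
    using half_disc_subset_slit_plane by blast
  have near: "\<exists>\<delta>>0. \<forall>v\<in>open_side s w \<inter> ball w r \<inter> ball w \<delta>. \<exists>z\<in>?Z. dist (branch a v) z < \<eta>" if "\<eta> > 0" for \<eta>
  proof -
    obtain \<delta> where \<delta>: "\<delta> > 0" "\<And>z. norm (poly F z - w) < \<delta> \<Longrightarrow> \<exists>z0. poly F z0 = w \<and> norm (z - z0) < \<eta>"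
      using poly_preimage_near[OF degpos \<open>\<eta> > 0\<close>] by metis
    show ?thesis
    proof (intro exI conjI ballI)
      show "\<delta> > 0" by (rule \<delta>(1))
      fix v assume v: "v \<in> open_side s w \<inter> ball w r \<inter> ball w \<delta>"
      then have "poly F (branch a v) = v" using poly_branch[OF a] r(2) by blast
      then show "\<exists>z\<in>?Z. dist (branch a v) z < \<eta>"
        using \<delta>(2)[of "branch a v"] v by (auto simp: dist_norm norm_minus_commute)
    qed
  qed
  obtain \<delta> where \<delta>: "\<delta> > 0" "\<And>v. v \<in> open_side s w \<inter> ball w r \<inter> ball w \<delta> \<Longrightarrow> \<exists>z\<in>?Z. dist (branch a v) z < e / 2"
    using near[OF e2] by blast
  let ?D = "open_side s w \<inter> ball w (min r \<delta>)"
  have D: "connected ?D" "?D \<subseteq> slit_plane" "?D \<subseteq> open_side s w \<inter> ball w r \<inter> ball w \<delta>"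
    using r(2) by (auto intro!: convex_connected convex_Int convex_open_side)
  have cb: "continuous_on ?D (branch a)" by (rule continuous_on_subset[OF continuous_branch[OF a] D(2)])
  obtain v0 where v0: "v0 \<in> ?D" using open_side_point[OF s, of "min r \<delta>" w] r(1) \<delta>(1) by auto
  then obtain z0 where z0: "z0 \<in> ?Z" "dist (branch a v0) z0 < e / 2" using \<delta>(2) D(3) by blast
  have z0': "dist (branch a v) z0 < e / 2" if "v \<in> ?D" for v
    using continuous_near_finite_set[OF D(1) cb e(2) _ v0 z0 that] \<delta>(2) D(3) by blast
  have "(branch a \<longlongrightarrow> z0) (at w within open_side s w)"
  proof (rule tendstoI)
    fix \<eta> :: real assume "\<eta> > 0"
    then have "min \<eta> (e / 2) > 0" using e2 by simp
    then obtain \<delta>' where \<delta>': "\<delta>' > 0" "\<And>v. v \<in> open_side s w \<inter> ball w r \<inter> ball w \<delta>' \<Longrightarrow> \<exists>z\<in>?Z. dist (branch a v) z < min \<eta> (e / 2)"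
      using near by blast
    show "\<forall>\<^sub>F v in at w within open_side s w. dist (branch a v) z0 < \<eta>"
      unfolding eventually_at
    proof (intro exI conjI ballI impI)
      show "min (min r \<delta>) \<delta>' > 0" using r \<delta> \<delta>' by simp
      fix v assume v: "v \<in> open_side s w" "v \<noteq> w \<and> dist v w < min (min r \<delta>) \<delta>'"
      then have vD: "v \<in> ?D" "v \<in> open_side s w \<inter> ball w r \<inter> ball w \<delta>'" by (auto simp: dist_commute)
      obtain z where z: "z \<in> ?Z" "dist (branch a v) z < min \<eta> (e / 2)" using \<delta>'(2)[OF vD(2)] by blast
      have "dist z z0 < e"
        using z(2) z0'[OF vD(1)] by (rule_tac dist_triangle_half_r[of "branch a v"]) auto
      then have "z = z0" using e(2)[rule_format, OF z(1) z0(1)] by blast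
      then show "dist (branch a v) z0 < \<eta>" using z(2) by simp
    qed
  qed
  then show ?thesis using z0(1) by blast
qed

lemma side_value:
  assumes a: "a \<in> {1..d}" and s: "s \<in> {1, -1}"
  shows "poly F (side_value s a w) = w" "(branch a \<longlongrightarrow> side_value s a w) (at w within open_side s w)"
proof -
  obtain z where z: "poly F z = w" "(branch a \<longlongrightarrow> z) (at w within open_side s w)"
    using ex_side_limit[OF assms] by blast
  have "side_value s a w = z" unfolding side_value_def
    by (rule tendsto_Lim[OF open_side_neq_bot[OF s] z(2)])
  then show "poly F (side_value s a w) = w" "(branch a \<longlongrightarrow> side_value s a w) (at w within open_side s w)"
    using z by auto
qed

lemma side_value_eq_branch:
  assumes a: "a \<in> {1..d}" and s: "s \<in> {1, -1}" and w: "w \<in> slit_plane"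
  shows "side_value s a w = branch a w"
proof -
  have "isCont (branch a) w"
    using continuous_branch[OF a] open_slit_plane w continuous_on_eq_continuous_at by blast
  then have "(branch a \<longlongrightarrow> branch a w) (at w within open_side s w)"
    unfolding isCont_def by (rule tendsto_within_subset[OF _ subset_UNIV])
  then show ?thesis using side_value(2)[OF a s] tendsto_unique[OF open_side_neq_bot[OF s]] by blast
qed

lemma side_value_tendsto:
  assumes a: "a \<in> {1..d}" and s: "s \<in> {1, -1}"
  shows "(side_value s a \<longlongrightarrow> side_value s a w) (at w within closed_side s w)"
proof (rule tendstoI)
  fix \<epsilon> :: real assume \<epsilon>: "\<epsilon> > 0"
  have "\<forall>\<^sub>F v in at w within open_side s w. dist (branch a v) (side_value s a w) < \<epsilon> / 2"
    using side_value(2)[OF a s, of w] \<epsilon> by (intro tendstoD) auto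
  then obtain r where r: "r > 0" "\<And>v. v \<in> open_side s w \<Longrightarrow> v \<noteq> w \<Longrightarrow> dist v w < r \<Longrightarrow> dist (branch a v) (side_value s a w) < \<epsilon> / 2"
    unfolding eventually_at by blast
  have "dist (side_value s a v) (side_value s a w) < \<epsilon>" if v: "v \<in> closed_side s w" "dist v w < r" for v
  proof -
    have "\<forall>\<^sub>F u in at v within open_side s v. dist u w < r"
    proof -
      have "\<forall>\<^sub>F u in at v. u \<in> ball w r"
        using v(2) by (intro eventually_at_in_open') (auto simp: dist_commute)
      then have "\<forall>\<^sub>F u in at v within open_side s v. u \<in> ball w r"
        by (rule filter_leD[OF at_le[OF subset_UNIV]])
      then show ?thesis by (simp add: dist_commute)
    qed
    moreover have "\<forall>\<^sub>F u in at v within open_side s v. u \<in> open_side s v"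
      by (simp add: eventually_at_filter)
    ultimately have "\<forall>\<^sub>F u in at v within open_side s v. dist (branch a u) (side_value s a w) \<le> \<epsilon> / 2"
    proof eventually_elim
      case (elim u)
      have "u \<in> open_side s w" using elim(2) open_side_subset[OF v(1)] by blast
      moreover from this have "u \<noteq> w" by (auto simp: open_side_def)
      ultimately show ?case using r(2)[of u] elim(1) by simp
    qed
    moreover have "((\<lambda>u. dist (branch a u) (side_value s a w)) \<longlongrightarrow> dist (side_value s a v) (side_value s a w))
        (at v within open_side s v)"
      by (intro tendsto_dist tendsto_const side_value(2)[OF a s])
    ultimately have "dist (side_value s a v) (side_value s a w) \<le> \<epsilon> / 2"
      using open_side_neq_bot[OF s, of v] by (intro tendsto_upperbound[where F = "at v within open_side s v"])
    then show ?thesis using \<epsilon> by simp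
  qed
  then show "\<forall>\<^sub>F v in at w within closed_side s w. dist (side_value s a v) (side_value s a w) < \<epsilon>"
    unfolding eventually_at using r(1) by blast
qed

lemma continuous_on_line_side_value:
  assumes a: "a \<in> {1..d}" and s: "s \<in> {1, -1}"
  shows "continuous_on {v. Im v = y} (side_value s a)"
  unfolding continuous_on_def
proof
  fix w assume "w \<in> {v. Im v = y}"
  then have "{v. Im v = y} \<subseteq> closed_side s w" by (auto simp: closed_side_def)
  then show "(side_value s a \<longlongrightarrow> side_value s a w) (at w within {v. Im v = y})"
    by (rule tendsto_within_subset[OF side_value_tendsto[OF a s]])
qed

lemma continuous_on_side_value:
  fixes \<gamma> :: "'a::topological_space \<Rightarrow> complex"
  assumes a: "a \<in> {1..d}" and s: "s \<in> {1, -1}" and \<gamma>: "continuous_on S \<gamma>"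
    and h: "\<And>x. x \<in> S \<Longrightarrow> Im (\<gamma> x) = y"
  shows "continuous_on S (\<lambda>x. side_value s a (\<gamma> x))"
  by (rule continuous_on_compose2[OF continuous_on_line_side_value[OF a s, of y] \<gamma>]) (use h in auto)

text \<open>The boundary values are continuous along horizontal lines, in general not across them, so uniqueness of
  lifts applies to every path whose image under \<open>F\<close> stays on one horizontal line, such as an
  orbit.\<close>

lemma lift_eq_side_value:
  fixes \<gamma> :: "'a::topological_space \<Rightarrow> complex"
  assumes a: "a \<in> {1..d}" and s: "s \<in> {1, -1}" and S: "connected S" and \<gamma>: "continuous_on S \<gamma>"
    and h: "\<And>x. x \<in> S \<Longrightarrow> Im (poly F (\<gamma> x)) = y"
    and nz: "\<And>x. x \<in> S \<Longrightarrow> poly dF (\<gamma> x) \<noteq> 0"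
    and x0: "x0 \<in> S" "\<gamma> x0 = side_value s a (poly F (\<gamma> x0))" and x: "x \<in> S"
  shows "\<gamma> x = side_value s a (poly F (\<gamma> x))"
proof (rule poly_lift_unique[OF S \<gamma>, where F = F and a = x0])
  show "continuous_on S (\<lambda>x. side_value s a (poly F (\<gamma> x)))"
    by (rule continuous_on_side_value[OF a s]) (use \<gamma> h in \<open>auto intro!: continuous_intros\<close>)
qed (use side_value(1)[OF a s] nz x0 x in auto)

end

section \<open>Branches near a simple critical point\<close>

text \<open>At a simple critical point \<open>F - F z\<close> is \<open>(x - z) ^ 2\<close> times a polynomial that does not vanish at \<open>z\<close>
  and so has a holomorphic square root nearby.\<close>

lemma poly_simple_critical_point_chart:
  fixes F :: "complex poly"
  assumes z: "poly (pderiv F) z = 0" "poly (pderiv (pderiv F)) z \<noteq> 0"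
  obtains \<psi> \<rho> where "\<rho> > 0" "\<psi> holomorphic_on ball z \<rho>" "inj_on \<psi> (ball z \<rho>)" "\<psi> z = 0"
    "\<And>x. x \<in> ball z \<rho> \<Longrightarrow> poly F x - poly F z = (\<psi> x)\<^sup>2"
proof -
  have "poly (F - [:poly F z:]) z = 0" by simp
  then obtain Q1 where Q1: "F - [:poly F z:] = [:-z, 1:] * Q1"
    unfolding poly_eq_0_iff_dvd by (elim dvdE)
  have "pderiv F = pderiv (F - [:poly F z:])" by (simp add: pderiv_diff pderiv_pCons)
  also have "\<dots> = Q1 + [:-z, 1:] * pderiv Q1"
    unfolding Q1 pderiv_mult by (simp add: pderiv_pCons)
  finally have d1: "pderiv F = Q1 + [:-z, 1:] * pderiv Q1" .
  then have "poly Q1 z = 0" using z(1) by simp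
  then obtain Q where Q: "Q1 = [:-z, 1:] * Q" unfolding poly_eq_0_iff_dvd by (elim dvdE)
  have "pderiv Q1 = Q + [:-z, 1:] * pderiv Q" unfolding Q pderiv_mult by (simp add: pderiv_pCons)
  then have "poly (pderiv Q1) z = poly Q z" by simp
  moreover have "poly (pderiv (pderiv F)) z = 2 * poly (pderiv Q1) z"
    unfolding d1 by (simp add: pderiv_add pderiv_mult pderiv_pCons pderiv_diff pderiv_smult)
  ultimately have Qz: "poly Q z \<noteq> 0" using z(2) by simp
  have FQ: "poly F x - poly F z = (x - z)\<^sup>2 * poly Q x" for x
    using arg_cong[OF Q1, of "\<lambda>p. poly p x"] unfolding Q by (simp add: power2_eq_square algebra_simps)
  have "open {x. poly Q x \<noteq> 0}" by (intro open_Collect_neq continuous_intros)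
  then obtain \<rho>0 where \<rho>0: "\<rho>0 > 0" "ball z \<rho>0 \<subseteq> {x. poly Q x \<noteq> 0}"
    using Qz unfolding open_contains_ball by blast
  obtain g where g: "g holomorphic_on ball z \<rho>0" "\<And>x. x \<in> ball z \<rho>0 \<Longrightarrow> poly Q x = g x ^ 2"
    by (rule contractible_imp_holomorphic_sqrt[of "poly Q" "ball z \<rho>0"])
      (use \<rho>0 in \<open>auto intro!: holomorphic_intros convex_imp_contractible\<close>)
  define \<psi> where "\<psi> x = (x - z) * g x" for x
  have hol: "\<psi> holomorphic_on ball z \<rho>0" unfolding \<psi>_def by (intro holomorphic_intros g)
  have "g field_differentiable at z"
    using g(1) \<rho>0(1) by (intro holomorphic_on_imp_differentiable_at[of g "ball z \<rho>0"]) auto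
  then obtain g' where "(g has_field_derivative g') (at z)" unfolding field_differentiable_def by blast
  then have "(\<psi> has_field_derivative g z) (at z)"
    unfolding \<psi>_def by (auto intro!: derivative_eq_intros)
  then have "deriv \<psi> z = g z" by (rule DERIV_imp_deriv)
  moreover have "g z \<noteq> 0" using g(2)[of z] Qz \<rho>0(1) by auto
  ultimately have nz: "deriv \<psi> z \<noteq> 0" by simp
  obtain \<rho> where \<rho>: "\<rho> > 0" "ball z \<rho> \<subseteq> ball z \<rho>0" "inj_on \<psi> (ball z \<rho>)"
    using has_complex_derivative_locally_injective[OF hol _ _ nz] \<rho>0(1) by auto
  show ?thesis
  proof (rule that[OF \<rho>(1) holomorphic_on_subset[OF hol \<rho>(2)] \<rho>(3)])
    show "\<psi> z = 0" by (simp add: \<psi>_def)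
    fix x assume "x \<in> ball z \<rho>"
    then have "poly Q x = g x ^ 2" using g(2) \<rho>(2) by blast
    then show "poly F x - poly F z = (\<psi> x)\<^sup>2" by (simp add: FQ \<psi>_def power_mult_distrib)
  qed
qed

text \<open>A square root of \<open>v - c\<close>, continuous on the closed half-plane above (\<open>s > 0\<close>) or below the line
  through \<open>c\<close>. The constants rotate the half-plane into the right half-plane, where \<open>csqrt\<close> is
  continuous, and make the two roots agree to the left of \<open>c\<close>; then they are opposite to the right
  of \<open>c\<close>.\<close>

definition side_sqrt :: "real \<Rightarrow> complex \<Rightarrow> complex \<Rightarrow> complex" where
  "side_sqrt s c v = (if s > 0 then cis (pi / 4) * csqrt (- \<i> * (v - c)) else \<i> * cis (pi / 4) * csqrt (\<i> * (v - c)))"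

lemma side_sqrt_power2: "(side_sqrt s c v)\<^sup>2 = v - c"
proof -
  have "(cis (pi / 4))\<^sup>2 = \<i>" by (simp add: Complex.DeMoivre complex_eq_iff)
  then show ?thesis by (simp add: side_sqrt_def power_mult_distrib algebra_simps)
qed

lemma side_sqrt_eq_0_iff: "side_sqrt s c v = 0 \<longleftrightarrow> v = c"
  using side_sqrt_power2[of s c v] by (metis eq_iff_diff_eq_0 zero_eq_power2)

lemma csqrt_tendsto_0: "(csqrt \<longlongrightarrow> 0) (at 0 within S)"
proof (rule tendsto_norm_zero_cancel)
  have "((\<lambda>z. sqrt (norm z)) \<longlongrightarrow> sqrt (norm (0::complex))) (at 0 within S)"
    by (intro tendsto_intros)
  then show "((\<lambda>z. norm (csqrt z)) \<longlongrightarrow> 0) (at 0 within S)" by simp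
qed

lemma continuous_on_csqrt_right: "continuous_on {z. Re z \<ge> 0} csqrt"
  unfolding continuous_on_eq_continuous_within
proof
  fix z assume z: "z \<in> {z. 0 \<le> Re z}"
  show "continuous (at z within {z. 0 \<le> Re z}) csqrt"
  proof (cases "z = 0")
    case True
    then show ?thesis using csqrt_tendsto_0 by (simp add: continuous_within)
  next
    case False
    then have "z \<notin> \<real>\<^sub>\<le>\<^sub>0" using z by (auto simp: complex_nonpos_Reals_iff complex_eq_iff)
    then show ?thesis by (rule continuous_within_csqrt)
  qed
qed

lemma continuous_side_sqrt:
  assumes "s \<in> {1, -1}" shows "continuous_on (closed_side s c) (side_sqrt s c)"
  using assms
proof
  assume "s = 1"
  moreover have "continuous_on (closed_side 1 c) (\<lambda>v. cis (pi / 4) * csqrt (- \<i> * (v - c)))"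
    by (intro continuous_intros continuous_on_compose2[OF continuous_on_csqrt_right])
      (auto simp: closed_side_def)
  ultimately show ?thesis by (simp add: side_sqrt_def[abs_def])
next
  assume "s \<in> {-1}"
  moreover have "continuous_on (closed_side (-1) c) (\<lambda>v. \<i> * cis (pi / 4) * csqrt (\<i> * (v - c)))"
    by (intro continuous_intros continuous_on_compose2[OF continuous_on_csqrt_right])
      (auto simp: closed_side_def)
  ultimately show ?thesis by (simp add: side_sqrt_def[abs_def])
qed

lemma csqrt_imaginary:
  assumes "t \<ge> 0"
  shows "csqrt (\<i> * of_real t) = of_real (sqrt t) * cis (pi / 4)"
        "csqrt (- (\<i> * of_real t)) = of_real (sqrt t) * cis (- pi / 4)"
proof -
  have "(cis (pi / 4))\<^sup>2 = \<i>" "(cis (- pi / 4))\<^sup>2 = - \<i>"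
    by (simp_all add: Complex.DeMoivre complex_eq_iff)
  moreover have "(complex_of_real (sqrt t))\<^sup>2 = of_real t"
    using assms by (metis of_real_power real_sqrt_pow2)
  ultimately have sq: "(of_real (sqrt t) * cis (pi / 4))\<^sup>2 = \<i> * of_real t"
      "(of_real (sqrt t) * cis (- pi / 4))\<^sup>2 = - (\<i> * of_real t)"
    by (simp_all add: power_mult_distrib)
  have re: "Re (of_real (sqrt t) * cis (pi / 4)) > 0 \<or> t = 0"  "Re (of_real (sqrt t) * cis (- pi / 4)) > 0 \<or> t = 0"
    using assms by (auto simp: cos_45)
  show "csqrt (\<i> * of_real t) = of_real (sqrt t) * cis (pi / 4)"
    using re(1) by (intro csqrt_unique[OF sq(1)]) auto
  show "csqrt (- (\<i> * of_real t)) = of_real (sqrt t) * cis (- pi / 4)"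
    using re(2) by (intro csqrt_unique[OF sq(2)]) auto
qed

lemma side_sqrt_left:
  assumes "t \<ge> 0" shows "side_sqrt 1 c (c - of_real t) = side_sqrt (-1) c (c - of_real t)"
proof -
  have "cis (pi / 4) * cis (pi / 4) = \<i> * cis (pi / 4) * cis (- pi / 4)"
    by (simp add: mult.assoc cis_mult complex_eq_iff)
  then show ?thesis
    using csqrt_imaginary[OF assms] by (simp add: side_sqrt_def mult_ac)
qed

lemma side_sqrt_right:
  assumes "t \<ge> 0" shows "side_sqrt 1 c (c + of_real t) = - side_sqrt (-1) c (c + of_real t)"
proof -
  have "cis (pi / 4) * cis (- pi / 4) = - (\<i> * cis (pi / 4) * cis (pi / 4))"
    by (simp add: mult.assoc cis_mult complex_eq_iff)
  then show ?thesis
    using csqrt_imaginary[OF assms] by (simp add: side_sqrt_def mult_ac)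
qed

locale critical_chart = normalized_poly +
  fixes z :: complex and \<psi> :: "complex \<Rightarrow> complex" and \<rho> :: real
  assumes \<rho>: "\<rho> > 0" and \<psi>_hol: "\<psi> holomorphic_on ball z \<rho>" and \<psi>_inj: "inj_on \<psi> (ball z \<rho>)"
    and \<psi>_z: "\<psi> z = 0" and \<psi>_sq: "\<And>x. x \<in> ball z \<rho> \<Longrightarrow> poly F x - poly F z = (\<psi> x)\<^sup>2"
begin

abbreviation c where "c \<equiv> poly F z"

text \<open>Near \<open>z\<close> the chart turns a boundary value into a square root of \<open>v - c\<close>, so what remains is a
  sign.\<close>

definition has_sign :: "real \<Rightarrow> nat \<Rightarrow> complex \<Rightarrow> bool" where
  "has_sign s a \<epsilon> \<longleftrightarrow> (\<exists>\<delta>>0. \<forall>v\<in>closed_side s c \<inter> ball c \<delta>.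
     side_value s a v \<in> ball z \<rho> \<and> \<psi> (side_value s a v) = \<epsilon> * side_sqrt s c v)"

text \<open>In the chart, the branch divided by \<open>side_sqrt\<close> squares to 1 on a half-disc, which is connected; the
  identity extends to the diameter by continuity.\<close>

lemma ex_sign:
  assumes a: "a \<in> {1..d}" and s: "s \<in> {1, -1}" and az: "side_value s a c = z"
  shows "\<exists>\<epsilon>\<in>{1, -1}. has_sign s a \<epsilon>"
proof -
  have "\<forall>\<^sub>F v in at c within closed_side s c. dist (side_value s a v) z < \<rho>"
    using side_value_tendsto[OF a s, of c] \<rho> unfolding az by (intro tendstoD)
  then obtain \<delta>1 where \<delta>1: "\<delta>1 > 0" "\<And>v. v \<in> closed_side s c \<Longrightarrow> v \<noteq> c \<Longrightarrow> dist v c < \<delta>1 \<Longrightarrow> dist (side_value s a v) z < \<rho>"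
    unfolding eventually_at by blast
  obtain r where r: "r > 0" "open_side s c \<inter> ball c r \<subseteq> slit_plane"
    using half_disc_subset_slit_plane by blast
  define \<delta> where "\<delta> = min r \<delta>1"
  have \<delta>: "\<delta> > 0" using r \<delta>1 by (simp add: \<delta>_def)
  let ?H = "closed_side s c \<inter> ball c \<delta>" and ?D = "open_side s c \<inter> ball c \<delta>"
  have DH: "?D \<subseteq> ?H" using open_side_closed_side by blast
  have Ds: "?D \<subseteq> slit_plane" using r by (auto simp: \<delta>_def)
  have inU: "side_value s a v \<in> ball z \<rho>" if "v \<in> ?H" for v
    using \<delta>1(2)[of v] that az \<rho> by (cases "v = c") (auto simp: \<delta>_def dist_commute)
  have psi2: "(\<psi> (side_value s a v))\<^sup>2 = v - c" if "v \<in> ?H" for v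
    using \<psi>_sq[OF inU[OF that]] side_value(1)[OF a s, of v] by simp
  define q where "q v = \<psi> (side_value s a v) / side_sqrt s c v" for v
  have cD: "v \<noteq> c" if "v \<in> ?D" for v using that by (auto simp: open_side_def)
  have q2: "q v \<in> {1, -1}" if v: "v \<in> ?D" for v
  proof -
    have "(q v)\<^sup>2 = 1"
      using psi2[of v] v DH side_sqrt_power2[of s c v] cD[OF v] by (auto simp: q_def power_divide)
    then show ?thesis by (simp add: power2_eq_1_iff)
  qed
  have contS: "continuous_on ?D (side_value s a)"
    by (rule continuous_on_eq[OF continuous_on_subset[OF continuous_branch[OF a] Ds]])
      (use side_value_eq_branch[OF a s] Ds in auto)
  have contq: "continuous_on ?D q"
    unfolding q_def
  proof (intro continuous_intros)
    show "continuous_on ?D (\<lambda>v. \<psi> (side_value s a v))"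
      by (rule continuous_on_compose2[OF holomorphic_on_imp_continuous_on[OF \<psi>_hol] contS])
        (use inU DH in auto)
    show "continuous_on ?D (side_sqrt s c)"
      by (rule continuous_on_subset[OF continuous_side_sqrt[OF s]]) (use DH in auto)
  qed (use cD side_sqrt_eq_0_iff in auto)
  have conn: "connected ?D" by (intro convex_connected convex_Int convex_open_side convex_ball)
  obtain v0 where v0: "v0 \<in> ?D" using open_side_point[OF s \<delta>] by blast
  have qc: "q v = q v0" if v: "v \<in> ?D" for v
  proof -
    have "dist (q v) (q v0) < 2 / 2"
    proof (rule continuous_near_finite_set[OF conn contq, of "{1, -1}"])
      show "\<forall>x\<in>{1, -1}. \<forall>y\<in>{1, -1}. dist x y < 2 \<longrightarrow> x = (y :: complex)" by (auto simp: dist_norm)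
      show "\<exists>x\<in>{1, -1}. dist (q u) x < 2 / 2" if "u \<in> ?D" for u
        using q2[OF that] by (intro bexI[of _ "q u"]) auto
    qed (use q2[OF v0] v0 v in auto)
    then show ?thesis using q2[OF v] q2[OF v0] by (auto simp: dist_norm)
  qed
  define \<epsilon> where "\<epsilon> = q v0"
  have D: "\<psi> (side_value s a v) = \<epsilon> * side_sqrt s c v" if v: "v \<in> ?D" for v
    using qc[OF v] cD[OF v] side_sqrt_eq_0_iff[of s c v] unfolding \<epsilon>_def q_def by (auto simp: field_simps)
  have H: "\<psi> (side_value s a v) = \<epsilon> * side_sqrt s c v" if v: "v \<in> ?H" for v
  proof -
    define h where "h v = \<psi> (side_value s a v) - \<epsilon> * side_sqrt s c v" for v
    have sub: "open_side s v \<subseteq> closed_side s v" "open_side s v \<subseteq> closed_side s c"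
      using open_side_subset[of v s c] open_side_closed_side v by blast+
    have "isCont \<psi> (side_value s a v)"
      using inU[OF v] \<psi>_hol by (metis holomorphic_on_imp_continuous_on continuous_on_eq_continuous_at open_ball)
    then have "((\<lambda>u. \<psi> (side_value s a u)) \<longlongrightarrow> \<psi> (side_value s a v)) (at v within open_side s v)"
      by (rule isCont_tendsto_compose) (rule tendsto_within_subset[OF side_value_tendsto[OF a s] sub(1)])
    moreover have "(side_sqrt s c \<longlongrightarrow> side_sqrt s c v) (at v within open_side s v)"
      using continuous_side_sqrt[OF s, of c] v tendsto_within_subset[OF _ sub(2)] unfolding continuous_on_def by blast
    ultimately have "(h \<longlongrightarrow> h v) (at v within open_side s v)"
      unfolding h_def by (intro tendsto_intros)
    moreover have "(h \<longlongrightarrow> 0) (at v within open_side s v)"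
    proof (rule tendsto_eventually)
      have "\<forall>\<^sub>F u in at v. u \<in> ball c \<delta>" using v by (intro eventually_at_in_open') auto
      then have "\<forall>\<^sub>F u in at v within open_side s v. u \<in> ball c \<delta>"
        by (rule filter_leD[OF at_le[OF subset_UNIV]])
      moreover have "\<forall>\<^sub>F u in at v within open_side s v. u \<in> open_side s v"
        by (simp add: eventually_at_filter)
      ultimately show "\<forall>\<^sub>F u in at v within open_side s v. h u = 0"
      proof eventually_elim
        case (elim u)
        then have "u \<in> ?D" using open_side_subset[of v s c] v by blast
        then show ?case using D by (simp add: h_def)
      qed
    qed
    ultimately have "h v = 0" using tendsto_unique[OF open_side_neq_bot[OF s]] by blast
    then show ?thesis by (simp add: h_def)
  qed
  have "has_sign s a \<epsilon>" unfolding has_sign_def using \<delta> inU H by blast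
  then show ?thesis using q2[OF v0] unfolding \<epsilon>_def by blast
qed

lemma has_sign_inj:
  assumes a: "a \<in> {1..d}" "b \<in> {1..d}" and s: "s \<in> {1, -1}" and sg: "has_sign s a \<epsilon>" "has_sign s b \<epsilon>"
  shows "a = b"
proof -
  obtain \<delta>1 \<delta>2 where \<delta>: "\<delta>1 > 0" "\<delta>2 > 0"
     "\<And>v. v\<in>closed_side s c \<inter> ball c \<delta>1 \<Longrightarrow> side_value s a v \<in> ball z \<rho> \<and> \<psi> (side_value s a v) = \<epsilon> * side_sqrt s c v"
     "\<And>v. v\<in>closed_side s c \<inter> ball c \<delta>2 \<Longrightarrow> side_value s b v \<in> ball z \<rho> \<and> \<psi> (side_value s b v) = \<epsilon> * side_sqrt s c v"
    using sg unfolding has_sign_def by blast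
  obtain r where r: "r > 0" "open_side s c \<inter> ball c r \<subseteq> slit_plane"
    using half_disc_subset_slit_plane by blast
  have "min r (min \<delta>1 \<delta>2) > 0" using r \<delta> by simp
  then obtain v where v: "v \<in> open_side s c \<inter> ball c (min r (min \<delta>1 \<delta>2))"
    using open_side_point[OF s] by blast
  then have vs: "v \<in> slit_plane" "v\<in>closed_side s c \<inter> ball c \<delta>1" "v\<in>closed_side s c \<inter> ball c \<delta>2"
    using r(2) open_side_closed_side by auto
  have "side_value s a v = side_value s b v"
    using \<delta>(3)[OF vs(2)] \<delta>(4)[OF vs(3)] by (rule_tac inj_onD[OF \<psi>_inj]) auto
  then have "branch a v = branch b v"
    using side_value_eq_branch[OF a(1) s vs(1)] side_value_eq_branch[OF a(2) s vs(1)] by simp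
  then show ?thesis by (rule branch_inj[OF a vs(1)])
qed

lemma has_sign_unique:
  assumes s: "s \<in> {1, -1}" and sg: "has_sign s a \<epsilon>" "has_sign s a \<epsilon>'"
  shows "\<epsilon> = \<epsilon>'"
proof -
  obtain \<delta>1 \<delta>2 where \<delta>: "\<delta>1 > 0" "\<delta>2 > 0"
     "\<And>v. v\<in>closed_side s c \<inter> ball c \<delta>1 \<Longrightarrow> \<psi> (side_value s a v) = \<epsilon> * side_sqrt s c v"
     "\<And>v. v\<in>closed_side s c \<inter> ball c \<delta>2 \<Longrightarrow> \<psi> (side_value s a v) = \<epsilon>' * side_sqrt s c v"
    using sg unfolding has_sign_def by blast
  have "min \<delta>1 \<delta>2 > 0" using \<delta> by simp
  then obtain v where v: "v \<in> open_side s c \<inter> ball c (min \<delta>1 \<delta>2)" "v \<noteq> c"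
    using open_side_point[OF s] by blast
  then have "v\<in>closed_side s c \<inter> ball c \<delta>1" "v\<in>closed_side s c \<inter> ball c \<delta>2"
    using open_side_closed_side by auto
  then have "\<epsilon> * side_sqrt s c v = \<epsilon>' * side_sqrt s c v" using \<delta>(3,4) by metis
  then show ?thesis using v(2) side_sqrt_eq_0_iff by simp
qed

text \<open>Both square roots, carried back by the chart, are local inverses of \<open>F\<close> on the half-disc, and every
  such inverse is one of the branches.\<close>

lemma ex_branch_with_sign:
  assumes s: "s \<in> {1, -1}" and \<epsilon>: "\<epsilon> \<in> {1, -1}"
  shows "\<exists>a\<in>{1..d}. side_value s a c = z \<and> has_sign s a \<epsilon>"
proof -
  obtain \<kappa> where \<kappa>: "\<kappa> holomorphic_on \<psi> ` ball z \<rho>" "\<And>x. x \<in> ball z \<rho> \<Longrightarrow> \<kappa> (\<psi> x) = x"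
    using holomorphic_has_inverse[OF \<psi>_hol open_ball \<psi>_inj] by metis
  let ?V = "\<psi> ` ball z \<rho>"
  have oV: "open ?V" by (rule open_mapping_thm3[OF \<psi>_hol open_ball \<psi>_inj])
  have zV: "0 \<in> ?V" using \<psi>_z \<rho> by (metis centre_in_ball imageI)
  have sqc: "((\<lambda>v. \<epsilon> * side_sqrt s c v) \<longlongrightarrow> 0) (at c within closed_side s c)"
  proof -
    have "(side_sqrt s c \<longlongrightarrow> side_sqrt s c c) (at c within closed_side s c)"
      using continuous_side_sqrt[OF s, of c] unfolding continuous_on_def by (auto simp: closed_side_def)
    then show ?thesis using side_sqrt_eq_0_iff[of s c c] by (intro tendsto_mult_right_zero) simp
  qed
  have "\<forall>\<^sub>F v in at c within closed_side s c. \<epsilon> * side_sqrt s c v \<in> ?V"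
    using topological_tendstoD[OF sqc oV zV] .
  then obtain \<delta>1 where \<delta>1: "\<delta>1 > 0" "\<And>v. v \<in> closed_side s c \<Longrightarrow> v \<noteq> c \<Longrightarrow> dist v c < \<delta>1 \<Longrightarrow> \<epsilon> * side_sqrt s c v \<in> ?V"
    unfolding eventually_at by blast
  obtain r where r: "r > 0" "open_side s c \<inter> ball c r \<subseteq> slit_plane"
    using half_disc_subset_slit_plane by blast
  define \<delta> where "\<delta> = min r \<delta>1"
  have \<delta>: "\<delta> > 0" using r \<delta>1 by (simp add: \<delta>_def)
  let ?D = "open_side s c \<inter> ball c \<delta>"
  have Ds: "?D \<subseteq> slit_plane" using r by (auto simp: \<delta>_def)
  have cD: "v \<noteq> c" if "v \<in> ?D" for v using that by (auto simp: open_side_def)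
  have DV: "\<epsilon> * side_sqrt s c v \<in> ?V" if v: "v \<in> ?D" for v
  proof (rule \<delta>1(2))
    show "v \<in> closed_side s c" "dist v c < \<delta>1"
      using v open_side_closed_side[of s c] by (auto simp: \<delta>_def dist_commute)
  qed (use cD v in auto)
  define f where "f v = \<kappa> (\<epsilon> * side_sqrt s c v)" for v
  have e2: "\<epsilon>\<^sup>2 = 1" using \<epsilon> by auto
  have f: "f v \<in> ball z \<rho>" "\<psi> (f v) = \<epsilon> * side_sqrt s c v" "poly F (f v) = v" if v: "v \<in> ?D" for v
  proof -
    obtain x where x: "x \<in> ball z \<rho>" "\<epsilon> * side_sqrt s c v = \<psi> x" using DV[OF v] by blast
    then have fx: "f v = x" using \<kappa>(2) by (simp add: f_def)
    then show "f v \<in> ball z \<rho>" "\<psi> (f v) = \<epsilon> * side_sqrt s c v" using x by auto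
    have "poly F x - c = v - c"
      using \<psi>_sq[OF x(1)] unfolding x(2)[symmetric] power_mult_distrib side_sqrt_power2 e2 by simp
    then show "poly F (f v) = v" using fx by simp
  qed
  have contf: "continuous_on ?D f"
    unfolding f_def
  proof (rule continuous_on_compose2[OF holomorphic_on_imp_continuous_on[OF \<kappa>(1)]])
    show "continuous_on ?D (\<lambda>v. \<epsilon> * side_sqrt s c v)"
      by (intro continuous_intros continuous_on_subset[OF continuous_side_sqrt[OF s]])
        (use open_side_closed_side in blast)
  qed (use DV in auto)
  have conn: "connected ?D" by (intro convex_connected convex_Int convex_open_side convex_ball)
  obtain v0 where v0: "v0 \<in> ?D" using open_side_point[OF s \<delta>] by blast
  then have v0s: "poly F (f v0) = v0" "v0 \<in> slit_plane" using f(3) Ds by blast+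
  obtain a where a: "a \<in> {1..d}" "branch a v0 = f v0" using branch_surj[of "f v0"] v0s by auto
  have fb: "f v = branch a v" if v: "v \<in> ?D" for v
  proof (rule poly_lift_unique[OF conn contf, of "branch a" F v0 v])
    show "continuous_on ?D (branch a)" by (rule continuous_on_subset[OF continuous_branch[OF a(1)] Ds])
    show "poly F (f v) = poly F (branch a v)" if "v \<in> ?D" for v
      using f(3)[OF that] poly_branch[OF a(1)] that Ds by auto
    show "poly dF (f v) \<noteq> 0" if "v \<in> ?D" for v
      using noncritical_over_slit_plane[of "f v"] f(3)[OF that] that Ds by auto
  qed (use v0 v a in auto)
  have ev: "\<forall>\<^sub>F v in at c within open_side s c. v \<in> ?D"
    unfolding eventually_at using \<delta> by (intro exI[of _ \<delta>]) (auto simp: dist_commute)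
  have "isCont \<kappa> 0"
    using \<kappa>(1) oV zV by (metis holomorphic_on_imp_continuous_on continuous_on_eq_continuous_at)
  then have "(f \<longlongrightarrow> \<kappa> 0) (at c within open_side s c)"
    unfolding f_def
    by (rule isCont_tendsto_compose) (rule tendsto_within_subset[OF sqc open_side_closed_side])
  moreover have "\<kappa> 0 = z" using \<kappa>(2)[of z] \<rho> \<psi>_z by simp
  ultimately have "(branch a \<longlongrightarrow> z) (at c within open_side s c)"
    using tendsto_cong[of f "branch a"] ev fb by (smt (verit, best) eventually_mono)
  then have az: "side_value s a c = z"
    using side_value(2)[OF a(1) s, of c] tendsto_unique[OF open_side_neq_bot[OF s]] by blast
  obtain \<epsilon>' where \<epsilon>': "\<epsilon>' \<in> {1, -1}" "has_sign s a \<epsilon>'" using ex_sign[OF a(1) s az] by blast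
  then obtain \<delta>' where \<delta>': "\<delta>' > 0"
     "\<And>v. v\<in>closed_side s c \<inter> ball c \<delta>' \<Longrightarrow> \<psi> (side_value s a v) = \<epsilon>' * side_sqrt s c v"
    unfolding has_sign_def by blast
  have "min \<delta> \<delta>' > 0" using \<delta> \<delta>' by simp
  then obtain v where v: "v \<in> open_side s c \<inter> ball c (min \<delta> \<delta>')"
    using open_side_point[OF s] by blast
  then have vD: "v \<in> ?D" "v\<in>closed_side s c \<inter> ball c \<delta>'" using open_side_closed_side[of s c] by auto
  have "side_value s a v = f v" using side_value_eq_branch[OF a(1) s] fb vD Ds by auto
  then have "\<epsilon>' * side_sqrt s c v = \<epsilon> * side_sqrt s c v" using \<delta>'(2)[OF vD(2)] f(2)[OF vD(1)] by metis
  then have "\<epsilon>' = \<epsilon>" using cD[OF vD(1)] side_sqrt_eq_0_iff[of s c v] by auto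
  then show ?thesis using a(1) az \<epsilon>'(2) by blast
qed

lemma two_sides_at_critical_point:
  assumes s: "s \<in> {1, -1}"
  shows "\<exists>a b. a \<noteq> b \<and> {a'\<in>{1..d}. side_value s a' c = z} = {a, b}"
proof -
  obtain a where a: "a \<in> {1..d}" "side_value s a c = z" "has_sign s a 1"
    using ex_branch_with_sign[OF s, of 1] by blast
  obtain b where b: "b \<in> {1..d}" "side_value s b c = z" "has_sign s b (-1)"
    using ex_branch_with_sign[OF s, of "-1"] by blast
  have "a \<noteq> b" using has_sign_unique[OF s a(3)] b(3) by force
  moreover have "{a'\<in>{1..d}. side_value s a' c = z} = {a, b}"
  proof (intro equalityI subsetI)
    fix a' assume "a' \<in> {a'\<in>{1..d}. side_value s a' c = z}"
    then have a': "a' \<in> {1..d}" "side_value s a' c = z" by auto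
    consider "has_sign s a' 1" | "has_sign s a' (-1)" using ex_sign[OF a'(1) s a'(2)] by blast
    then show "a' \<in> {a, b}"
    proof cases
      case 1
      then show ?thesis using has_sign_inj[OF a'(1) a(1) s _ a(3)] by simp
    next
      case 2
      then show ?thesis using has_sign_inj[OF a'(1) b(1) s _ b(3)] by simp
    qed
  qed (use a b in auto)
  ultimately show ?thesis by blast
qed

text \<open>The branch \<open>a\<close> has the same sign on both sides, since its boundary values agree to the left of \<open>c\<close>,
  and \<open>b\<close> has the opposite one. To the right of \<open>c\<close> the two square roots are opposite as well, so
  the upper side of \<open>a\<close> meets the lower side of \<open>b\<close>.\<close>

lemma swap_right_of_critical_point:
  assumes ab: "a \<in> {1..d}" "b \<in> {1..d}" "a \<noteq> b"
    and val: "side_value 1 a c = z" "side_value (-1) a c = z" "side_value (-1) b c = z"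
    and left: "\<And>t. t > 0 \<Longrightarrow> side_value 1 a (c - of_real t) = side_value (-1) a (c - of_real t)"
  shows "\<exists>\<delta>>0. \<forall>t. 0 < t \<and> t < \<delta> \<longrightarrow> side_value 1 a (c + of_real t) = side_value (-1) b (c + of_real t)"
proof -
  obtain \<epsilon> where \<epsilon>: "\<epsilon> \<in> {1, -1}" "has_sign 1 a \<epsilon>" using ex_sign[OF ab(1) _ val(1)] by auto
  obtain \<epsilon>2 where \<epsilon>2: "\<epsilon>2 \<in> {1, -1}" "has_sign (-1) a \<epsilon>2" using ex_sign[OF ab(1) _ val(2)] by auto
  obtain \<epsilon>3 where \<epsilon>3: "\<epsilon>3 \<in> {1, -1}" "has_sign (-1) b \<epsilon>3" using ex_sign[OF ab(2) _ val(3)] by auto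
  obtain \<delta>1 where \<delta>1: "\<delta>1 > 0"
     "\<And>v. v\<in>closed_side 1 c \<inter> ball c \<delta>1 \<Longrightarrow> side_value 1 a v \<in> ball z \<rho> \<and> \<psi> (side_value 1 a v) = \<epsilon> * side_sqrt 1 c v"
    using \<epsilon>(2) unfolding has_sign_def by blast
  obtain \<delta>2 where \<delta>2: "\<delta>2 > 0"
     "\<And>v. v\<in>closed_side (-1) c \<inter> ball c \<delta>2 \<Longrightarrow> \<psi> (side_value (-1) a v) = \<epsilon>2 * side_sqrt (-1) c v"
    using \<epsilon>2(2) unfolding has_sign_def by blast
  obtain \<delta>3 where \<delta>3: "\<delta>3 > 0"
     "\<And>v. v\<in>closed_side (-1) c \<inter> ball c \<delta>3 \<Longrightarrow> side_value (-1) b v \<in> ball z \<rho> \<and> \<psi> (side_value (-1) b v) = \<epsilon>3 * side_sqrt (-1) c v"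
    using \<epsilon>3(2) unfolding has_sign_def by blast
  have line: "c + of_real t \<in> closed_side s c" "c - of_real t \<in> closed_side s c" for s t by (auto simp: closed_side_def)
  have "\<epsilon>2 = \<epsilon>"
  proof -
    define t where "t = min \<delta>1 \<delta>2 / 2"
    have t: "t > 0" "t < \<delta>1" "t < \<delta>2" using \<delta>1(1) \<delta>2(1) by (auto simp: t_def)
    have "\<epsilon> * side_sqrt 1 c (c - of_real t) = \<epsilon>2 * side_sqrt (-1) c (c - of_real t)"
      using \<delta>1(2)[of "c - of_real t"] \<delta>2(2)[of "c - of_real t"] left[OF t(1)] t line by (simp add: dist_norm)
    then have "(\<epsilon> - \<epsilon>2) * side_sqrt 1 c (c - of_real t) = 0"
      using side_sqrt_left[of t c] t(1) by (simp add: algebra_simps)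
    then show ?thesis using t(1) side_sqrt_eq_0_iff by simp
  qed
  moreover have "\<epsilon>3 \<noteq> \<epsilon>2" using has_sign_inj[OF ab(1,2) _ \<epsilon>2(2)] \<epsilon>3(2) ab(3) by auto
  ultimately have e3: "\<epsilon>3 = - \<epsilon>" using \<epsilon>(1) \<epsilon>3(1) by auto
  show ?thesis
  proof (intro exI conjI allI impI)
    show "min \<delta>1 \<delta>3 > 0" using \<delta>1(1) \<delta>3(1) by simp
    fix t assume t: "0 < t \<and> t < min \<delta>1 \<delta>3"
    let ?v = "c + of_real t"
    have "\<psi> (side_value 1 a ?v) = \<epsilon> * side_sqrt 1 c ?v" "side_value 1 a ?v \<in> ball z \<rho>"
      using \<delta>1(2)[of ?v] t line by (auto simp: dist_norm)
    moreover have "\<psi> (side_value (-1) b ?v) = \<epsilon>3 * side_sqrt (-1) c ?v" "side_value (-1) b ?v \<in> ball z \<rho>"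
      using \<delta>3(2)[of ?v] t line by (auto simp: dist_norm)
    moreover have "\<epsilon> * side_sqrt 1 c ?v = \<epsilon>3 * side_sqrt (-1) c ?v"
      using side_sqrt_right[of t c] t e3 by simp
    ultimately show "side_value 1 a ?v = side_value (-1) b ?v"
      by (rule_tac inj_onD[OF \<psi>_inj]) auto
  qed
qed

end

section \<open>Orbits as lifts of horizontal lines\<close>

text \<open>Along an orbit \<open>F\<close> moves with speed the squared modulus of \<open>pderiv F\<close>: orbits are the level curves of
  the imaginary part of \<open>F\<close>, run in the direction of increasing real part.\<close>

lemma curve_poly_derivative:
  assumes "integral_curve (vfield (pderiv F)) I \<gamma>" "t \<in> I"
  shows "((\<lambda>t. poly F (\<gamma> t)) has_vector_derivative of_real ((norm (poly (pderiv F) (\<gamma> t)))\<^sup>2)) (at t)"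
proof -
  have "(\<gamma> has_vector_derivative cnj (poly (pderiv F) (\<gamma> t))) (at t)"
    using assms unfolding integral_curve_def vfield_def by blast
  then have "(poly F \<circ> \<gamma> has_vector_derivative cnj (poly (pderiv F) (\<gamma> t)) * poly (pderiv F) (\<gamma> t)) (at t)"
    by (rule field_vector_diff_chain_at[OF _ poly_DERIV])
  then show ?thesis by (simp add: o_def complex_norm_square[symmetric] mult.commute)
qed

lemma curve_continuous: "integral_curve X I \<gamma> \<Longrightarrow> continuous_on I \<gamma>"
  unfolding integral_curve_def
  by (meson continuous_at_imp_continuous_on has_vector_derivative_continuous)

lemma curve_level:
  assumes c: "integral_curve (vfield (pderiv F)) I \<gamma>" and st: "s \<in> I" "t \<in> I"
  shows "Im (poly F (\<gamma> s)) = Im (poly F (\<gamma> t))"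
proof -
  have "convex I" using c unfolding integral_curve_def by (simp add: is_interval_convex)
  moreover have "((\<lambda>t. Im (poly F (\<gamma> t))) has_field_derivative 0) (at t within I)" if "t \<in> I" for t
  proof -
    have "((\<lambda>t. Im (poly F (\<gamma> t))) has_vector_derivative Im (of_real ((norm (poly (pderiv F) (\<gamma> t)))\<^sup>2))) (at t)"
      by (rule bounded_linear.has_vector_derivative[OF bounded_linear_Im curve_poly_derivative[OF c that]])
    then show ?thesis
      by (simp add: has_real_derivative_iff_has_vector_derivative has_vector_derivative_at_within)
  qed
  ultimately obtain k where "\<And>x. x \<in> I \<Longrightarrow> Im (poly F (\<gamma> x)) = k"
    using has_field_derivative_zero_constant[of I] by metis
  then show ?thesis using st by simp
qed

lemma curve_Re_derivative:
  assumes c: "integral_curve (vfield (pderiv F)) I \<gamma>" and t: "t \<in> I"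
  shows "((\<lambda>t. Re (poly F (\<gamma> t))) has_real_derivative (norm (poly (pderiv F) (\<gamma> t)))\<^sup>2) (at t)"
  using bounded_linear.has_vector_derivative[OF bounded_linear_Re curve_poly_derivative[OF c t]]
  by (simp add: has_real_derivative_iff_has_vector_derivative)

lemma curve_Re_less:
  assumes c: "integral_curve (vfield (pderiv F)) I \<gamma>" and st: "s \<in> I" "t \<in> I" "s < t"
    and nz: "\<And>t. t \<in> I \<Longrightarrow> poly (pderiv F) (\<gamma> t) \<noteq> 0"
  shows "Re (poly F (\<gamma> s)) < Re (poly F (\<gamma> t))"
proof (rule DERIV_pos_imp_increasing[OF st(3)])
  fix x assume "s \<le> x" "x \<le> t"
  then have x: "x \<in> I" using c st unfolding integral_curve_def by (meson mem_is_interval_1_I)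
  then show "\<exists>y. ((\<lambda>t. Re (poly F (\<gamma> t))) has_real_derivative y) (at x) \<and> 0 < y"
    using curve_Re_derivative[OF c x] nz[OF x] by (intro exI[of _ "(norm (poly (pderiv F) (\<gamma> x)))\<^sup>2"]) auto
qed

text \<open>Gronwall: along an orbit the squared modulus of \<open>P\<close> has a derivative bounded by a multiple of
  itself, so it vanishes identically if it vanishes once. Hence an equilibrium is never reached in
  finite time.\<close>

lemma curve_through_zero:
  assumes c: "integral_curve (vfield P) I \<gamma>" and t0: "t0 \<in> I" "poly P (\<gamma> t0) = 0" and t1: "t1 \<in> I"
  shows "poly P (\<gamma> t1) = 0"
proof -
  define u where "u t = (norm (poly P (\<gamma> t)))\<^sup>2" for t
  define D where "D t = 2 * inner (poly P (\<gamma> t)) (cnj (poly P (\<gamma> t)) * poly (pderiv P) (\<gamma> t))" for t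
  have I: "is_interval I" using c unfolding integral_curve_def by blast
  have u': "(u has_real_derivative D t) (at t)" if "t \<in> I" for t
  proof -
    have "(\<gamma> has_vector_derivative cnj (poly P (\<gamma> t))) (at t)"
      using c that unfolding integral_curve_def vfield_def by blast
    then have "(poly P \<circ> \<gamma> has_vector_derivative cnj (poly P (\<gamma> t)) * poly (pderiv P) (\<gamma> t)) (at t)"
      by (rule field_vector_diff_chain_at[OF _ poly_DERIV])
    from bounded_bilinear.has_vector_derivative[OF bounded_bilinear_inner this this]
    moreover have "u = (\<lambda>t. inner (poly P (\<gamma> t)) (poly P (\<gamma> t)))"
      by (auto simp: u_def power2_norm_eq_inner)
    ultimately show ?thesis
      by (simp add: has_real_derivative_iff_has_vector_derivative D_def inner_commute o_def)
  qed
  have Dle: "\<bar>D t\<bar> \<le> 2 * norm (poly (pderiv P) (\<gamma> t)) * u t" for t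
  proof -
    have "\<bar>D t\<bar> \<le> 2 * (norm (poly P (\<gamma> t)) * norm (cnj (poly P (\<gamma> t)) * poly (pderiv P) (\<gamma> t)))"
      unfolding D_def abs_mult using Cauchy_Schwarz_ineq2 by simp
    then show ?thesis by (simp add: norm_mult u_def power2_eq_square mult_ac)
  qed
  have sub: "{min t0 t1..max t0 t1} \<subseteq> I"
  proof
    fix x assume "x \<in> {min t0 t1..max t0 t1}"
    moreover have "min t0 t1 \<in> I" "max t0 t1 \<in> I" using t0(1) t1 by (auto simp: min_def max_def)
    ultimately show "x \<in> I" using mem_is_interval_1_I[OF I] by (meson atLeastAtMost_iff)
  qed
  have "continuous_on {min t0 t1..max t0 t1} (\<lambda>t. norm (poly (pderiv P) (\<gamma> t)))"
    using continuous_on_subset[OF curve_continuous[OF c] sub] by (intro continuous_intros)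
  then have "bounded ((\<lambda>t. norm (poly (pderiv P) (\<gamma> t))) ` {min t0 t1..max t0 t1})"
    by (intro compact_imp_bounded compact_continuous_image) auto
  then obtain L where L': "\<forall>x\<in>(\<lambda>t. norm (poly (pderiv P) (\<gamma> t))) ` {min t0 t1..max t0 t1}. norm x \<le> L"
    unfolding bounded_iff by blast
  have L: "norm (poly (pderiv P) (\<gamma> t)) \<le> L" if "t \<in> {min t0 t1..max t0 t1}" for t
    using L'[rule_format, OF imageI[OF that]] by simp
  have DL: "\<bar>D t\<bar> \<le> 2 * L * u t" if "t \<in> {min t0 t1..max t0 t1}" for t
    using Dle[of t] mult_right_mono[OF L[OF that], of "2 * u t"] by (simp add: u_def)
  have "u t1 \<le> 0"
  proof (cases "t0 \<le> t1")
    case True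
    have "u t1 * exp (- 2 * L * t1) \<le> u t0 * exp (- 2 * L * t0)"
    proof (rule DERIV_nonpos_imp_nonincreasing[OF True])
      fix x assume "t0 \<le> x" "x \<le> t1"
      then have x: "x \<in> {min t0 t1..max t0 t1}" by auto
      have "((\<lambda>t. u t * exp (- 2 * L * t)) has_real_derivative (D x - 2 * L * u x) * exp (- 2 * L * x)) (at x)"
        using u'[OF subsetD[OF sub x]] by (auto intro!: derivative_eq_intros simp: algebra_simps)
      moreover have "(D x - 2 * L * u x) * exp (- 2 * L * x) \<le> 0"
        using DL[OF x] by (intro mult_nonpos_nonneg) auto
      ultimately show "\<exists>y. ((\<lambda>t. u t * exp (- 2 * L * t)) has_real_derivative y) (at x) \<and> y \<le> 0" by blast
    qed
    then show ?thesis using t0(2) by (simp add: u_def mult_le_0_iff)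
  next
    case False
    then have le: "t1 \<le> t0" by simp
    have "u t1 * exp (2 * L * t1) \<le> u t0 * exp (2 * L * t0)"
    proof (rule DERIV_nonneg_imp_nondecreasing[OF le])
      fix x assume "t1 \<le> x" "x \<le> t0"
      then have x: "x \<in> {min t0 t1..max t0 t1}" by auto
      have "((\<lambda>t. u t * exp (2 * L * t)) has_real_derivative (D x + 2 * L * u x) * exp (2 * L * x)) (at x)"
        using u'[OF subsetD[OF sub x]] by (auto intro!: derivative_eq_intros simp: algebra_simps)
      moreover have "(D x + 2 * L * u x) * exp (2 * L * x) \<ge> 0"
        using DL[OF x] by (intro mult_nonneg_nonneg) auto
      ultimately show "\<exists>y. ((\<lambda>t. u t * exp (2 * L * t)) has_real_derivative y) (at x) \<and> 0 \<le> y" by blast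
    qed
    then show ?thesis using t0(2) by (simp add: u_def mult_le_0_iff)
  qed
  then show ?thesis by (simp add: u_def)
qed

lemma forward_end_le_at:
  assumes I: "open I" "I \<noteq> {}" and b: "\<And>t. t \<in> I \<Longrightarrow> t < b" "\<And>e. e < b \<Longrightarrow> \<exists>t\<in>I. e < t"
  shows "forward_end I \<le> at b"
proof (rule filter_leI)
  fix Q assume "eventually Q (at b)"
  then obtain e where e: "e > 0" "\<And>t. t \<noteq> b \<Longrightarrow> dist t b < e \<Longrightarrow> Q t" unfolding eventually_at by auto
  obtain t where t: "t \<in> I" "b - e < t" using b(2)[of "b - e"] e(1) by auto
  show "eventually Q (forward_end I)"
    unfolding eventually_forward_end[OF I(2)]
  proof (intro bexI[OF _ t(1)] ballI impI)
    fix t' assume "t' \<in> I" "t \<le> t'"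
    then show "Q t'" using e(2)[of t'] b(1)[of t'] t(2) by (auto simp: dist_real_def)
  qed
qed

lemma backward_end_le_at:
  assumes I: "open I" "I \<noteq> {}" and b: "\<And>t. t \<in> I \<Longrightarrow> b < t" "\<And>e. b < e \<Longrightarrow> \<exists>t\<in>I. t < e"
  shows "backward_end I \<le> at b"
proof (rule filter_leI)
  fix Q assume "eventually Q (at b)"
  then obtain e where e: "e > 0" "\<And>t. t \<noteq> b \<Longrightarrow> dist t b < e \<Longrightarrow> Q t" unfolding eventually_at by auto
  obtain t where t: "t \<in> I" "t < b + e" using b(2)[of "b + e"] e(1) by auto
  show "eventually Q (backward_end I)"
    unfolding eventually_backward_end[OF I(2)]
  proof (intro bexI[OF _ t(1)] ballI impI)
    fix t' assume "t' \<in> I" "t' \<le> t"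
    then show "Q t'" using e(2)[of t'] b(1)[of t'] t(2) by (auto simp: dist_real_def)
  qed
qed

lemma forward_end_neq_bot: "I \<noteq> {} \<Longrightarrow> forward_end I \<noteq> bot"
  using eventually_forward_end[of I "\<lambda>_. False"] by (auto simp: trivial_limit_def)

lemma backward_end_neq_bot: "I \<noteq> {} \<Longrightarrow> backward_end I \<noteq> bot"
  using eventually_backward_end[of I "\<lambda>_. False"] by (auto simp: trivial_limit_def)

lemma eventually_in_forward_end: "I \<noteq> {} \<Longrightarrow> \<forall>\<^sub>F t in forward_end I. t \<in> I"
  by (auto simp: eventually_forward_end)

lemma eventually_in_backward_end: "I \<noteq> {} \<Longrightarrow> \<forall>\<^sub>F t in backward_end I. t \<in> I"
  by (auto simp: eventually_backward_end)

text \<open>A nonconstant orbit with such a limit at one end cannot be continued beyond that end.\<close>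

definition complete_limit :: "complex poly \<Rightarrow> (real \<Rightarrow> complex) \<Rightarrow> real filter \<Rightarrow> bool" where
  "complete_limit P \<gamma> E \<longleftrightarrow> filterlim \<gamma> at_infinity E \<or> (\<exists>z. poly P z = 0 \<and> (\<gamma> \<longlongrightarrow> z) E)"

lemma complete_limit_not_inside:
  assumes J: "integral_curve (vfield P) J \<delta>" and b: "b \<in> J" and E: "E \<le> at b" "E \<noteq> bot"
    and eq: "\<forall>\<^sub>F t in E. \<delta> t = \<gamma> t" and lim: "complete_limit P \<gamma> E" and t0: "t0 \<in> J"
  shows "poly P (\<delta> t0) = 0"
proof -
  have "isCont \<delta> b"
    using J b unfolding integral_curve_def by (meson has_vector_derivative_continuous)
  then have "(\<delta> \<longlongrightarrow> \<delta> b) E" unfolding isCont_def by (rule tendsto_mono[OF E(1)])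
  then have lim': "(\<gamma> \<longlongrightarrow> \<delta> b) E" using tendsto_cong[OF eq] by simp
  then have "\<not> filterlim \<gamma> at_infinity E" using not_tendsto_and_filterlim_at_infinity[OF E(2)] by blast
  then obtain z where "poly P z = 0" "(\<gamma> \<longlongrightarrow> z) E" using lim unfolding complete_limit_def by blast
  then have "poly P (\<delta> b) = 0" using tendsto_unique[OF E(2)] lim' by metis
  then show ?thesis using curve_through_zero[OF J b _ t0] by blast
qed

text \<open>An extension would be continuous at an endpoint of \<open>I\<close>, which excludes the limit infinity, and would
  pass through a zero of \<open>P\<close> there if the limit is a zero.\<close>

lemma maximal_curveI:
  assumes c: "integral_curve (vfield P) I \<gamma>" and nz: "\<And>t. t \<in> I \<Longrightarrow> poly P (\<gamma> t) \<noteq> 0"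
    and lim: "complete_limit P \<gamma> (forward_end I)" "complete_limit P \<gamma> (backward_end I)"
  shows "maximal_curve (vfield P) I \<gamma>"
  unfolding maximal_curve_def
proof (intro conjI allI impI c)
  fix J \<delta> assume "integral_curve (vfield P) J \<delta> \<and> I \<subseteq> J \<and> (\<forall>t\<in>I. \<delta> t = \<gamma> t)"
  then have J: "integral_curve (vfield P) J \<delta>" "I \<subseteq> J" "\<And>t. t \<in> I \<Longrightarrow> \<delta> t = \<gamma> t" by auto
  have I: "open I" "I \<noteq> {}" "is_interval I" using c unfolding integral_curve_def by auto
  have iJ: "is_interval J" using J unfolding integral_curve_def by auto
  obtain t0 where t0: "t0 \<in> I" using I by blast
  have nzt0: "poly P (\<delta> t0) \<noteq> 0" using nz t0 J(3) by simp
  show "J = I"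
  proof (rule ccontr)
    assume "J \<noteq> I"
    then obtain s where s: "s \<in> J" "s \<notin> I" using J(2) by blast
    have "s \<noteq> t0" using s t0 by blast
    then consider "t0 < s" | "s < t0" by linarith
    then show False
    proof cases
      case 1
      have lt: "t < s" if "t \<in> I" for t
      proof (rule ccontr)
        assume "\<not> t < s"
        then have "s \<in> I" using I(3) t0 that 1 by (meson mem_is_interval_1_I less_imp_le not_less)
        then show False using s by blast
      qed
      define b where "b = Sup I"
      have bdd: "bdd_above I" using lt by (meson bdd_above.I less_imp_le)
      have "b \<le> s" unfolding b_def using lt I(2) by (intro cSup_least) (auto intro: less_imp_le)
      moreover have le: "t \<le> b" if "t \<in> I" for t unfolding b_def using bdd that by (intro cSup_upper)
      ultimately have bJ: "b \<in> J" using iJ J(2) t0 s(1) by (meson mem_is_interval_1_I subsetD)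
      have "b \<notin> I"
      proof
        assume "b \<in> I"
        then obtain e where "e > 0" "ball b e \<subseteq> I" using I(1) open_contains_ball by blast
        then have "b + e / 2 \<in> I" by (auto simp: dist_real_def)
        then show False using le[of "b + e / 2"] \<open>e > 0\<close> by simp
      qed
      then have b1: "t < b" if "t \<in> I" for t using le[OF that] that by (metis less_le)
      have b2: "\<exists>t\<in>I. e < t" if "e < b" for e using that less_cSup_iff[OF I(2) bdd] unfolding b_def by blast
      have "\<forall>\<^sub>F t in forward_end I. \<delta> t = \<gamma> t"
        using eventually_in_forward_end[OF I(2)] by eventually_elim (rule J(3))
      then show False
        using complete_limit_not_inside[OF J(1) bJ forward_end_le_at[OF I(1,2) b1 b2] forward_end_neq_bot[OF I(2)] _ lim(1)]
          t0 J(2) nzt0 by blast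
    next
      case 2
      have lt: "s < t" if "t \<in> I" for t
      proof (rule ccontr)
        assume "\<not> s < t"
        then have "s \<in> I" using I(3) t0 that 2 by (meson mem_is_interval_1_I less_imp_le not_less)
        then show False using s by blast
      qed
      define b where "b = Inf I"
      have bdd: "bdd_below I" using lt by (meson bdd_below.I less_imp_le)
      have "s \<le> b" unfolding b_def using lt I(2) by (intro cInf_greatest) (auto intro: less_imp_le)
      moreover have le: "b \<le> t" if "t \<in> I" for t unfolding b_def using bdd that by (intro cInf_lower)
      ultimately have bJ: "b \<in> J" using iJ J(2) t0 s(1) by (meson mem_is_interval_1_I subsetD)
      have "b \<notin> I"
      proof
        assume "b \<in> I"
        then obtain e where "e > 0" "ball b e \<subseteq> I" using I(1) open_contains_ball by blast
        then have "b - e / 2 \<in> I" by (auto simp: dist_real_def)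
        then show False using le[of "b - e / 2"] \<open>e > 0\<close> by simp
      qed
      then have b1: "b < t" if "t \<in> I" for t using le[OF that] that by (metis less_le)
      have b2: "\<exists>t\<in>I. t < e" if "b < e" for e using that cInf_less_iff[OF I(2) bdd] unfolding b_def by blast
      have "\<forall>\<^sub>F t in backward_end I. \<delta> t = \<gamma> t"
        using eventually_in_backward_end[OF I(2)] by eventually_elim (rule J(3))
      then show False
        using complete_limit_not_inside[OF J(1) bJ backward_end_le_at[OF I(1,2) b1 b2] backward_end_neq_bot[OF I(2)] _ lim(2)]
          t0 J(2) nzt0 by blast
    qed
  qed
qed

lemma horizontal_lift_derivative:
  fixes F :: "complex poly"
  assumes J: "open J" "\<sigma> \<in> J" and g: "continuous_on J g" and lift: "\<And>x. x \<in> J \<Longrightarrow> poly F (g x) = Complex x y"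
    and nz: "poly (pderiv F) (g \<sigma>) \<noteq> 0"
  shows "(g has_vector_derivative 1 / poly (pderiv F) (g \<sigma>)) (at \<sigma>)"
proof -
  obtain r where r: "r > 0" "open (poly F ` ball (g \<sigma>) r)" "inj_on (poly F) (ball (g \<sigma>) r)"
    using poly_locally_invertible[OF nz] by blast
  let ?B = "ball (g \<sigma>) r"
  have hol: "poly F holomorphic_on ?B" by (intro holomorphic_intros)
  obtain \<kappa> where \<kappa>: "\<kappa> holomorphic_on poly F ` ?B"
      "\<And>z. z \<in> ?B \<Longrightarrow> deriv (poly F) z * deriv \<kappa> (poly F z) = 1" "\<And>z. z \<in> ?B \<Longrightarrow> \<kappa> (poly F z) = z"
    using holomorphic_has_inverse[OF hol open_ball r(3)] by metis
  have gB: "g \<sigma> \<in> ?B" using r(1) by simp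
  have Fg: "poly F (g \<sigma>) = Complex \<sigma> y" using lift J(2) by blast
  have "(\<kappa> has_field_derivative deriv \<kappa> (Complex \<sigma> y)) (at (Complex \<sigma> y))"
    using \<kappa>(1) r(2) gB Fg by (metis holomorphic_derivI imageI)
  moreover have "deriv (poly F) (g \<sigma>) = poly (pderiv F) (g \<sigma>)" by (rule DERIV_imp_deriv[OF poly_DERIV])
  moreover from this have "deriv \<kappa> (Complex \<sigma> y) = 1 / poly (pderiv F) (g \<sigma>)"
    using \<kappa>(2)[OF gB] Fg nz by (simp add: field_simps)
  ultimately have d: "(\<kappa> has_field_derivative 1 / poly (pderiv F) (g \<sigma>)) (at (Complex \<sigma> y))"
    by simp
  have "((\<lambda>x. complex_of_real x + \<i> * of_real y) has_vector_derivative (of_real 1 + 0)) (at \<sigma>)"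
    by (intro has_vector_derivative_add has_vector_derivative_const has_vector_derivative_of_real DERIV_ident)
  then have "((\<lambda>x. Complex x y) has_vector_derivative 1) (at \<sigma>)" by (simp add: Complex_eq)
  then have *: "(\<kappa> \<circ> (\<lambda>x. Complex x y) has_vector_derivative 1 * (1 / poly (pderiv F) (g \<sigma>))) (at \<sigma>)"
    by (rule field_vector_diff_chain_at) (rule d)
  have op: "open (J \<inter> g -` ?B)" by (rule continuous_open_preimage[OF g J(1) open_ball])
  have "(\<kappa> \<circ> (\<lambda>x. Complex x y)) x = g x" if x: "x \<in> J \<inter> g -` ?B" for x
  proof -
    have "\<kappa> (poly F (g x)) = g x" using x by (intro \<kappa>(3)) auto
    then show ?thesis using lift x by simp
  qed
  from has_vector_derivative_transform_within_open[OF * op _ this] show ?thesis using J(2) r(1) by simp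
qed

text \<open>Lifts of horizontal segments through \<open>F\<close> are orbits up to a change of time: the time \<open>T\<close> is a
  primitive of the reciprocal of the speed of \<open>F\<close>. Only the behaviour at the two ends matters
  later, so the limits are transported for an arbitrary target filter.\<close>

lemma curve_of_horizontal_lift:
  fixes F :: "complex poly" and \<alpha> \<beta> :: ereal
  defines "E \<equiv> einterval \<alpha> \<beta>"
  assumes ab: "\<alpha> < \<beta>" and g: "continuous_on E g" and lift: "\<And>x. x \<in> E \<Longrightarrow> poly F (g x) = Complex x y"
    and nz: "\<And>x. x \<in> E \<Longrightarrow> poly (pderiv F) (g x) \<noteq> 0"
  obtains I \<gamma> where "integral_curve (vfield (pderiv F)) I \<gamma>" "\<gamma> ` I = g ` E"
    "\<And>G. filterlim g G (forward_end E) \<Longrightarrow> filterlim \<gamma> G (forward_end I)"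
    "\<And>G. filterlim g G (backward_end E) \<Longrightarrow> filterlim \<gamma> G (backward_end I)"
proof -
  have oE: "open E" unfolding E_def by (rule open_einterval)
  have iE: "is_interval E" unfolding E_def is_interval_1
  proof (intro ballI allI impI)
    fix a b x assume "a \<in> einterval \<alpha> \<beta>" "b \<in> einterval \<alpha> \<beta>" "a \<le> x \<and> x \<le> b"
    then have "\<alpha> < ereal a" "ereal a \<le> ereal x" "ereal x \<le> ereal b" "ereal b < \<beta>"
      by (auto simp: einterval_iff)
    then have "\<alpha> < ereal x" "ereal x < \<beta>"
      by (blast intro: less_le_trans, blast intro: le_less_trans)
    then show "x \<in> einterval \<alpha> \<beta>" by (simp add: einterval_iff)
  qed
  have neE: "E \<noteq> {}" unfolding E_def using einterval_nonempty[OF ab] by blast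
  have inE: "x \<in> E \<longleftrightarrow> \<alpha> < ereal x \<and> ereal x < \<beta>" for x unfolding E_def by (rule einterval_iff)
  define h where "h x = 1 / (norm (poly (pderiv F) (g x)))\<^sup>2" for x
  have hpos: "h x > 0" if "x \<in> E" for x using nz[OF that] by (simp add: h_def)
  have "isCont h x" if "x \<in> E" for x
  proof -
    have "isCont g x" using g oE that continuous_on_eq_continuous_at by blast
    then show ?thesis unfolding h_def using nz[OF that] by (intro continuous_intros) auto
  qed
  then obtain T where T0: "\<And>x. \<alpha> < ereal x \<Longrightarrow> ereal x < \<beta> \<Longrightarrow> (T has_vector_derivative h x) (at x)"
    using einterval_antiderivative[OF ab, of h] inE by blast
  have T: "(T has_real_derivative h x) (at x)" if "x \<in> E" for x
    using T0 that inE by (simp add: has_real_derivative_iff_has_vector_derivative)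
  have mono: "T x < T x'" if "x \<in> E" "x' \<in> E" "x < x'" for x x'
  proof (rule DERIV_pos_imp_increasing[OF that(3)])
    fix u assume "x \<le> u" "u \<le> x'"
    then have "u \<in> E" using iE that by (meson mem_is_interval_1_I)
    then show "\<exists>y. (T has_real_derivative y) (at u) \<and> 0 < y" using T hpos by blast
  qed
  have mono': "T x \<le> T x' \<longleftrightarrow> x \<le> x'" if "x \<in> E" "x' \<in> E" for x x'
    using mono[OF that] mono[OF that(2,1)] by (cases x x' rule: linorder_cases) auto
  have inj: "inj_on T E" by (rule inj_onI) (metis mono' order_antisym order_refl)
  have contT: "continuous_on E T"
    using T by (intro continuous_at_imp_continuous_on ballI) (blast intro: DERIV_isCont)
  define I where "I = T ` E"
  define \<tau> where "\<tau> = the_inv_into E T"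
  have \<tau>: "\<tau> (T x) = x" if "x \<in> E" for x unfolding \<tau>_def by (rule the_inv_into_f_f[OF inj that])
  have oI: "open I" unfolding I_def by (rule invariance_of_domain[OF contT oE inj])
  have "connected I" unfolding I_def
    by (rule connected_continuous_image[OF contT]) (use iE is_interval_connected in blast)
  then have iI: "is_interval I" by (simp add: is_interval_connected_1)
  have neI: "I \<noteq> {}" using neE by (simp add: I_def)
  have \<tau>': "(\<tau> has_real_derivative (norm (poly (pderiv F) (g x)))\<^sup>2) (at (T x))" if "x \<in> E" for x
  proof -
    have "(\<tau> has_real_derivative inverse (h x)) (at (T x))"
      by (rule has_field_derivative_inverse_strong[OF T[OF that] _ oE that contT])
        (use hpos[OF that] \<tau> in auto)
    then show ?thesis by (simp add: h_def)
  qed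
  have curve: "integral_curve (vfield (pderiv F)) I (g \<circ> \<tau>)"
    unfolding integral_curve_def
  proof (intro conjI neI oI iI ballI)
    fix t assume "t \<in> I"
    then obtain x where x: "x \<in> E" "t = T x" unfolding I_def by blast
    let ?p = "poly (pderiv F) (g x)"
    have "(\<tau> has_vector_derivative (norm ?p)\<^sup>2) (at t)"
      using \<tau>'[OF x(1)] x(2) by (simp add: has_real_derivative_iff_has_vector_derivative)
    moreover have "(g has_vector_derivative 1 / ?p) (at (\<tau> t))"
      using horizontal_lift_derivative[OF oE x(1) g lift nz[OF x(1)]] \<tau>[OF x(1)] x(2) by simp
    ultimately have "(g \<circ> \<tau> has_vector_derivative (norm ?p)\<^sup>2 *\<^sub>R (1 / ?p)) (at t)"
      by (rule vector_diff_chain_at)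
    moreover have "(norm ?p)\<^sup>2 *\<^sub>R (1 / ?p) = cnj ?p"
      using nz[OF x(1)] complex_norm_square[of ?p] by (simp add: scaleR_conv_of_real)
    ultimately show "(g \<circ> \<tau> has_vector_derivative vfield (pderiv F) ((g \<circ> \<tau>) t)) (at t)"
      using \<tau>[OF x(1)] x(2) by (simp add: vfield_def)
  qed
  have fw: "filterlim \<tau> (forward_end E) (forward_end I)"
    unfolding filterlim_iff eventually_forward_end[OF neE] eventually_forward_end[OF neI]
  proof (intro allI impI)
    fix Q assume "\<exists>s\<in>E. \<forall>t\<in>E. s \<le> t \<longrightarrow> Q t"
    then obtain s where s: "s \<in> E" "\<And>t. t \<in> E \<Longrightarrow> s \<le> t \<Longrightarrow> Q t" by blast
    then show "\<exists>s\<in>I. \<forall>t\<in>I. s \<le> t \<longrightarrow> Q (\<tau> t)"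
      unfolding I_def using mono' \<tau> by (intro bexI[of _ "T s"]) auto
  qed
  have bw: "filterlim \<tau> (backward_end E) (backward_end I)"
    unfolding filterlim_iff eventually_backward_end[OF neE] eventually_backward_end[OF neI]
  proof (intro allI impI)
    fix Q assume "\<exists>s\<in>E. \<forall>t\<in>E. t \<le> s \<longrightarrow> Q t"
    then obtain s where s: "s \<in> E" "\<And>t. t \<in> E \<Longrightarrow> t \<le> s \<Longrightarrow> Q t" by blast
    then show "\<exists>s\<in>I. \<forall>t\<in>I. t \<le> s \<longrightarrow> Q (\<tau> t)"
      unfolding I_def using mono' \<tau> by (intro bexI[of _ "T s"]) auto
  qed
  show ?thesis
  proof (rule that[OF curve])
    show "(g \<circ> \<tau>) ` I = g ` E" unfolding I_def image_comp[symmetric] using \<tau> by force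
    show "filterlim (g \<circ> \<tau>) G (forward_end I)" if "filterlim g G (forward_end E)" for G
      using filterlim_compose[OF that fw] by (simp add: o_def)
    show "filterlim (g \<circ> \<tau>) G (backward_end I)" if "filterlim g G (backward_end E)" for G
      using filterlim_compose[OF that bw] by (simp add: o_def)
  qed
qed

section \<open>Separatrices and the edges of the tree\<close>

lemma complete_limit_filterlim:
  assumes "complete_limit P g E" "\<And>G. filterlim g G E \<Longrightarrow> filterlim \<gamma> G E'"
  shows "complete_limit P \<gamma> E'"
  using assms unfolding complete_limit_def by blast

lemma maximal_curve_of_horizontal_lift:
  fixes F :: "complex poly" and \<alpha> \<beta> :: ereal
  defines "E \<equiv> einterval \<alpha> \<beta>"
  assumes ab: "\<alpha> < \<beta>" and g: "continuous_on E g" and lift: "\<And>x. x \<in> E \<Longrightarrow> poly F (g x) = Complex x y"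
    and nz: "\<And>x. x \<in> E \<Longrightarrow> poly (pderiv F) (g x) \<noteq> 0"
    and lim: "complete_limit (pderiv F) g (forward_end E)" "complete_limit (pderiv F) g (backward_end E)"
  obtains I \<gamma> where "maximal_curve (vfield (pderiv F)) I \<gamma>" "\<gamma> ` I = g ` E"
    "\<And>G. filterlim g G (forward_end E) \<Longrightarrow> filterlim \<gamma> G (forward_end I)"
    "\<And>G. filterlim g G (backward_end E) \<Longrightarrow> filterlim \<gamma> G (backward_end I)"
proof -
  obtain I \<gamma> where c: "integral_curve (vfield (pderiv F)) I \<gamma>" "\<gamma> ` I = g ` E"
    "\<And>G. filterlim g G (forward_end E) \<Longrightarrow> filterlim \<gamma> G (forward_end I)"
    "\<And>G. filterlim g G (backward_end E) \<Longrightarrow> filterlim \<gamma> G (backward_end I)"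
    using curve_of_horizontal_lift[OF ab, of g F y] g lift nz unfolding E_def by blast
  have "maximal_curve (vfield (pderiv F)) I \<gamma>"
  proof (rule maximal_curveI[OF c(1)])
    fix t assume "t \<in> I"
    then obtain x where "x \<in> E" "\<gamma> t = g x" using c(2) by blast
    then show "poly (pderiv F) (\<gamma> t) \<noteq> 0" using nz by simp
  qed (use complete_limit_filterlim[OF lim(1) c(3)] complete_limit_filterlim[OF lim(2) c(4)] in blast)+
  then show ?thesis using that c by blast
qed

lemma backward_end_unbounded:
  assumes "\<beta> > -\<infinity>"
  shows "eventually Q (backward_end (einterval (-\<infinity>) \<beta>)) \<longleftrightarrow> eventually Q at_bot"
proof -
  let ?E = "einterval (-\<infinity>) \<beta>"
  obtain b where b: "b \<in> ?E" using einterval_nonempty[of "-\<infinity>" \<beta>] assms by auto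
  have left: "x \<in> ?E" if "x \<le> s" "s \<in> ?E" for x s
    using that by (auto simp: einterval_iff intro: le_less_trans[of "ereal x" "ereal s"])
  have "?E \<noteq> {}" using b by blast
  then have "eventually Q (backward_end ?E) \<longleftrightarrow> (\<exists>s\<in>?E. \<forall>t\<in>?E. t \<le> s \<longrightarrow> Q t)"
    by (rule eventually_backward_end)
  also have "\<dots> \<longleftrightarrow> (\<exists>s. \<forall>t\<le>s. Q t)"
  proof
    assume "\<exists>s\<in>?E. \<forall>t\<in>?E. t \<le> s \<longrightarrow> Q t"
    then show "\<exists>s. \<forall>t\<le>s. Q t" using left by blast
  next
    assume "\<exists>s. \<forall>t\<le>s. Q t"
    then obtain s where s: "\<And>t. t \<le> s \<Longrightarrow> Q t" by blast
    have "min s b \<in> ?E" using left[OF _ b] by simp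
    then show "\<exists>s\<in>?E. \<forall>t\<in>?E. t \<le> s \<longrightarrow> Q t" using s by (intro bexI[of _ "min s b"]) auto
  qed
  finally show ?thesis by (simp add: eventually_at_bot_linorder)
qed

lemma backward_end_eq_at_bot: "\<beta> > -\<infinity> \<Longrightarrow> backward_end (einterval (-\<infinity>) \<beta>) = at_bot"
  using backward_end_unbounded by (auto simp: filter_eq_iff)

lemma forward_end_UNIV: "forward_end UNIV = (at_top :: real filter)"
  by (auto simp: filter_eq_iff eventually_forward_end eventually_at_top_linorder)

lemma at_bot_real_horizontal: "filterlim (\<lambda>\<sigma>. Complex \<sigma> y) at_infinity at_bot"
  unfolding filterlim_at_infinity[OF order_refl] eventually_at_bot_linorder
proof safe
  fix r :: real assume "r > 0"
  have "r \<le> norm (Complex x y)" if "x \<le> - r" for x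
    using abs_Re_le_cmod[of "Complex x y"] that by simp
  then show "\<exists>N. \<forall>n\<le>N. r \<le> norm (Complex n y)" by blast
qed

lemma at_top_real_horizontal: "filterlim (\<lambda>\<sigma>. Complex \<sigma> y) at_infinity at_top"
  unfolding filterlim_at_infinity[OF order_refl] eventually_at_top_linorder
proof safe
  fix r :: real assume "r > 0"
  have "r \<le> norm (Complex x y)" if "r \<le> x" for x
    using abs_Re_le_cmod[of "Complex x y"] that by simp
  then show "\<exists>N. \<forall>n\<ge>N. r \<le> norm (Complex n y)" by blast
qed

context normalized_poly begin

lemma poly_at_infinity: "filterlim g at_infinity E \<Longrightarrow> filterlim (\<lambda>x. poly F (g x)) at_infinity E"
proof -
  assume g: "filterlim g at_infinity E"
  obtain R where R: "R \<ge> 1" "\<And>z. norm z \<ge> R \<Longrightarrow> norm z ^ d \<le> 2 * d * norm (poly F z)"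
    using power_le_poly by metis
  show ?thesis unfolding filterlim_at_infinity[OF order_refl]
  proof safe
    fix r :: real assume r: "r > 0"
    have "\<forall>\<^sub>F x in E. max R (2 * d * r) \<le> norm (g x)"
      using g r R(1) unfolding filterlim_at_infinity[OF order_refl] by (metis less_max_iff_disj less_le_trans zero_less_one)
    then show "\<forall>\<^sub>F x in E. r \<le> norm (poly F (g x))"
    proof eventually_elim
      case (elim x)
      have "2 * d * r \<le> norm (g x)" using elim by simp
      also have "\<dots> \<le> norm (g x) ^ d" using elim R(1) dpos self_le_power[of "norm (g x)" d] by simp
      also have "\<dots> \<le> 2 * d * norm (poly F (g x))" using R(2) elim by simp
      finally show ?case using dpos by simp
    qed
  qed
qed

abbreviation line_value where "line_value s a y \<sigma> \<equiv> side_value s a (Complex \<sigma> y)"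

lemma continuous_line_value:
  "a \<in> {1..d} \<Longrightarrow> s \<in> {1, -1} \<Longrightarrow> continuous_on S (\<lambda>\<sigma>. line_value s a y \<sigma>)"
  by (rule continuous_on_side_value[where y = y]) (auto simp: Complex_eq intro!: continuous_intros)

lemma line_value_tendsto:
  assumes "a \<in> {1..d}" "s \<in> {1, -1}" shows "((\<lambda>\<sigma>. line_value s a y \<sigma>) \<longlongrightarrow> line_value s a y b) (at b)"
  using continuous_line_value[OF assms, of UNIV y] by (simp add: continuous_on_def)

lemma sgn_exp: "sgn (exp z) = cis (Im z)"
  unfolding sgn_eq norm_exp_eq_Re by (subst exp_eq_polar[of z]) simp

text \<open>On a fixed horizontal line the argument of \<open>- w\<close> tends to 0 on the left.\<close>

lemma sgn_left_root_tendsto: "((\<lambda>w. sgn (rt w)) \<longlongrightarrow> 1) (inf far_left (principal {w. Im w = y}))"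
proof -
  let ?G = "inf far_left (principal {w. Im w = y})"
  have ev: "\<forall>\<^sub>F w in ?G. Re w < R \<and> Im w = y" for R
    unfolding eventually_inf_principal eventually_far_left by auto
  have "((\<lambda>w. arctan (y / Re w) / d) \<longlongrightarrow> arctan 0 / d) ?G"
  proof (intro tendsto_intros)
    have "filterlim Re at_bot ?G"
      unfolding filterlim_at_bot_dense using ev by (metis (mono_tags, lifting) eventually_mono)
    then show "((\<lambda>w. y / Re w) \<longlongrightarrow> 0) ?G"
      by (intro tendsto_divide_0[OF tendsto_const] filterlim_at_bot_imp_at_infinity)
  qed (use dpos in auto)
  moreover have "isCont cis x" for x :: real
    unfolding cis_conv_exp by (intro continuous_intros)
  ultimately have lim: "((\<lambda>w. cis (arctan (y / Re w) / d)) \<longlongrightarrow> cis (arctan 0 / d)) ?G"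
    by (rule isCont_tendsto_compose[rotated])
  have ev': "\<forall>\<^sub>F w in ?G. cis (arctan (y / Re w) / d) = sgn (rt w)"
    using ev[of 0]
  proof eventually_elim
    case (elim w)
    have pos: "Re (- of_nat d * w) > 0" using elim dpos by (simp add: mult_pos_neg)
    then have nz: "- of_nat d * w \<noteq> 0" by force
    have "Im (Ln (- of_nat d * w)) = arctan (Im (- of_nat d * w) / Re (- of_nat d * w))"
      using arg_conv_arctan[OF pos] Arg_eq_Im_Ln[OF nz] by simp
    also have "\<dots> = arctan (y / Re w)" using elim dpos by (simp add: field_simps)
    finally have "Im (Ln (- of_nat d * w) / of_nat d) = arctan (y / Re w) / d"
      unfolding Im_divide_of_nat by (rule arg_cong)
    then show ?case unfolding left_root_def sgn_exp by (simp only:)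
  qed
  from tendsto_cong[THEN iffD1, OF ev' lim] show ?thesis by simp
qed

lemma sgn_branch_tendsto:
  assumes a: "a \<in> {1..d}"
  shows "((\<lambda>w. sgn (branch a w)) \<longlongrightarrow> vd a) (inf far_left (principal {w. Im w = y}))"
proof -
  let ?G = "inf far_left (principal {w. Im w = y})"
  have "((\<lambda>w. branch a w / rt w) \<longlongrightarrow> vd a) ?G"
    using branch(2)[OF a] unfolding from_valley_def by (rule tendsto_mono[rotated]) simp
  moreover have "vd a \<noteq> 0" using norm_valley_dir[of d a] by force
  ultimately have "((\<lambda>w. sgn (branch a w / rt w)) \<longlongrightarrow> sgn (vd a)) ?G" by (intro tendsto_sgn)
  then have "((\<lambda>w. sgn (branch a w / rt w) * sgn (rt w)) \<longlongrightarrow> sgn (vd a) * 1) ?G"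
    by (intro tendsto_mult sgn_left_root_tendsto)
  moreover have "sgn (branch a w / rt w) * sgn (rt w) = sgn (branch a w)" for w
    unfolding sgn_mult[symmetric] by simp
  moreover have "sgn (vd a) = vd a" by (simp add: sgn_eq)
  ultimately show ?thesis by simp
qed

lemma side_value_far_left:
  assumes a: "a \<in> {1..d}" and s: "s \<in> {1, -1}"
  shows "\<forall>\<^sub>F w in far_left. side_value s a w = branch a w \<and> w \<in> slit_plane"
proof -
  obtain R where "{w. Re w < R} \<subseteq> slit_plane" using ex_left_half_plane by blast
  then show ?thesis unfolding eventually_far_left using side_value_eq_branch[OF a s] by blast
qed

lemma filterlim_line_far_left:
  "filterlim (\<lambda>\<sigma>. Complex \<sigma> y) (inf far_left (principal {w. Im w = y})) at_bot"
proof -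
  have "filterlim (\<lambda>\<sigma>. Complex \<sigma> y) far_left at_bot"
    unfolding filterlim_iff eventually_far_left eventually_at_bot_dense
    by (metis complex.sel(1))
  then show ?thesis unfolding filterlim_inf filterlim_principal by simp
qed

end

locale generic_poly = normalized_poly +
  assumes simple: "\<And>z. poly (pderiv F) z = 0 \<Longrightarrow> poly (pderiv (pderiv F)) z \<noteq> 0"
    and no_heteroclinic: "\<And>I \<gamma>. \<not> heteroclinic_connection (pderiv F) I \<gamma>"
begin

text \<open>Between two consecutive critical points the lift of the horizontal line would be a heteroclinic
  connection.\<close>

lemma line_value_one_zero_aux:
  assumes a: "a \<in> {1..d}" and s: "s \<in> {1, -1}" and lt: "\<sigma>1 < \<sigma>2"
    and z: "poly dF (line_value s a y \<sigma>1) = 0" "poly dF (line_value s a y \<sigma>2) = 0"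
  shows False
proof -
  let ?g = "\<lambda>\<sigma>. line_value s a y \<sigma>"
  define S where "S = {\<sigma>. poly dF (?g \<sigma>) = 0 \<and> \<sigma>1 < \<sigma>}"
  have "S \<subseteq> Re ` crit_values"
  proof
    fix \<sigma> assume "\<sigma> \<in> S"
    then have "poly F (?g \<sigma>) \<in> crit_values" unfolding S_def crit_values_def by blast
    then have "Complex \<sigma> y \<in> crit_values" using side_value(1)[OF a s] by simp
    then show "\<sigma> \<in> Re ` crit_values" by (metis complex.sel(1) imageI)
  qed
  then have fin: "finite S" using finite_crit_values finite_subset by blast
  have S: "\<sigma>2 \<in> S" using lt z by (simp add: S_def)
  define m where "m = Min S"
  have m: "m \<in> S" unfolding m_def using fin S by (intro Min_in) auto
  have mle: "m \<le> x" if "x \<in> S" for x unfolding m_def using fin that by (intro Min_le)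
  let ?E = "einterval (ereal \<sigma>1) (ereal m)"
  have E: "?E = {\<sigma>1<..<m}" by (auto simp: einterval_iff)
  have lm: "\<sigma>1 < m" using m by (simp add: S_def)
  have neE: "?E \<noteq> {}" "open ?E" unfolding E using lm by (auto simp: greaterThanLessThan_empty_iff)
  have nz: "poly dF (?g x) \<noteq> 0" if "x \<in> ?E" for x using mle[of x] that unfolding E S_def by auto
  have lf: "(?g \<longlongrightarrow> ?g m) (forward_end ?E)"
  proof (rule tendsto_mono[OF forward_end_le_at[OF neE(2,1)] line_value_tendsto[OF a s]])
    show "\<exists>t\<in>?E. e < t" if "e < m" for e
      unfolding E using dense[of "max e \<sigma>1" m] that lm by auto
  qed (auto simp: E)
  have lb: "(?g \<longlongrightarrow> ?g \<sigma>1) (backward_end ?E)"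
  proof (rule tendsto_mono[OF backward_end_le_at[OF neE(2,1)] line_value_tendsto[OF a s]])
    show "\<exists>t\<in>?E. t < e" if "\<sigma>1 < e" for e
      unfolding E using dense[of \<sigma>1 "min e m"] that lm by auto
  qed (auto simp: E)
  have cl: "complete_limit dF ?g (forward_end ?E)" "complete_limit dF ?g (backward_end ?E)"
    using lf lb z(1) m unfolding complete_limit_def S_def by auto
  obtain I \<gamma> where c: "maximal_curve (vfield dF) I \<gamma>" "\<gamma> ` I = ?g ` ?E"
    "\<And>G. filterlim ?g G (forward_end ?E) \<Longrightarrow> filterlim \<gamma> G (forward_end I)"
    "\<And>G. filterlim ?g G (backward_end ?E) \<Longrightarrow> filterlim \<gamma> G (backward_end I)"
    by (rule maximal_curve_of_horizontal_lift[of "ereal \<sigma>1" "ereal m" ?g F y])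
      (use lm continuous_line_value[OF a s] side_value(1)[OF a s] nz cl in auto)
  have "heteroclinic_connection dF I \<gamma>"
    unfolding heteroclinic_connection_def
  proof (intro conjI ballI c(1))
    fix t assume "t \<in> I"
    then obtain x where "x \<in> ?E" "\<gamma> t = ?g x" using c(2) by blast
    then show "poly dF (\<gamma> t) \<noteq> 0" using nz by simp
  next
    show "\<exists>a. poly dF a = 0 \<and> (\<gamma> \<longlongrightarrow> a) (backward_end I)" using c(4)[OF lb] z(1) by blast
    show "\<exists>b. poly dF b = 0 \<and> (\<gamma> \<longlongrightarrow> b) (forward_end I)" using c(3)[OF lf] m unfolding S_def by blast
  qed
  then show False using no_heteroclinic by blast
qed

lemma line_value_one_zero:
  assumes a: "a \<in> {1..d}" and s: "s \<in> {1, -1}"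
    and z: "poly dF (line_value s a y \<sigma>) = 0" "poly dF (line_value s a y \<tau>) = 0"
  shows "\<sigma> = \<tau>"
  using line_value_one_zero_aux[OF a s _ z] line_value_one_zero_aux[OF a s _ z(2,1)]
  by (cases \<sigma> \<tau> rule: linorder_cases) auto

text \<open>At a noncritical height the whole horizontal line lifts, and the lifted orbit escapes to infinity on
  the right.\<close>

lemma branch_in_basin:
  assumes a: "a \<in> {1..d}" and v: "Im v \<notin> Im ` crit_values"
  shows "branch a v \<in> attraction_basin_infinity dF"
proof -
  let ?g = "\<lambda>\<sigma>. line_value 1 a (Im v) \<sigma>"
  let ?E = "einterval (-\<infinity>) \<infinity>"
  have E: "?E = UNIV" by (auto simp: einterval_iff)
  have sl: "Complex \<sigma> (Im v) \<in> slit_plane" for \<sigma> by (rule off_heights_slit_plane) (use v in simp)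
  have nz: "poly dF (?g \<sigma>) \<noteq> 0" for \<sigma>
    using noncritical_over_slit_plane[of "?g \<sigma>"] side_value(1)[OF a, of 1] sl by simp
  have fw: "filterlim ?g at_infinity (forward_end ?E)"
    unfolding E forward_end_UNIV using at_top_real_horizontal side_value(1)[OF a, of 1]
    by (rule_tac preimage_at_infinity) simp
  have bw: "filterlim ?g at_infinity (backward_end ?E)"
    using backward_end_eq_at_bot[of \<infinity>] at_bot_real_horizontal side_value(1)[OF a, of 1]
    by (rule_tac preimage_at_infinity) simp
  obtain I \<gamma> where c: "maximal_curve (vfield dF) I \<gamma>" "\<gamma> ` I = ?g ` ?E"
    "\<And>G. filterlim ?g G (forward_end ?E) \<Longrightarrow> filterlim \<gamma> G (forward_end I)"
    by (rule maximal_curve_of_horizontal_lift[of "-\<infinity>" \<infinity> ?g F "Im v"])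
      (use continuous_line_value[OF a] side_value(1)[OF a] nz fw bw in \<open>auto simp: complete_limit_def\<close>)
  have "branch a v = ?g (Re v)" using side_value_eq_branch[OF a, of 1 v] off_heights_slit_plane[OF v] by simp
  then have "branch a v \<in> \<gamma> ` I" unfolding c(2) E by blast
  then show ?thesis unfolding attraction_basin_infinity_def using c(1) c(3)[OF fw] by blast
qed

lemma side_value_in_closure_basin:
  assumes a: "a \<in> {1..d}" and s: "s \<in> {1, -1}"
  shows "side_value s a w \<in> closure (attraction_basin_infinity dF)"
proof -
  obtain r where r: "r > 0" "\<forall>v\<in>open_side s w \<inter> ball w r. Im v \<notin> Im ` crit_values"
    using half_disc_avoids_heights by blast
  have "\<forall>\<^sub>F v in at w within open_side s w. branch a v \<in> closure (attraction_basin_infinity dF)"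
    unfolding eventually_at
  proof (intro exI[of _ r] conjI ballI impI r(1))
    fix v assume "v \<in> open_side s w" "v \<noteq> w \<and> dist v w < r"
    then have "Im v \<notin> Im ` crit_values" using r(2) by (auto simp: dist_commute)
    then show "branch a v \<in> closure (attraction_basin_infinity dF)"
      using branch_in_basin[OF a] closure_subset by blast
  qed
  then show ?thesis
    by (rule Lim_in_closed_set[OF closed_closure _ open_side_neq_bot[OF s] side_value(2)[OF a s]])
qed

text \<open>An orbit through this point that escaped to infinity would have to follow the lift of the horizontal
  line past the height \<open>c\<close>, where there is an equilibrium.\<close>

lemma side_value_not_in_basin:
  assumes a: "a \<in> {1..d}" and s: "s \<in> {1, -1}" and z: "poly dF (line_value s a y c) = 0" and lt: "\<sigma> < c"
  shows "line_value s a y \<sigma> \<notin> attraction_basin_infinity dF"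
proof
  assume "line_value s a y \<sigma> \<in> attraction_basin_infinity dF"
  then obtain I \<gamma> t0 where I: "maximal_curve (vfield dF) I \<gamma>" "t0 \<in> I" "\<gamma> t0 = line_value s a y \<sigma>"
      "filterlim \<gamma> at_infinity (forward_end I)"
    unfolding attraction_basin_infinity_def by force
  have c: "integral_curve (vfield dF) I \<gamma>" using I(1) unfolding maximal_curve_def by blast
  have int: "is_interval I" and neI: "I \<noteq> {}" using c unfolding integral_curve_def by auto
  have Ft0: "poly F (\<gamma> t0) = Complex \<sigma> y" using I(3) side_value(1)[OF a s] by simp
  have nzt0: "poly dF (\<gamma> t0) \<noteq> 0" using line_value_one_zero[OF a s z, of \<sigma>] lt I(3) by auto
  have nz: "poly dF (\<gamma> t) \<noteq> 0" if "t \<in> I" for t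
    using curve_through_zero[OF c that _ I(2)] nzt0 by blast
  have level: "Im (poly F (\<gamma> t)) = y" if "t \<in> I" for t using curve_level[OF c that I(2)] Ft0 by simp
  have eq: "\<gamma> t = side_value s a (poly F (\<gamma> t))" if "t \<in> I" for t
    by (rule lift_eq_side_value[OF a s _ curve_continuous[OF c] level nz I(2) _ that])
      (use int is_interval_connected I(3) Ft0 in auto)
  define M where "M = \<bar>c\<bar> + \<bar>y\<bar> + \<bar>\<sigma>\<bar> + 1"
  have "\<forall>\<^sub>F t in forward_end I. M \<le> norm (poly F (\<gamma> t))"
    using poly_at_infinity[OF I(4)] unfolding filterlim_at_infinity[OF order_refl]
    by (elim allE[of _ M]) (auto simp: M_def)
  then obtain t1 where t1: "t1 \<in> I" "\<And>t. t \<in> I \<Longrightarrow> t1 \<le> t \<Longrightarrow> M \<le> norm (poly F (\<gamma> t))"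
    unfolding eventually_forward_end[OF neI] by blast
  define t2 where "t2 = max t0 t1"
  have t2: "t2 \<in> I" "t0 \<le> t2" "t1 \<le> t2" using I(2) t1(1) by (auto simp: t2_def max_def)
  have "M \<le> \<bar>Re (poly F (\<gamma> t2))\<bar> + \<bar>y\<bar>"
    using t1(2)[OF t2(1,3)] cmod_le[of "poly F (\<gamma> t2)"] level[OF t2(1)] by simp
  moreover have "\<sigma> \<le> Re (poly F (\<gamma> t2))"
    using curve_Re_less[OF c I(2) t2(1) _ nz] t2(2) Ft0 by (cases "t0 = t2") auto
  ultimately have big: "c \<le> Re (poly F (\<gamma> t2))" unfolding M_def by linarith
  have sub: "{t0..t2} \<subseteq> I" using int I(2) t2(1) by (meson atLeastAtMost_iff mem_is_interval_1_I subsetI)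
  have "\<exists>t\<ge>t0. t \<le> t2 \<and> Re (poly F (\<gamma> t)) = c"
  proof (rule IVT')
    show "continuous_on {t0..t2} (\<lambda>t. Re (poly F (\<gamma> t)))"
      by (intro continuous_intros continuous_on_subset[OF curve_continuous[OF c] sub])
  qed (use Ft0 lt big t2 in auto)
  then obtain t where t: "t \<in> I" "Re (poly F (\<gamma> t)) = c" using sub by auto
  then have "poly F (\<gamma> t) = Complex c y" using level[OF t(1)] by (simp add: complex_eq_iff)
  then show False using eq[OF t(1)] z nz[OF t(1)] by simp
qed

text \<open>The part of the lifted line to the left of the zero is an orbit from the valley \<open>a\<close> to the zero. It
  bounds the basin of infinity, because orbits at nearby heights pass the zero and escape.\<close>

lemma separatrix_to_zero:
  assumes a: "a \<in> {1..d}" and s: "s \<in> {1, -1}" and z: "poly dF z = 0" and az: "side_value s a (poly F z) = z"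
  shows "\<exists>I \<gamma>. incoming_separatrix dF I \<gamma> \<and> (\<gamma> \<longlongrightarrow> z) (forward_end I) \<and> emanates_from I \<gamma> (vd a)"
proof -
  define c where "c = Re (poly F z)"
  define y where "y = Im (poly F z)"
  let ?g = "\<lambda>\<sigma>. line_value s a y \<sigma>"
  let ?E = "einterval (-\<infinity>) (ereal c)"
  have E: "?E = {..<c}" by (auto simp: einterval_iff)
  have neE: "?E \<noteq> {}" "open ?E" unfolding E by auto
  have gc: "?g c = z" using az by (simp add: c_def y_def)
  have nz: "poly dF (?g x) \<noteq> 0" if "x \<in> ?E" for x
    using line_value_one_zero[OF a s, where y = y and \<sigma> = x and \<tau> = c] gc z that unfolding E by auto
  have lf: "(?g \<longlongrightarrow> z) (forward_end ?E)"
    unfolding gc[symmetric]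
  proof (rule tendsto_mono[OF forward_end_le_at[OF neE(2,1)] line_value_tendsto[OF a s]])
    show "\<exists>t\<in>?E. e < t" if "e < c" for e
      unfolding E using dense[of e c] that by auto
  qed (auto simp: E)
  have be: "backward_end ?E = at_bot" by (rule backward_end_eq_at_bot) simp
  have lb: "filterlim ?g at_infinity (backward_end ?E)"
    unfolding be using at_bot_real_horizontal side_value(1)[OF a s]
    by (rule_tac preimage_at_infinity) simp
  have lsgn: "((\<lambda>\<sigma>. sgn (?g \<sigma>)) \<longlongrightarrow> vd a) (backward_end ?E)"
  proof -
    have "((\<lambda>\<sigma>. sgn (branch a (Complex \<sigma> y))) \<longlongrightarrow> vd a) at_bot"
      by (rule filterlim_compose[OF sgn_branch_tendsto[OF a] filterlim_line_far_left])
    moreover have "filterlim (\<lambda>\<sigma>. Complex \<sigma> y) far_left at_bot"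
      using filterlim_line_far_left[of y] unfolding filterlim_inf by blast
    then have "\<forall>\<^sub>F \<sigma> in at_bot. ?g \<sigma> = branch a (Complex \<sigma> y)"
      using side_value_far_left[OF a s] unfolding filterlim_iff by (smt (verit, best) eventually_mono)
    then have "\<forall>\<^sub>F \<sigma> in at_bot. sgn (?g \<sigma>) = sgn (branch a (Complex \<sigma> y))"
      by eventually_elim simp
    ultimately show ?thesis unfolding be using tendsto_cong by fast
  qed
  have cl: "complete_limit dF ?g (forward_end ?E)" "complete_limit dF ?g (backward_end ?E)"
    using lf lb z unfolding complete_limit_def by auto
  obtain I \<gamma> where c: "maximal_curve (vfield dF) I \<gamma>" "\<gamma> ` I = ?g ` ?E"
    "\<And>G. filterlim ?g G (forward_end ?E) \<Longrightarrow> filterlim \<gamma> G (forward_end I)"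
    "\<And>G. filterlim ?g G (backward_end ?E) \<Longrightarrow> filterlim \<gamma> G (backward_end I)"
    by (rule maximal_curve_of_horizontal_lift[of "-\<infinity>" "ereal c" ?g F y])
      (use continuous_line_value[OF a s] side_value(1)[OF a s] nz cl in auto)
  have "incoming_separatrix dF I \<gamma>"
    unfolding incoming_separatrix_def
  proof (intro conjI c(1) bexI)
    have lt: "c - 1 < c" by simp
    then show "?g (c - 1) \<in> \<gamma> ` I" unfolding c(2) E by blast
    show "poly dF (?g (c - 1)) \<noteq> 0" using nz unfolding E by simp
    have "?g (c - 1) \<notin> attraction_basin_infinity dF"
      using side_value_not_in_basin[OF a s _ lt, of y] gc z by simp
    then show "?g (c - 1) \<in> frontier (attraction_basin_infinity dF)"
      unfolding frontier_def using side_value_in_closure_basin[OF a s] interior_subset by blast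
  qed
  moreover have "((\<lambda>t. sgn (\<gamma> t)) \<longlongrightarrow> vd a) (backward_end I)"
  proof -
    have "filterlim ?g (filtercomap sgn (nhds (vd a))) (backward_end ?E)"
      using lsgn by (simp add: filterlim_filtercomap_iff o_def)
    then have "filterlim \<gamma> (filtercomap sgn (nhds (vd a))) (backward_end I)" by (rule c(4))
    then show ?thesis by (simp add: filterlim_filtercomap_iff o_def)
  qed
  ultimately show ?thesis using c(3)[OF lf] c(4)[OF lb] unfolding emanates_from_def by blast
qed

text \<open>Far back in time the orbit lies in the valley \<open>a\<close>, hence on the branch \<open>a\<close>; by uniqueness of lifts it
  follows the boundary values of that branch up to the zero.\<close>

lemma side_value_of_separatrix:
  assumes a: "a \<in> {1..d}" and s: "s \<in> {1, -1}" and I: "incoming_separatrix dF I \<gamma>"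
    and lim: "(\<gamma> \<longlongrightarrow> z) (forward_end I)" and em: "emanates_from I \<gamma> (vd a)"
  shows "side_value s a (poly F z) = z"
proof -
  have c: "integral_curve (vfield dF) I \<gamma>" using I unfolding incoming_separatrix_def maximal_curve_def by blast
  have int: "is_interval I" and neI: "I \<noteq> {}" using c unfolding integral_curve_def by auto
  obtain t1 where t1: "t1 \<in> I" "poly dF (\<gamma> t1) \<noteq> 0" using I unfolding incoming_separatrix_def by blast
  have nz: "poly dF (\<gamma> t) \<noteq> 0" if "t \<in> I" for t using curve_through_zero[OF c that _ t1(1)] t1(2) by blast
  define y where "y = Im (poly F (\<gamma> t1))"
  have level: "Im (poly F (\<gamma> t)) = y" if "t \<in> I" for t using curve_level[OF c that t1(1)] by (simp add: y_def)
  let ?L = "{w. Im w = y}"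
  have inf: "filterlim (\<lambda>t. poly F (\<gamma> t)) at_infinity (backward_end I)"
    using em poly_at_infinity unfolding emanates_from_def by blast
  have far: "filterlim (\<lambda>t. poly F (\<gamma> t)) (inf far_left (principal ?L)) (backward_end I)"
    unfolding filterlim_inf filterlim_principal
  proof (intro conjI)
    show "\<forall>\<^sub>F t in backward_end I. poly F (\<gamma> t) \<in> ?L"
      using eventually_in_backward_end[OF neI] by eventually_elim (simp add: level)
    show "filterlim (\<lambda>t. poly F (\<gamma> t)) far_left (backward_end I)"
      unfolding far_left_def filterlim_filtercomap_iff filterlim_at_bot_dense
    proof
      fix R
      define M where "M = \<bar>R\<bar> + \<bar>y\<bar> + \<bar>Re (poly F (\<gamma> t1))\<bar> + 1"
      have "\<forall>\<^sub>F t in backward_end I. M \<le> norm (poly F (\<gamma> t))"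
        using inf unfolding filterlim_at_infinity[OF order_refl]
        by (elim allE[of _ M]) (auto simp: M_def)
      moreover have "\<forall>\<^sub>F t in backward_end I. t \<in> I \<and> t \<le> t1"
        unfolding eventually_backward_end[OF neI] using t1(1) by blast
      ultimately show "\<forall>\<^sub>F t in backward_end I. (Re \<circ> (\<lambda>t. poly F (\<gamma> t))) t < R"
      proof eventually_elim
        case (elim t)
        have "M \<le> \<bar>Re (poly F (\<gamma> t))\<bar> + \<bar>y\<bar>"
          using elim(1) cmod_le[of "poly F (\<gamma> t)"] level elim(2) by simp
        moreover have "Re (poly F (\<gamma> t)) \<le> Re (poly F (\<gamma> t1))"
          using curve_Re_less[OF c _ t1(1) _ nz, of t] elim(2) by (cases "t = t1") auto
        ultimately show ?case unfolding M_def o_def by linarith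
      qed
    qed
  qed
  obtain e where e: "e > 0" "\<forall>x\<in>vd ` {1..d}. \<forall>y\<in>vd ` {1..d}. dist x y < e \<longrightarrow> x = y"
    using finite_set_separated[of "vd ` {1..d}"] by auto
  have "\<forall>\<^sub>F t in backward_end I. dist (sgn (branch b (poly F (\<gamma> t)))) (vd b) < e / 2" if "b \<in> {1..d}" for b
    using filterlim_compose[OF sgn_branch_tendsto[OF that] far] e(1) by (intro tendstoD) auto
  then have ev1: "\<forall>\<^sub>F t in backward_end I. \<forall>b\<in>{1..d}. dist (sgn (branch b (poly F (\<gamma> t)))) (vd b) < e / 2"
    by (intro eventually_ball_finite) auto
  have ev2: "\<forall>\<^sub>F t in backward_end I. dist (sgn (\<gamma> t)) (vd a) < e / 2"
    using em e(1) unfolding emanates_from_def by (intro tendstoD) auto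
  have "filterlim (\<lambda>t. poly F (\<gamma> t)) far_left (backward_end I)" using far unfolding filterlim_inf by blast
  then have ev3: "\<forall>\<^sub>F t in backward_end I. side_value s a (poly F (\<gamma> t)) = branch a (poly F (\<gamma> t)) \<and> poly F (\<gamma> t) \<in> slit_plane"
    using side_value_far_left[OF a s] unfolding filterlim_iff by blast
  have "\<forall>\<^sub>F t in backward_end I. t \<in> I \<and> \<gamma> t = side_value s a (poly F (\<gamma> t))"
    using ev1 ev2 ev3 eventually_in_backward_end[OF neI]
  proof eventually_elim
    case (elim t)
    obtain b where b: "b \<in> {1..d}" "branch b (poly F (\<gamma> t)) = \<gamma> t" using branch_surj elim(3) by blast
    have "dist (sgn (\<gamma> t)) (vd b) < e / 2" using elim(1) b by metis
    then have "dist (vd a) (vd b) < e"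
      using elim(2) by (metis dist_commute dist_triangle_half_l)
    then have "vd a = vd b" using e(2)[rule_format, of "vd a" "vd b"] a b(1) by simp
    then have "a = b" by (rule inj_onD[OF inj_valley_dir[OF dpos] _ a b(1)])
    then show ?case using b(2) elim(3,4) by simp
  qed
  then obtain t0 where t0: "t0 \<in> I" "\<gamma> t0 = side_value s a (poly F (\<gamma> t0))"
    using eventually_happens'[OF backward_end_neq_bot[OF neI]] by blast
  have eq: "\<gamma> t = side_value s a (poly F (\<gamma> t))" if "t \<in> I" for t
    by (rule lift_eq_side_value[OF a s _ curve_continuous[OF c] level nz t0 that])
      (use int is_interval_connected in auto)
  have Flim: "((\<lambda>t. poly F (\<gamma> t)) \<longlongrightarrow> poly F z) (forward_end I)"
    by (rule isCont_tendsto_compose[OF _ lim]) simp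
  have evL: "\<forall>\<^sub>F t in forward_end I. poly F (\<gamma> t) \<in> ?L"
    using eventually_in_forward_end[OF neI] by eventually_elim (simp add: level)
  have "closed ?L" by (intro closed_Collect_eq continuous_intros)
  then have zL: "poly F z \<in> ?L"
    by (rule Lim_in_closed_set[OF _ evL forward_end_neq_bot[OF neI] Flim])
  have "((\<lambda>t. side_value s a (poly F (\<gamma> t))) \<longlongrightarrow> side_value s a (poly F z)) (forward_end I)"
    by (rule continuous_on_tendsto_compose[OF continuous_on_line_side_value[OF a s] Flim zL evL])
  moreover have "\<forall>\<^sub>F t in forward_end I. side_value s a (poly F (\<gamma> t)) = \<gamma> t"
    using eventually_in_forward_end[OF neI] by eventually_elim (use eq in simp)
  ultimately have "(\<gamma> \<longlongrightarrow> side_value s a (poly F z)) (forward_end I)"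
    using tendsto_cong by fast
  then show ?thesis using tendsto_unique[OF forward_end_neq_bot[OF neI]] lim by blast
qed

definition edge :: "complex \<Rightarrow> nat set" where
  "edge z = edge_of_zero (d - 2) dF z"

lemma repelling_vertex_eq: "repelling_vertex (d - 2) a = vd a"
  using d2 unfolding repelling_vertex_def valley_dir_def
  by (intro arg_cong[of _ _ cis]) (simp add: field_simps of_nat_diff)

text \<open>The edges of the tree read off from orbits are those read off from the branches, on either side of
  the slits.\<close>

lemma edge_eq:
  assumes z: "poly dF z = 0" and s: "s \<in> {1, -1}"
  shows "edge z = {a\<in>{1..d}. side_value s a (poly F z) = z}"
proof -
  have "d - 2 + 2 = d" using d2 by simp
  then show ?thesis
    unfolding edge_def edge_of_zero_def repelling_vertex_eq
    using separatrix_to_zero[OF _ s z] side_value_of_separatrix[OF _ s] by auto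
qed

lemma ex_chart:
  assumes "poly dF z = 0"
  obtains \<psi> \<rho> where "critical_chart F d z \<psi> \<rho>"
proof -
  obtain \<psi> \<rho> where "\<rho> > 0" "\<psi> holomorphic_on ball z \<rho>" "inj_on \<psi> (ball z \<rho>)" "\<psi> z = 0"
    "\<And>x. x \<in> ball z \<rho> \<Longrightarrow> poly F x - poly F z = (\<psi> x)\<^sup>2"
    using poly_simple_critical_point_chart[OF assms simple[OF assms]] by blast
  then have "critical_chart F d z \<psi> \<rho>" by unfold_locales auto
  then show ?thesis by (rule that)
qed

lemma edge_two:
  assumes "poly dF z = 0" shows "\<exists>a b. a \<noteq> b \<and> edge z = {a, b}" "edge z \<subseteq> {1..d}"
proof -
  obtain \<psi> \<rho> where "critical_chart F d z \<psi> \<rho>" using ex_chart[OF assms] .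
  then interpret critical_chart F d z \<psi> \<rho> .
  show "\<exists>a b. a \<noteq> b \<and> edge z = {a, b}" "edge z \<subseteq> {1..d}"
    using two_sides_at_critical_point[of 1] edge_eq[OF assms, of 1] by auto
qed

lemma edge_at_same_height:
  assumes z: "poly dF z = 0" "poly dF z' = 0" and a: "a \<in> edge z" "a \<in> edge z'"
    and im: "Im (poly F z) = Im (poly F z')"
  shows "z = z'"
proof -
  have a': "a \<in> {1..d}" "side_value 1 a (poly F z) = z" "side_value 1 a (poly F z') = z'"
    using a edge_eq[of _ 1] z by auto
  define y where "y = Im (poly F z)"
  have v: "line_value 1 a y (Re (poly F z)) = z" "line_value 1 a y (Re (poly F z')) = z'"
  proof -
    have "Complex (Re (poly F z)) y = poly F z" "Complex (Re (poly F z')) y = poly F z'"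
      by (simp_all add: y_def complex_eq_iff im)
    then show "line_value 1 a y (Re (poly F z)) = z" "line_value 1 a y (Re (poly F z')) = z'"
      by (simp_all only: a'(2,3))
  qed
  have same: "Re (poly F z) = Re (poly F z')"
    by (rule line_value_one_zero[OF a'(1), where s = 1 and y = y]) (simp_all only: v z insert_iff simp_thms)
  have "z = line_value 1 a y (Re (poly F z))" by (rule v(1)[symmetric])
  also have "\<dots> = line_value 1 a y (Re (poly F z'))" unfolding same ..
  also have "\<dots> = z'" by (rule v(2))
  finally show ?thesis .
qed

text \<open>Both sides are lifts of the same horizontal line and coincide far to the left, where there are no
  slits; by uniqueness they can separate only at a critical point.\<close>

lemma sides_agree_before:
  assumes a: "a \<in> {1..d}" and nz: "\<And>\<sigma>. \<sigma> < Re p \<Longrightarrow> poly dF (line_value 1 a (Im p) \<sigma>) \<noteq> 0"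
  shows "side_value 1 a p = side_value (-1) a p"
proof -
  let ?u = "\<lambda>\<sigma>. line_value 1 a (Im p) \<sigma>" and ?l = "\<lambda>\<sigma>. line_value (-1) a (Im p) \<sigma>"
  obtain R where R: "{w. Re w < R} \<subseteq> slit_plane" using ex_left_half_plane by blast
  define \<sigma>0 where "\<sigma>0 = min R (Re p) - 1"
  have s0: "\<sigma>0 \<in> {..<Re p}" "Complex \<sigma>0 (Im p) \<in> slit_plane" using R by (auto simp: \<sigma>0_def)
  have eq: "?u \<sigma> = ?l \<sigma>" if "\<sigma> \<in> {..<Re p}" for \<sigma>
  proof -
    have "?u \<sigma> = side_value (-1) a (poly F (?u \<sigma>))"
    proof (rule lift_eq_side_value[OF a _ _ _ _ _ s0(1) _ that, where y = "Im p"])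
      show "?u \<sigma>0 = side_value (-1) a (poly F (?u \<sigma>0))"
        unfolding side_value(1)[OF a insertI1] using side_value_eq_branch[OF a _ s0(2)] by simp
    qed (use nz side_value(1)[OF a, of 1] continuous_line_value[OF a] in auto)
    then show ?thesis using side_value(1)[OF a, of 1] by simp
  qed
  have u: "(?u \<longlongrightarrow> ?u (Re p)) (at_left (Re p))"
    by (rule tendsto_within_subset[OF line_value_tendsto[OF a] subset_UNIV]) simp
  have l: "(?l \<longlongrightarrow> ?l (Re p)) (at_left (Re p))"
    by (rule tendsto_within_subset[OF line_value_tendsto[OF a] subset_UNIV]) simp
  have "\<forall>\<^sub>F \<sigma> in at_left (Re p). ?u \<sigma> = ?l \<sigma>"
    using eq by (auto simp: eventually_at_filter)
  from tendsto_cong[THEN iffD1, OF this u] have "(?l \<longlongrightarrow> ?u (Re p)) (at_left (Re p))" .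
  from tendsto_unique[OF trivial_limit_at_left_real this l] show ?thesis by simp
qed

lemma sides_agree:
  assumes a: "a \<in> {1..d}"
    and no: "\<And>z. poly dF z = 0 \<Longrightarrow> a \<in> edge z \<Longrightarrow> Im (poly F z) = Im p \<Longrightarrow> Re (poly F z) < Re p \<Longrightarrow> False"
  shows "side_value 1 a p = side_value (-1) a p"
proof (rule sides_agree_before[OF a])
  fix \<sigma> assume lt: "\<sigma> < Re p"
  let ?z = "line_value 1 a (Im p) \<sigma>"
  have F: "poly F ?z = Complex \<sigma> (Im p)" using side_value(1)[OF a] by simp
  show "poly dF ?z \<noteq> 0"
  proof
    assume z: "poly dF ?z = 0"
    have "a \<in> edge ?z" using edge_eq[OF z, of 1] a F by simp
    then show False using no[OF z] F lt by simp
  qed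
qed

text \<open>The swap that takes place just to the right of the zero persists along the whole ray, because an
  outgoing separatrix meets no further zero.\<close>

lemma sides_swap:
  assumes z: "poly dF z = 0" and e: "edge z = {a, b}" "a \<noteq> b"
    and p: "Im (poly F z) = Im p" "Re (poly F z) < Re p"
  shows "side_value 1 a p = side_value (-1) b p"
proof -
  obtain \<psi> \<rho> where "critical_chart F d z \<psi> \<rho>" using ex_chart[OF z] .
  then interpret critical_chart F d z \<psi> \<rho> .
  have a: "a \<in> {1..d}" "side_value 1 a c = z" "side_value (-1) a c = z"
    using e edge_eq[OF z, of 1] edge_eq[OF z, of "-1"] by auto
  have b: "b \<in> {1..d}" "side_value 1 b c = z" "side_value (-1) b c = z"
    using e edge_eq[OF z, of 1] edge_eq[OF z, of "-1"] by auto
  have uz: "poly dF (line_value 1 a (Im c) \<sigma>) \<noteq> 0" if "\<sigma> \<noteq> Re c" for \<sigma>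
    using line_value_one_zero[OF a(1), where s = 1 and y = "Im c" and \<sigma> = \<sigma> and \<tau> = "Re c"] that a(2) z by auto
  have left: "side_value 1 a (c - of_real t) = side_value (-1) a (c - of_real t)" if "t > 0" for t
    by (rule sides_agree_before[OF a(1)]) (use uz that in auto)
  obtain \<delta> where \<delta>: "\<delta> > 0" "\<And>t. 0 < t \<and> t < \<delta> \<Longrightarrow> side_value 1 a (c + of_real t) = side_value (-1) b (c + of_real t)"
    using swap_right_of_critical_point[OF a(1) b(1) e(2) a(2,3) b(3) left] by blast
  define \<sigma>0 where "\<sigma>0 = Re c + \<delta> / 2"
  have s0: "\<sigma>0 \<in> {Re c<..}" using \<delta>(1) by (simp add: \<sigma>0_def)
  have c0: "c + of_real (\<delta> / 2) = Complex \<sigma>0 (Im p)" using p by (simp add: \<sigma>0_def complex_eq_iff)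
  let ?u = "\<lambda>\<sigma>. line_value 1 a (Im p) \<sigma>"
  have "?u (Re p) = side_value (-1) b (poly F (?u (Re p)))"
  proof (rule lift_eq_side_value[OF b(1) _ _ _ _ _ s0, where y = "Im p" and \<gamma> = ?u])
    show "?u \<sigma>0 = side_value (-1) b (poly F (?u \<sigma>0))"
      unfolding side_value(1)[OF a(1) insertI1] using \<delta>(2)[of "\<delta> / 2"] \<delta>(1) unfolding c0 by simp
    show "poly dF (?u x) \<noteq> 0" if "x \<in> {Re c<..}" for x using uz[of x] that p(1) by simp
  qed (use side_value(1)[OF a(1), of 1] continuous_line_value[OF a(1)] p in auto)
  then show ?thesis using side_value(1)[OF a(1), of 1] by simp
qed

end

section \<open>Gluing the branches and connectedness of the tree\<close>

text \<open>One-sided continuity from above and from below is continuity, and a continuous function that is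
  holomorphic off finitely many horizontal lines is holomorphic on them too, by Morera's theorem.\<close>

lemma entire_of_sides:
  fixes f :: "complex \<Rightarrow> complex" and H :: "real set"
  assumes H: "finite H" and hol: "f holomorphic_on {w. Im w \<notin> H}"
    and lim: "\<And>w. (f \<longlongrightarrow> f w) (at w within closed_side 1 w)" "\<And>w. (f \<longlongrightarrow> f w) (at w within closed_side (-1) w)"
  shows "f holomorphic_on UNIV"
proof -
  have cont: "continuous_on UNIV f"
    unfolding continuous_on_def
  proof
    fix w
    have "closed_side 1 w \<union> closed_side (-1) w = UNIV" by (auto simp: closed_side_def)
    then show "(f \<longlongrightarrow> f w) (at w within UNIV)" using Lim_Un[OF lim(1) lim(2), of w] by simp
  qed
  have "f field_differentiable at p" for p
  proof -
    obtain r where r: "r > 0" "\<forall>x\<in>H. x \<noteq> Im p \<longrightarrow> r \<le> dist (Im p) x"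
      using finite_set_avoid[OF H] by meson
    have off: "Im v \<notin> H" if "v \<in> ball p r" "Im v \<noteq> Im p" for v
      using r(2) that abs_Im_le_cmod[of "p - v"] by (fastforce simp: dist_norm)
    have "f holomorphic_on ball p r"
    proof (rule holomorphic_on_paste_across_line[OF open_ball, of \<i> f p r "Im p"])
      show "f holomorphic_on ball p r \<inter> {z. \<i> \<bullet> z < Im p}" "f holomorphic_on ball p r \<inter> {z. Im p < \<i> \<bullet> z}"
        by (rule holomorphic_on_subset[OF hol], use off in \<open>auto simp: inner_complex_def\<close>)+
    qed (use continuous_on_subset[OF cont] in auto)
    then show ?thesis using r(1) by (intro holomorphic_on_imp_differentiable_at[of f "ball p r"]) auto
  qed
  then show ?thesis by (simp add: holomorphic_on_def)
qed

lemma entire_linear_growth: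
  assumes hol: "f holomorphic_on UNIV" and C: "\<And>w. norm (f w) \<le> C * (1 + norm w)"
  shows "\<exists>\<alpha> \<beta>. \<forall>w. f w = \<alpha> + \<beta> * w"
proof -
  have C0: "C \<ge> 0" using order_trans[OF norm_ge_zero C[of 0]] by simp
  have *: "norm (f w) \<le> 2 * C * norm w ^ 1" if "1 \<le> norm w" for w
  proof -
    have "C * (1 + norm w) \<le> C * (2 * norm w)" using that C0 by (intro mult_left_mono) auto
    then show ?thesis using C[of w] by simp
  qed
  have "f w = f 0 + deriv f 0 * w" for w
    using Liouville_polynomial[OF hol *, where \<xi> = w] by simp
  then show ?thesis by (intro exI allI)
qed

text \<open>At most \<open>n\<close> factors, each at most the \<open>n\<close>-th root of \<open>B\<close>. Applied to branches of the inverse of a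
  polynomial of degree \<open>n\<close>, it bounds their product linearly.\<close>

lemma prod_le_of_power_le:
  fixes x :: "'a \<Rightarrow> real"
  assumes A: "card A \<le> n" "n > 0" and x: "\<And>a. a \<in> A \<Longrightarrow> 0 \<le> x a \<and> x a ^ n \<le> B" and B: "B \<ge> 1"
  shows "(\<Prod>a\<in>A. x a) \<le> B"
proof -
  have "(\<Prod>a\<in>A. x a) ^ n = (\<Prod>a\<in>A. x a ^ n)" by (simp add: prod_power_distrib)
  also have "\<dots> \<le> (\<Prod>a\<in>A. B)" using x by (intro prod_mono) auto
  also have "\<dots> = B ^ card A" by simp
  also have "\<dots> \<le> B ^ n" using A(1) B by (intro power_increasing) auto
  finally show ?thesis using A(2) B by (simp add: power_mono_iff prod_nonneg x)
qed

text \<open>The involution exchanging the ends of each edge of a matching.\<close>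

definition swap_along :: "'a set set \<Rightarrow> 'a \<Rightarrow> 'a" where
  "swap_along M a = (if \<exists>b. b \<noteq> a \<and> {a, b} \<in> M then THE b. b \<noteq> a \<and> {a, b} \<in> M else a)"

definition matching :: "'a set set \<Rightarrow> bool" where
  "matching M \<longleftrightarrow> (\<forall>e\<in>M. \<exists>a b. a \<noteq> b \<and> e = {a, b}) \<and> (\<forall>e\<in>M. \<forall>e'\<in>M. e \<inter> e' \<noteq> {} \<longrightarrow> e = e')"

lemma swap_along_edge:
  assumes "matching M" "{a, b} \<in> M" "a \<noteq> b" shows "swap_along M a = b"
proof -
  have "c = b" if "c \<noteq> a \<and> {a, c} \<in> M" for c
  proof -
    have "{a, c} = {a, b}"
      using assms(1)[unfolded matching_def, THEN conjunct2, rule_format, of "{a, c}" "{a, b}"] assms(2) that by blast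
    then show ?thesis using that by (auto simp: doubleton_eq_iff)
  qed
  then have "(THE b. b \<noteq> a \<and> {a, b} \<in> M) = b"
    by (rule_tac the_equality) (use assms(2,3) in simp_all)
  moreover have "\<exists>b. b \<noteq> a \<and> {a, b} \<in> M" using assms(2,3) by (intro exI[of _ b]) simp
  ultimately show ?thesis unfolding swap_along_def by (simp only: if_True)
qed

lemma swap_along_none: "(\<And>e. e \<in> M \<Longrightarrow> a \<notin> e) \<Longrightarrow> swap_along M a = a"
  unfolding swap_along_def by auto

lemma swap_along_cases:
  assumes "matching M"
  obtains (edge) b where "{a, b} \<in> M" "a \<noteq> b" "swap_along M a = b" | (none) "\<And>e. e \<in> M \<Longrightarrow> a \<notin> e" "swap_along M a = a"
proof (cases "\<exists>e\<in>M. a \<in> e")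
  case True
  then obtain e where e: "e \<in> M" "a \<in> e" by blast
  have "\<exists>x y. x \<noteq> y \<and> e = {x, y}"
    by (rule bspec[OF assms[unfolded matching_def, THEN conjunct1] e(1)])
  then obtain x y where xy: "x \<noteq> y" "e = {x, y}" by (elim exE conjE)
  obtain b where b: "{a, b} \<in> M" "a \<noteq> b"
  proof (cases "a = x")
    case True
    then show ?thesis using e(1) xy by (rule_tac that[of y]) simp_all
  next
    case False
    then have "a = y" using e(2) xy by simp
    then show ?thesis using e(1) xy by (rule_tac that[of x]) (simp_all add: insert_commute)
  qed
  show ?thesis by (rule edge[OF b swap_along_edge[OF assms b]])
next
  case False
  then have n: "a \<notin> e" if "e \<in> M" for e using that by blast
  show ?thesis by (rule none[OF n swap_along_none[OF n]])
qed

lemma swap_along_involution: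
  assumes "matching M" shows "swap_along M (swap_along M a) = a"
  using assms
proof (cases rule: swap_along_cases[of M a])
  case (edge b)
  then have "{b, a} \<in> M" "b \<noteq> a" by (auto simp: insert_commute)
  then show ?thesis using swap_along_edge[OF assms] edge(3) by simp
qed simp

lemma swap_along_closed:
  assumes M: "matching M" and A: "\<And>e. e \<in> M \<Longrightarrow> e \<inter> A \<noteq> {} \<Longrightarrow> e \<subseteq> A" and a: "a \<in> A"
  shows "swap_along M a \<in> A"
  using M
proof (cases rule: swap_along_cases[of M a])
  case (edge b)
  then have "{a, b} \<subseteq> A" using A a by blast
  then show ?thesis using edge by simp
qed (use a in simp)

text \<open>Grow a connected set of vertices from a single one: each new vertex needs a new edge.\<close>

lemma card_vertices_le_edges:
  assumes V: "finite V" "V \<noteq> {}" and ES: "finite ES" "\<And>e. e \<in> ES \<Longrightarrow> e \<subseteq> V \<and> (\<exists>a b. e = {a, b})"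
    and conn: "\<And>A. A \<subseteq> V \<Longrightarrow> A \<noteq> {} \<Longrightarrow> A \<noteq> V \<Longrightarrow> \<exists>e\<in>ES. e \<inter> A \<noteq> {} \<and> \<not> e \<subseteq> A"
  shows "card V \<le> card ES + 1"
proof -
  have grow: "n < card V \<Longrightarrow> \<exists>A T. A \<subseteq> V \<and> card A = Suc n \<and> T \<subseteq> ES \<and> card T = n \<and> (\<forall>e\<in>T. e \<subseteq> A)" for n
  proof (induction n)
    case 0
    obtain v where "v \<in> V" using V(2) by blast
    then show ?case by (intro exI[of _ "{v}"] exI[of _ "{}"]) auto
  next
    case (Suc n)
    then obtain A T where AT: "A \<subseteq> V" "card A = Suc n" "T \<subseteq> ES" "card T = n" "\<And>e. e \<in> T \<Longrightarrow> e \<subseteq> A"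
      by fastforce
    have "A \<noteq> {}" "A \<noteq> V" using AT(2) Suc.prems by auto
    from conn[OF AT(1) this] obtain e where e: "e \<in> ES" "e \<inter> A \<noteq> {}" "\<not> e \<subseteq> A" by (elim bexE conjE)
    have fin: "finite A" "finite T"
      by (rule finite_subset[OF AT(1) V(1)], rule finite_subset[OF AT(3) ES(1)])
    have eV: "e \<subseteq> V" and "\<exists>a b. e = {a, b}" using ES(2)[OF e(1)] by simp_all
    then obtain a b where ab: "e = {a, b}" by (elim exE)
    obtain v where "v \<in> e" "v \<notin> A" using e(3) by (auto simp: subset_iff)
    then have v: "v \<in> V" "v \<notin> A" "e \<subseteq> insert v A" using eV e(2) unfolding ab by auto
    show ?case
    proof (intro exI conjI ballI)
      show "insert v A \<subseteq> V" "insert e T \<subseteq> ES" using v AT e by auto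
      show "card (insert v A) = Suc (Suc n)" using v(2) AT(2) fin(1) by simp
      have "e \<notin> T" using AT(5) e(3) by blast
      then show "card (insert e T) = Suc n" using AT(4) fin(2) by simp
      show "e' \<subseteq> insert v A" if "e' \<in> insert e T" for e' using that v(3) AT(5) by blast
    qed
  qed
  have "card V - 1 < card V" using V by (simp add: card_gt_0_iff)
  from grow[OF this] obtain T where T: "T \<subseteq> ES" "card T = card V - 1" by (elim exE conjE)
  then show ?thesis using card_mono[OF ES(1) T(1)] by simp
qed

context normalized_poly begin

lemma side_value_growth:
  obtains C where "C \<ge> 1" "\<And>a s w. a \<in> {1..d} \<Longrightarrow> s \<in> {1, -1} \<Longrightarrow> norm (side_value s a w) ^ d \<le> C * (1 + norm w)"
proof -
  obtain R where R: "R \<ge> 1" "\<And>z. norm z \<ge> R \<Longrightarrow> norm z ^ d \<le> 2 * d * norm (poly F z)"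
    using power_le_poly by metis
  define C where "C = R ^ d + 2 * d"
  have "R ^ d \<ge> 1" using R(1) by simp
  then have C: "C \<ge> 1" "C \<ge> 2 * d" "C \<ge> R ^ d" unfolding C_def by auto
  show ?thesis
  proof (rule that[OF C(1)])
    fix a s w assume as: "a \<in> {1..d}" "s \<in> {1, -1::real}"
    have F: "poly F (side_value s a w) = w" by (rule side_value(1)[OF as])
    show "norm (side_value s a w) ^ d \<le> C * (1 + norm w)"
    proof (cases "norm (side_value s a w) \<ge> R")
      case True
      then have "norm (side_value s a w) ^ d \<le> 2 * d * norm w" using R(2) F by metis
      also have "\<dots> \<le> C * (1 + norm w)" using C by (intro mult_mono) auto
      finally show ?thesis .
    next
      case False
      then have "norm (side_value s a w) ^ d \<le> R ^ d" by (intro power_mono) auto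
      also have "\<dots> \<le> C * (1 + norm w)" using C mult_mono[of "R ^ d" C 1 "1 + norm w"] R(1) by simp
      finally show ?thesis .
    qed
  qed
qed

lemma far_left_at_infinity: "filterlim (\<lambda>w. w) at_infinity far_left"
  unfolding filterlim_at_infinity[OF order_refl] eventually_far_left
proof safe
  fix r :: real
  have "r \<le> norm w" if "Re w < - r" for w using that abs_Re_le_cmod[of w] by linarith
  then show "\<exists>R. \<forall>w. Re w < R \<longrightarrow> r \<le> norm w" by blast
qed

lemma branch_at_infinity:
  assumes a: "a \<in> {1..d}" and s: "s \<in> {1, -1}"
  shows "filterlim (side_value s a) at_infinity far_left"
proof (rule preimage_at_infinity)
  show "filterlim (\<lambda>w. poly F (side_value s a w)) at_infinity far_left"
    using far_left_at_infinity side_value(1)[OF a s] by simp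
qed

lemma side_value_holomorphic:
  assumes a: "a \<in> {1..d}" and s: "s \<in> {1, -1}"
  shows "side_value s a holomorphic_on {w. Im w \<notin> Im ` crit_values}"
proof -
  have sub: "{w. Im w \<notin> Im ` crit_values} \<subseteq> slit_plane" using off_heights_slit_plane by blast
  have "branch a holomorphic_on {w. Im w \<notin> Im ` crit_values}"
    using inverse_branch_holomorphic[OF branch(1)[OF a]] sub by (rule holomorphic_on_subset)
  then show ?thesis
    by (rule holomorphic_transform) (use side_value_eq_branch[OF a s] sub in auto)
qed

end

definition cut_edges :: "(nat set \<times> complex) set \<Rightarrow> complex \<Rightarrow> nat set set" where
  "cut_edges K p = {e. \<exists>c. (e, c) \<in> K \<and> Im c = Im p \<and> Re c < Re p}"

context generic_poly begin

text \<open>The combinatorial invariant together with the critical values. It determines how the branches are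
  glued across the slits.\<close>

definition crit_data where "crit_data = (\<lambda>z. (edge z, poly F z)) ` {z. poly dF z = 0}"

abbreviation partner where "partner p \<equiv> swap_along (cut_edges crit_data p)"

lemma cut_edges_eq:
  "cut_edges crit_data p = {edge z | z. poly dF z = 0 \<and> Im (poly F z) = Im p \<and> Re (poly F z) < Re p}"
  unfolding cut_edges_def crit_data_def by auto

text \<open>Two edges at the same height cannot share a vertex, since a branch meets only one critical point at
  each height.\<close>

lemma matching_cut_edges: "matching (cut_edges crit_data p)"
  unfolding matching_def
proof (intro conjI ballI impI)
  fix e assume "e \<in> cut_edges crit_data p"
  then show "\<exists>a b. a \<noteq> b \<and> e = {a, b}" unfolding cut_edges_eq using edge_two(1) by blast
next
  fix e e' assume "e \<in> cut_edges crit_data p" "e' \<in> cut_edges crit_data p" "e \<inter> e' \<noteq> {}"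
  then obtain z z' a where z: "e = edge z" "e' = edge z'" "poly dF z = 0" "poly dF z' = 0"
     "Im (poly F z) = Im p" "Im (poly F z') = Im p" "a \<in> edge z" "a \<in> edge z'"
    unfolding cut_edges_eq by blast
  then have "z = z'" using edge_at_same_height[of z z' a] by simp
  then show "e = e'" using z by simp
qed

text \<open>The gluing rule: across the point \<open>p\<close> of a slit, the branch \<open>a\<close> continues as its partner along the
  edges whose critical value lies to the left of \<open>p\<close> at the same height.\<close>

lemma sides_partner:
  assumes a: "a \<in> {1..d}" shows "side_value 1 a p = side_value (-1) (partner p a) p"
  using matching_cut_edges
proof (cases rule: swap_along_cases[of "cut_edges crit_data p" a])
  case (edge b)
  then obtain z where "poly dF z = 0" "edge z = {a, b}" "Im (poly F z) = Im p" "Re (poly F z) < Re p"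
    unfolding cut_edges_eq by auto
  then show ?thesis using sides_swap edge by metis
next
  case none
  have "side_value 1 a p = side_value (-1) a p"
    by (rule sides_agree[OF a]) (use none(1) in \<open>auto simp: cut_edges_eq\<close>)
  then show ?thesis using none(2) by simp
qed

lemma partner_closed:
  assumes "\<And>z. poly dF z = 0 \<Longrightarrow> edge z \<inter> A \<noteq> {} \<Longrightarrow> edge z \<subseteq> A" "a \<in> A"
  shows "partner p a \<in> A"
  by (rule swap_along_closed[OF matching_cut_edges _ assms(2)]) (use assms(1) in \<open>auto simp: cut_edges_eq\<close>)

text \<open>A set of vertices closed under edges is permuted by the gluing, so the product of its branches has
  no jump on the slits. It is entire, and its growth is at most linear.\<close>

lemma prod_side_value_entire:
  assumes A: "A \<subseteq> {1..d}" "\<And>z. poly dF z = 0 \<Longrightarrow> edge z \<inter> A \<noteq> {} \<Longrightarrow> edge z \<subseteq> A"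
  shows "\<exists>\<alpha> \<beta>. \<forall>w. (\<Prod>a\<in>A. side_value 1 a w) = \<alpha> + \<beta> * w"
proof -
  define f where "f s w = (\<Prod>a\<in>A. side_value s a w)" for s w
  have fin: "finite A" using A(1) finite_subset by blast
  have eq: "f 1 = f (-1)"
  proof
    fix p
    have "f 1 p = (\<Prod>a\<in>A. side_value (-1) (partner p a) p)"
      unfolding f_def using sides_partner A(1) by (intro prod.cong) auto
    also have "\<dots> = f (-1) p" unfolding f_def
      by (rule prod.reindex_bij_witness[of _ "partner p" "partner p"])
        (use partner_closed[OF A(2)] swap_along_involution[OF matching_cut_edges] in auto)
    finally show "f 1 p = f (-1) p" .
  qed
  have lim: "(f s \<longlongrightarrow> f s w) (at w within closed_side s w)" if "s \<in> {1, -1}" for s w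
    unfolding f_def using side_value_tendsto that A(1) by (intro tendsto_prod) auto
  \<comment> \<open>Equality of the two sides makes the product continuous across the slits.\<close>
  have "f 1 holomorphic_on UNIV"
  proof (rule entire_of_sides)
    show "finite (Im ` crit_values)" using finite_crit_values by simp
    show "f 1 holomorphic_on {w. Im w \<notin> Im ` crit_values}"
      unfolding f_def using side_value_holomorphic A(1) by (intro holomorphic_on_prod) auto
    show "(f 1 \<longlongrightarrow> f 1 w) (at w within closed_side 1 w)" for w using lim by simp
    show "(f 1 \<longlongrightarrow> f 1 w) (at w within closed_side (-1) w)" for w unfolding eq using lim by simp
  qed
  moreover obtain C where C: "C \<ge> 1" "\<And>a s w. a \<in> {1..d} \<Longrightarrow> s \<in> {1, -1} \<Longrightarrow> norm (side_value s a w) ^ d \<le> C * (1 + norm w)"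
    using side_value_growth by metis
  have "norm (f 1 w) \<le> C * (1 + norm w)" for w
    unfolding f_def prod_norm[symmetric]
  proof (rule prod_le_of_power_le[OF _ dpos])
    show "card A \<le> d" using card_mono[OF _ A(1)] by simp
    show "1 \<le> C * (1 + norm w)" using C(1) mult_mono[of 1 C 1 "1 + norm w"] by simp
  qed (use C(2) A(1) in auto)
  ultimately show ?thesis using entire_linear_growth unfolding f_def by blast
qed

lemma prod_side_value_nonconstant:
  assumes A: "A \<subseteq> {1..d}" "A \<noteq> {}" and eq: "\<And>w. (\<Prod>a\<in>A. side_value 1 a w) = \<alpha> + \<beta> * w"
  shows "\<beta> \<noteq> 0"
proof
  assume "\<beta> = 0"
  then have const: "(\<Prod>a\<in>A. side_value 1 a w) = \<alpha>" for w using eq by simp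
  have fin: "finite A" using A(1) finite_subset by blast
  define M where "M = norm \<alpha> + 1"
  have M: "M \<ge> 1" by (simp add: M_def)
  have "\<forall>\<^sub>F w in far_left. M \<le> norm (side_value 1 a w)" if "a \<in> A" for a
  proof -
    have "filterlim (side_value 1 a) at_infinity far_left" using branch_at_infinity that A(1) by blast
    then show ?thesis using M unfolding filterlim_at_infinity[OF order_refl] by simp
  qed
  then have "\<forall>\<^sub>F w in far_left. \<forall>a\<in>A. M \<le> norm (side_value 1 a w)"
    using fin by (intro eventually_ball_finite) auto
  then obtain w where w: "\<And>a. a \<in> A \<Longrightarrow> M \<le> norm (side_value 1 a w)"
    using eventually_happens'[OF far_left_neq_bot] by blast
  have "M \<le> M ^ card A" using M fin A(2) by (intro self_le_power) (auto simp: card_gt_0_iff)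
  also have "\<dots> = (\<Prod>a\<in>A. M)" by simp
  also have "\<dots> \<le> (\<Prod>a\<in>A. norm (side_value 1 a w))" using w M by (intro prod_mono) auto
  also have "\<dots> = norm \<alpha>" using const[of w] by (simp add: prod_norm)
  finally show False by (simp add: M_def)
qed

text \<open>Otherwise the branches over \<open>A\<close> and over its complement would have two nonconstant linear products,
  and the product of all branches would be quadratic, while it grows linearly.\<close>

lemma edges_connected:
  assumes A: "A \<subseteq> {1..d}" "A \<noteq> {}" "A \<noteq> {1..d}"
  shows "\<exists>z. poly dF z = 0 \<and> edge z \<inter> A \<noteq> {} \<and> \<not> edge z \<subseteq> A"
proof (rule ccontr)
  assume "\<not> ?thesis"
  then have cl: "\<And>z. poly dF z = 0 \<Longrightarrow> edge z \<inter> A \<noteq> {} \<Longrightarrow> edge z \<subseteq> A" by blast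
  let ?B = "{1..d} - A"
  have cl': "edge z \<subseteq> ?B" if "poly dF z = 0" "edge z \<inter> ?B \<noteq> {}" for z
    using cl[OF that(1)] edge_two(2)[OF that(1)] that(2) by blast
  obtain \<alpha> \<beta> where 1: "\<And>w. (\<Prod>a\<in>A. side_value 1 a w) = \<alpha> + \<beta> * w"
    using prod_side_value_entire[OF A(1) cl] by blast
  obtain \<alpha>' \<beta>' where 2: "\<And>w. (\<Prod>a\<in>?B. side_value 1 a w) = \<alpha>' + \<beta>' * w"
    using prod_side_value_entire[OF Diff_subset cl'] by blast
  obtain \<alpha>'' \<beta>'' where 3: "\<And>w. (\<Prod>a\<in>{1..d}. side_value 1 a w) = \<alpha>'' + \<beta>'' * w"
    using prod_side_value_entire[of "{1..d}"] edge_two(2) by blast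
  have "\<beta> \<noteq> 0" by (rule prod_side_value_nonconstant[OF A(1,2) 1])
  moreover have "\<beta>' \<noteq> 0" by (rule prod_side_value_nonconstant[OF _ _ 2]) (use A in auto)
  moreover have "poly ([:\<alpha>, \<beta>:] * [:\<alpha>', \<beta>':]) = poly [:\<alpha>'', \<beta>'':]"
  proof
    fix w
    have "(\<Prod>a\<in>{1..d}. side_value 1 a w) = (\<Prod>a\<in>?B. side_value 1 a w) * (\<Prod>a\<in>A. side_value 1 a w)"
      by (rule prod.subset_diff[OF A(1)]) simp
    then show "poly ([:\<alpha>, \<beta>:] * [:\<alpha>', \<beta>':]) w = poly [:\<alpha>'', \<beta>'':] w"
      unfolding 1 2 3 by (simp add: algebra_simps)
  qed
  then have "[:\<alpha>, \<beta>:] * [:\<alpha>', \<beta>':] = [:\<alpha>'', \<beta>'':]" by (simp only: poly_eq_poly_eq_iff)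
  from arg_cong[OF this, of "\<lambda>p. coeff p 2"] have "\<beta> * \<beta>' = 0" by (auto simp: numeral_2_eq_2)
  ultimately show False by simp
qed

text \<open>A connected graph on \<open>d\<close> vertices has at least \<open>d - 1\<close> edges, and there are at most \<open>d - 1\<close> zeros to
  provide them.\<close>

lemma edge_inj: "inj_on edge {z. poly dF z = 0}"
proof -
  let ?Z = "{z. poly dF z = 0}"
  have fin: "finite ?Z" by (rule finite_critical_points[OF degpos])
  have "card {1..d} \<le> card (edge ` ?Z) + 1"
  proof (rule card_vertices_le_edges)
    show "{1..d} \<noteq> {}" using dpos by auto
    show "e \<subseteq> {1..d} \<and> (\<exists>a b. e = {a, b})" if e: "e \<in> edge ` ?Z" for e
    proof -
      obtain z where z: "poly dF z = 0" "e = edge z" using e by blast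
      obtain a b where "edge z = {a, b}" using edge_two(1)[OF z(1)] by (elim exE conjE)
      then show ?thesis unfolding z(2) by (intro conjI edge_two(2)[OF z(1)] exI)
    qed
    show "\<exists>e\<in>edge ` ?Z. e \<inter> A \<noteq> {} \<and> \<not> e \<subseteq> A" if A: "A \<subseteq> {1..d}" "A \<noteq> {}" "A \<noteq> {1..d}" for A
    proof -
      obtain z where "poly dF z = 0" "edge z \<inter> A \<noteq> {}" "\<not> edge z \<subseteq> A"
        using edges_connected[OF A] by (elim exE conjE)
      then show ?thesis by (intro bexI[of _ "edge z"] imageI) simp_all
    qed
  qed (use fin in auto)
  moreover have "card ?Z \<le> d - 1"
  proof -
    have "degree dF = d - 1" by (simp add: degree_pderiv deg)
    moreover from this have "dF \<noteq> 0" using d2 by auto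
    ultimately show ?thesis using card_poly_roots_bound[of dF] by simp
  qed
  ultimately have "card ?Z \<le> card (edge ` ?Z)" by simp
  then have "card (edge ` ?Z) = card ?Z" using card_image_le[OF fin, of edge] by linarith
  then show ?thesis by (rule eq_card_imp_inj_on[OF fin])
qed

end

section \<open>Determination of the polynomial\<close>

context normalized_poly begin

lemma left_root_at_infinity: "filterlim rt at_infinity far_left"
  unfolding filterlim_at_infinity[OF order_refl]
proof safe
  fix r :: real assume r: "r > 0"
  have "r \<le> norm (rt w)" if "Re w < - (r ^ d)" for w
  proof -
    have pos: "r ^ d > 0" using r by simp
    then have w0: "w \<noteq> 0" using that r by auto
    have "r ^ d \<le> norm w" using that abs_Re_le_cmod[of w] by linarith
    also have "\<dots> \<le> d * norm w" using dpos by (simp add: mult_right_mono[of 1 "real d", simplified])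
    also have "\<dots> = norm (rt w) ^ d" using norm_left_root_power[OF dpos w0] by simp
    finally show ?thesis using r dpos by (simp add: power_mono_iff)
  qed
  then show "\<forall>\<^sub>F w in far_left. r \<le> norm (rt w)" unfolding eventually_far_left by blast
qed

lemma low_degree_negligible:
  assumes g: "((\<lambda>w. g w / rt w) \<longlongrightarrow> v) far_left" and Q: "degree Q + 1 < d"
  shows "((\<lambda>w. poly Q (g w) / rt w ^ (d - 1)) \<longlongrightarrow> 0) far_left"
proof -
  have inv: "((\<lambda>w. inverse (rt w)) \<longlongrightarrow> 0) far_left"
    by (rule filterlim_compose[OF tendsto_inverse_0 left_root_at_infinity])
  have "((\<lambda>w. \<Sum>i\<le>degree Q. coeff Q i * (g w / rt w) ^ i * inverse (rt w) ^ (d - 1 - i)) \<longlongrightarrow>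
      (\<Sum>i\<le>degree Q. coeff Q i * v ^ i * 0 ^ (d - 1 - i))) far_left"
    by (intro tendsto_intros g inv)
  moreover have "(\<Sum>i\<le>degree Q. coeff Q i * v ^ i * 0 ^ (d - 1 - i)) = 0"
    using Q by (intro sum.neutral) (auto simp: power_0_left)
  moreover have "(\<Sum>i\<le>degree Q. coeff Q i * (g w / rt w) ^ i * inverse (rt w) ^ (d - 1 - i)) = poly Q (g w) / rt w ^ (d - 1)" for w
    unfolding poly_altdef sum_divide_distrib
  proof (rule sum.cong[OF refl])
    fix i assume "i \<in> {..degree Q}"
    then have "i \<le> d - 1" using Q by auto
    then have "rt w ^ (d - 1) = rt w ^ i * rt w ^ (d - 1 - i)" by (metis le_add_diff_inverse power_add)
    then show "coeff Q i * (g w / rt w) ^ i * inverse (rt w) ^ (d - 1 - i) = coeff Q i * g w ^ i / rt w ^ (d - 1)"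
      by (simp add: power_divide power_inverse field_simps)
  qed
  ultimately show ?thesis by simp
qed

lemma degree_lower_centred:
  assumes "coeff F (d - 1) = 0" shows "degree lower + 1 < d"
proof -
  have "degree lower \<le> d - 2"
  proof (rule degree_le, safe)
    fix i assume i: "d - 2 < i"
    then consider "i = d - 1" | "i = d" | "i > d" by linarith
    then show "coeff lower i = 0"
      using dpos lead deg assms d2 by cases (auto simp: lower_def coeff_eq_0)
  qed
  then show ?thesis using d2 by simp
qed

lemma linear_far_left_zero:
  assumes eq: "\<And>w. f w = \<alpha> + \<beta> * w" and lim: "(f \<longlongrightarrow> 0) far_left"
  shows "f w = 0"
proof -
  have "filterlim (\<lambda>w. w - 1) far_left far_left"
    unfolding filterlim_iff eventually_far_left
  proof (intro allI impI)
    fix Q :: "complex \<Rightarrow> bool" assume "\<exists>R. \<forall>w. Re w < R \<longrightarrow> Q w"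
    then obtain R where R: "\<And>w. Re w < R \<Longrightarrow> Q w" by blast
    show "\<exists>R. \<forall>w. Re w < R \<longrightarrow> Q (w - 1)" by (intro exI[of _ R]) (use R in force)
  qed
  then have "((\<lambda>w. f w - f (w - 1)) \<longlongrightarrow> 0 - 0) far_left"
    by (intro tendsto_diff lim filterlim_compose[OF lim])
  moreover have "f w - f (w - 1) = \<beta>" for w by (simp add: eq algebra_simps)
  ultimately have b: "\<beta> = 0" by (simp add: tendsto_const_iff)
  then have f: "f = (\<lambda>_. \<alpha>)" using eq by auto
  then have "\<alpha> = 0" using lim by (simp add: tendsto_const_iff)
  then show ?thesis using f by simp
qed

end

lemma power_sum_diff_tendsto:
  fixes x y :: "'b \<Rightarrow> complex"
  assumes "(x \<longlongrightarrow> v) G" "(y \<longlongrightarrow> v) G" "d > 0"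
  shows "((\<lambda>w. \<Sum>i<d. y w ^ (d - Suc i) * x w ^ i) \<longlongrightarrow> of_nat d * v ^ (d - 1)) G"
proof -
  have "((\<lambda>w. \<Sum>i<d. y w ^ (d - Suc i) * x w ^ i) \<longlongrightarrow> (\<Sum>i<d. v ^ (d - Suc i) * v ^ i)) G"
    by (intro tendsto_intros assms)
  moreover have "(\<Sum>i<d. v ^ (d - Suc i) * v ^ i) = (\<Sum>i<d. v ^ (d - 1))"
    by (intro sum.cong) (auto simp: power_add[symmetric])
  ultimately show ?thesis by simp
qed

locale two_generic_polys = F: generic_poly F d + G: generic_poly G d for F G :: "complex poly" and d :: nat +
  assumes same_data: "F.crit_data = G.crit_data"
    and centred: "coeff F (d - 1) = 0" "coeff G (d - 1) = 0"
begin

lemma same_crit_values: "F.crit_values = G.crit_values"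
proof -
  have "F.crit_values = snd ` F.crit_data" "G.crit_values = snd ` G.crit_data"
    unfolding F.crit_values_def F.crit_data_def G.crit_values_def G.crit_data_def by (auto simp: image_image)
  then show ?thesis using same_data by simp
qed

text \<open>Both branches are \<open>valley_dir d a\<close> times \<open>r\<close> to first order. Since there is no term of degree
  \<open>d - 1\<close>, their \<open>d\<close>-th powers differ by less than \<open>r ^ (d - 1)\<close>; dividing by the sum in the
  factorisation of a difference of powers, which is of order \<open>r ^ (d - 1)\<close>, makes the difference of
  the branches tend to 0.\<close>

lemma branches_asymptotic:
  assumes a: "a \<in> {1..d}"
  shows "((\<lambda>w. F.side_value 1 a w - G.side_value 1 a w) \<longlongrightarrow> 0) far_left"
proof -
  let ?x = "F.branch a" and ?y = "G.branch a" and ?v = "valley_dir d a"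
  note x = F.branch(2)[OF a, unfolded F.from_valley_def] and y = G.branch(2)[OF a, unfolded G.from_valley_def]
  let ?S = "\<lambda>w. \<Sum>i<d. (?y w / left_root d w) ^ (d - Suc i) * (?x w / left_root d w) ^ i"
  have vnz: "of_nat d * ?v ^ (d - 1) \<noteq> 0"
  proof -
    have "?v \<noteq> 0" using norm_valley_dir[of d a] by force
    then show ?thesis using F.dpos by simp
  qed
  have S: "(?S \<longlongrightarrow> of_nat d * ?v ^ (d - 1)) far_left" by (rule power_sum_diff_tendsto[OF x y F.dpos])
  have low: "((\<lambda>w. (poly F.lower (?x w) - poly G.lower (?y w)) / left_root d w ^ (d - 1)) \<longlongrightarrow> 0) far_left"
  proof -
    have F: "((\<lambda>w. poly F.lower (?x w) / left_root d w ^ (d - 1)) \<longlongrightarrow> 0) far_left"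
      by (rule F.low_degree_negligible[OF x]) (rule F.degree_lower_centred[OF centred(1)])
    have G: "((\<lambda>w. poly G.lower (?y w) / left_root d w ^ (d - 1)) \<longlongrightarrow> 0) far_left"
      by (rule G.low_degree_negligible[OF y]) (rule G.degree_lower_centred[OF centred(2)])
    show ?thesis using tendsto_diff[OF F G] by (simp add: diff_divide_distrib)
  qed
  have lim: "((\<lambda>w. (poly F.lower (?x w) - poly G.lower (?y w)) / left_root d w ^ (d - 1) / ?S w) \<longlongrightarrow> 0 / (of_nat d * ?v ^ (d - 1))) far_left"
    by (rule tendsto_divide[OF low S vnz])
  have pull: "R * r * ((x / r - y / r) * S) = R * ((x - y) * S)" if "r \<noteq> 0" for R r x y S :: complex
    using that by (simp add: field_simps)
  have quot: "X / R / S = B" if "X = R * (B * S)" "R \<noteq> 0" "S \<noteq> 0" for X R B S :: complex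
    using that by simp
  have "\<forall>\<^sub>F w in far_left. ?S w \<noteq> 0"
    using S vnz by (rule tendsto_imp_eventually_ne)
  then have "\<forall>\<^sub>F w in far_left. (poly F.lower (?x w) - poly G.lower (?y w)) / left_root d w ^ (d - 1) / ?S w = F.side_value 1 a w - G.side_value 1 a w"
    using F.side_value_far_left[OF a insertI1] G.side_value_far_left[OF a insertI1]
  proof eventually_elim
    case (elim w)
    let ?r = "left_root d w"
    have "poly F (?x w) = w" "poly G (?y w) = w"
      using F.poly_branch[OF a] G.poly_branch[OF a] elim by auto
    then have "poly F.lower (?x w) - poly G.lower (?y w) = ?x w ^ d - ?y w ^ d"
      unfolding F.lower_eq G.lower_eq by simp
    also have "\<dots> = ?r ^ d * ((?x w / ?r) ^ d - (?y w / ?r) ^ d)" by (simp add: power_divide algebra_simps)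
    also have "\<dots> = ?r ^ d * ((?x w / ?r - ?y w / ?r) * ?S w)" by (simp only: power_diff_sumr2)
    also have "\<dots> = ?r ^ (d - 1) * ((?x w - ?y w) * ?S w)"
    proof -
      have e: "?r ^ d = ?r ^ (d - 1) * ?r" using power_minus_mult[OF F.dpos, of ?r] by (rule sym)
      show ?thesis unfolding e by (rule pull) simp
    qed
    finally have "(poly F.lower (?x w) - poly G.lower (?y w)) / ?r ^ (d - 1) / ?S w = ?x w - ?y w"
      by (rule quot[OF _ _ elim(1)]) simp
    then show ?case using elim(2,3) by simp
  qed
  from tendsto_cong[THEN iffD1, OF this lim] show ?thesis by simp
qed

text \<open>The product over all vertices of the differences of the two branches is invariant under the common
  gluing, hence entire; it grows at most linearly and tends to 0 on the left, so it is 0.\<close>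

lemma ex_common_branch: "\<exists>a\<in>{1..d}. F.side_value 1 a w = G.side_value 1 a w"
proof -
  define f where "f s w = (\<Prod>a\<in>{1..d}. F.side_value s a w - G.side_value s a w)" for s w
  have eq: "f 1 = f (-1)"
  proof
    fix p
    have "f 1 p = (\<Prod>a\<in>{1..d}. F.side_value (-1) (F.partner p a) p - G.side_value (-1) (F.partner p a) p)"
      unfolding f_def using F.sides_partner[of _ p] G.sides_partner[of _ p] same_data by (intro prod.cong) auto
    also have "\<dots> = f (-1) p" unfolding f_def
      by (rule prod.reindex_bij_witness[of _ "F.partner p" "F.partner p"])
        (use F.partner_closed[of "{1..d}"] F.edge_two(2) swap_along_involution[OF F.matching_cut_edges] in auto)
    finally show "f 1 p = f (-1) p" .
  qed
  have lim: "(f s \<longlongrightarrow> f s w) (at w within closed_side s w)" if "s \<in> {1, -1}" for s w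
    unfolding f_def using F.side_value_tendsto G.side_value_tendsto that by (intro tendsto_prod tendsto_diff) auto
  have hol: "f 1 holomorphic_on UNIV"
  proof (rule entire_of_sides)
    show "finite (Im ` F.crit_values)" using F.finite_crit_values by simp
    show "f 1 holomorphic_on {w. Im w \<notin> Im ` F.crit_values}"
      unfolding f_def using F.side_value_holomorphic G.side_value_holomorphic unfolding same_crit_values
      by (intro holomorphic_on_prod holomorphic_on_diff) auto
    show "(f 1 \<longlongrightarrow> f 1 w) (at w within closed_side 1 w)" for w using lim by simp
    show "(f 1 \<longlongrightarrow> f 1 w) (at w within closed_side (-1) w)" for w unfolding eq using lim by simp
  qed
  obtain C1 where C1: "C1 \<ge> 1" "\<And>a s w. a \<in> {1..d} \<Longrightarrow> s \<in> {1, -1} \<Longrightarrow> norm (F.side_value s a w) ^ d \<le> C1 * (1 + norm w)"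
    using F.side_value_growth by metis
  obtain C2 where C2: "C2 \<ge> 1" "\<And>a s w. a \<in> {1..d} \<Longrightarrow> s \<in> {1, -1} \<Longrightarrow> norm (G.side_value s a w) ^ d \<le> C2 * (1 + norm w)"
    using G.side_value_growth by metis
  define C where "C = 2 ^ d * max C1 C2"
  have C1': "1 \<le> C" using C1(1) mult_mono[of 1 "2 ^ d" 1 "max C1 C2"] by (simp add: C_def)
  have growth: "norm (f 1 w) \<le> C * (1 + norm w)" for w
    unfolding f_def prod_norm[symmetric]
  proof (rule prod_le_of_power_le[OF _ F.dpos])
    show "1 \<le> C * (1 + norm w)" using C1' mult_mono[of 1 C 1 "1 + norm w"] by simp
    fix a assume a: "a \<in> {1..d}"
    let ?x = "norm (F.side_value 1 a w)" and ?y = "norm (G.side_value 1 a w)"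
    have B: "?x ^ d \<le> max C1 C2 * (1 + norm w)" "?y ^ d \<le> max C1 C2 * (1 + norm w)"
      using order_trans[OF C1(2)[OF a insertI1] mult_right_mono[of C1 "max C1 C2" "1 + norm w"]]
        order_trans[OF C2(2)[OF a insertI1] mult_right_mono[of C2 "max C1 C2" "1 + norm w"]] by auto
    have "norm (F.side_value 1 a w - G.side_value 1 a w) \<le> 2 * max ?x ?y"
      using norm_triangle_ineq4[of "F.side_value 1 a w" "G.side_value 1 a w"] by simp
    then have "norm (F.side_value 1 a w - G.side_value 1 a w) ^ d \<le> (2 * max ?x ?y) ^ d"
      by (intro power_mono) auto
    also have "\<dots> = 2 ^ d * max ?x ?y ^ d" by (simp add: power_mult_distrib)
    also have "\<dots> \<le> 2 ^ d * (max C1 C2 * (1 + norm w))"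
      using B by (intro mult_left_mono) (auto simp: max_def)
    finally show "0 \<le> norm (F.side_value 1 a w - G.side_value 1 a w) \<and>
        norm (F.side_value 1 a w - G.side_value 1 a w) ^ d \<le> C * (1 + norm w)"
      by (simp add: C_def mult.assoc)
  qed simp
  obtain \<alpha> \<beta> where lin: "\<And>w. f 1 w = \<alpha> + \<beta> * w" using entire_linear_growth[OF hol growth] by blast
  have "(f 1 \<longlongrightarrow> (\<Prod>a\<in>{1..d}. 0)) far_left"
    unfolding f_def by (intro tendsto_prod branches_asymptotic)
  then have "(f 1 \<longlongrightarrow> 0) far_left" using F.dpos by (simp add: power_0_left)
  then have "f 1 w = 0" by (rule F.linear_far_left_zero[OF lin])
  then show ?thesis unfolding f_def by simp
qed

text \<open>Every \<open>w\<close> has a common preimage under \<open>F\<close> and \<open>G\<close>, so \<open>F - G\<close> has infinitely many zeros.\<close>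

lemma polys_equal: "F = G"
proof (rule ccontr)
  assume "F \<noteq> G"
  then have fin: "finite {z. poly (F - G) z = 0}" by (intro poly_roots_finite) simp
  have "(UNIV :: complex set) \<subseteq> poly F ` {z. poly (F - G) z = 0}"
  proof
    fix w :: complex
    obtain a where a: "a \<in> {1..d}" "F.side_value 1 a w = G.side_value 1 a w" using ex_common_branch by blast
    have "poly F (F.side_value 1 a w) = w" "poly G (F.side_value 1 a w) = w"
      using F.side_value(1)[OF a(1), of 1 w] G.side_value(1)[OF a(1), of 1 w] a(2) by auto
    then show "w \<in> poly F ` {z. poly (F - G) z = 0}"
      by (intro image_eqI[of _ _ "F.side_value 1 a w"]) auto
  qed
  then have "finite (UNIV :: complex set)" using fin finite_surj by blast
  then show False using infinite_UNIV_char_0 by blast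
qed

end

lemma in_edges_at:
  assumes e: "e \<in> E" "j \<in> e" and two: "\<exists>a b. a \<noteq> b \<and> e = {a, b}" and sub: "e \<subseteq> {1..n}"
  shows "e \<in> set (edges_at n E j)"
proof -
  obtain m where m: "e = {j, m}" "m \<noteq> j" using e(2) two by (metis insertE insert_commute singletonD)
  have jm: "1 \<le> j" "j \<le> n" "1 \<le> m" "m \<le> n" using sub m by auto
  define l where "l = (if j < m then m else m + n)"
  have "l \<in> {j + 1..<j + n}" using jm m(2) by (auto simp: l_def)
  moreover have "{j, if l \<le> n then l else l - n} = e" using jm m by (auto simp: l_def)
  ultimately show ?thesis using e(1) unfolding edges_at_def by (force simp: image_iff)
qed

context generic_poly begin

lemma zero_on_edge_edge:
  assumes "poly dF z = 0" shows "zero_on_edge (d - 2) dF (edge z) = z"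
  unfolding zero_on_edge_def
proof (rule the_equality)
  show "poly dF z = 0 \<and> edge_of_zero (d - 2) dF z = edge z" using assms by (simp add: edge_def)
  fix z' assume "poly dF z' = 0 \<and> edge_of_zero (d - 2) dF z' = edge z"
  then show "z' = z" using inj_onD[OF edge_inj, of z' z] assms by (simp add: edge_def)
qed

definition edges where "edges = edge ` {z. poly dF z = 0}"

lemma combinatorial_invariant_eq: "combinatorial_invariant (d - 2) dF = edges"
  unfolding combinatorial_invariant_def edges_def edge_def[abs_def] ..

abbreviation zero_at where "zero_at e \<equiv> zero_on_edge (d - 2) dF e"

lemma length_vertex_periods: "length (vertex_periods (d - 2) dF j) = length (edges_at d edges j) - 1"
proof -
  have dd: "d - 2 + 2 = d" using d2 by simp
  show ?thesis unfolding vertex_periods_def Let_def combinatorial_invariant_eq dd by simp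
qed

lemma nth_vertex_periods:
  assumes "l < length (edges_at d edges j) - 1"
  shows "vertex_periods (d - 2) dF j ! l =
    poly F (zero_at (edges_at d edges j ! Suc l)) - poly F (zero_at (edges_at d edges j ! l))"
proof -
  have "d - 2 + 2 = d" using d2 by simp
  have int: "contour_integral (linepath x y) (poly dF) = poly F y - poly F x" for x y
  proof -
    have "(poly dF has_contour_integral (poly F (pathfinish (linepath x y)) - poly F (pathstart (linepath x y)))) (linepath x y)"
      by (rule contour_integral_primitive[of UNIV]) (auto intro: poly_DERIV has_field_derivative_at_within)
    then show ?thesis using contour_integral_unique by fastforce
  qed
  show ?thesis
    using assms unfolding vertex_periods_def Let_def combinatorial_invariant_eq \<open>d - 2 + 2 = d\<close>
    by (simp add: int)
qed

lemma edges_two: "e \<in> edges \<Longrightarrow> (\<exists>a b. a \<noteq> b \<and> e = {a, b}) \<and> e \<subseteq> {1..d}"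
  unfolding edges_def using edge_two by blast

text \<open>Consecutive edges at a vertex suffice, because the tree is connected.\<close>

lemma constant_on_edges:
  assumes step: "\<And>j l. j \<in> {1..d} \<Longrightarrow> l < length (edges_at d edges j) - 1 \<Longrightarrow>
      D (edges_at d edges j ! Suc l) = D (edges_at d edges j ! l)"
    and e: "e \<in> edges" "e' \<in> edges"
  shows "D e = D e'"
proof -
  have first: "D (edges_at d edges j ! l) = D (edges_at d edges j ! 0)"
    if "j \<in> {1..d}" "l < length (edges_at d edges j)" for j l
    using that(2) by (induction l) (use step[OF that(1)] in auto)
  have vertex: "D e1 = D e2" if "e1 \<in> edges" "e2 \<in> edges" "j \<in> e1" "j \<in> e2" for e1 e2 j
  proof -
    have j: "j \<in> {1..d}" using that edges_two by blast
    have "e1 \<in> set (edges_at d edges j)" "e2 \<in> set (edges_at d edges j)"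
      using in_edges_at that edges_two by simp_all
    then show ?thesis using first[OF j] by (auto simp: in_set_conv_nth)
  qed
  define A where "A = {j\<in>{1..d}. \<exists>e1\<in>edges. j \<in> e1 \<and> D e1 = D e}"
  have inA: "e1 \<subseteq> A" if "e1 \<in> edges" "D e1 = D e" for e1
    using that edges_two unfolding A_def by blast
  have "A = {1..d}"
  proof (rule ccontr)
    assume "A \<noteq> {1..d}"
    moreover have "A \<subseteq> {1..d}" unfolding A_def by blast
    moreover have "A \<noteq> {}" using inA[OF e(1) refl] edges_two[OF e(1)] by blast
    ultimately obtain z where z: "poly dF z = 0" "edge z \<inter> A \<noteq> {}" "\<not> edge z \<subseteq> A"
      using edges_connected by blast
    have ez: "edge z \<in> edges" unfolding edges_def using z(1) by blast
    obtain j e1 where "j \<in> edge z" "e1 \<in> edges" "j \<in> e1" "D e1 = D e"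
      using z(2) unfolding A_def by blast
    then have "D (edge z) = D e" using vertex[OF ez, of e1 j] by simp
    then show False using inA[OF ez] z(3) by blast
  qed
  moreover obtain j where "j \<in> e'" "j \<in> {1..d}" using edges_two[OF e(2)] by blast
  ultimately obtain e1 where "e1 \<in> edges" "j \<in> e1" "D e1 = D e" unfolding A_def by blast
  then show ?thesis using vertex[OF e(2) _ \<open>j \<in> e'\<close>, of e1] by simp
qed

end

text \<open>A period is a difference of critical values on consecutive edges at a vertex. So the difference of the
  critical values of \<open>F\<close> and \<open>G\<close> on corresponding edges is constant around each vertex.\<close>

lemma same_periods_imp_critical_values_differ_by_constant:
  assumes "generic_poly F d" "generic_poly G d"
    and comb: "combinatorial_invariant (d - 2) (pderiv F) = combinatorial_invariant (d - 2) (pderiv G)"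
    and ana: "analytic_invariant (d - 2) (pderiv F) = analytic_invariant (d - 2) (pderiv G)"
  obtains \<kappa> where "\<And>z w. poly (pderiv F) z = 0 \<Longrightarrow> poly (pderiv G) w = 0 \<Longrightarrow>
    edge_of_zero (d - 2) (pderiv F) z = edge_of_zero (d - 2) (pderiv G) w \<Longrightarrow> poly F z = poly G w + \<kappa>"
proof -
  interpret F: generic_poly F d by fact
  interpret G: generic_poly G d by fact
  have E: "F.edges = G.edges" using comb by (simp add: F.combinatorial_invariant_eq G.combinatorial_invariant_eq)
  have "map (vertex_periods (d - 2) (pderiv F)) [1..<d - 2 + 3] = map (vertex_periods (d - 2) (pderiv G)) [1..<d - 2 + 3]"
    using ana unfolding analytic_invariant_def
    by (subst (asm) concat_eq_concat_iff)
      (auto simp: zip_map_map F.length_vertex_periods G.length_vertex_periods E zip_same_conv_map)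
  then have vp: "vertex_periods (d - 2) (pderiv F) j = vertex_periods (d - 2) (pderiv G) j" if "j \<in> {1..d}" for j
    using that F.d2 by (auto simp: map_eq_conv)
  define D where "D e = poly F (F.zero_at e) - poly G (G.zero_at e)" for e
  have "D e = D e'" if "e \<in> F.edges" "e' \<in> F.edges" for e e'
  proof (rule F.constant_on_edges[OF _ that])
    fix j l assume j: "j \<in> {1..d}" and l: "l < length (edges_at d F.edges j) - 1"
    show "D (edges_at d F.edges j ! Suc l) = D (edges_at d F.edges j ! l)"
      using F.nth_vertex_periods[OF l] G.nth_vertex_periods[of l j] l vp[OF j]
      unfolding D_def E by (simp add: algebra_simps)
  qed
  then obtain \<kappa> where \<kappa>: "\<And>e. e \<in> F.edges \<Longrightarrow> D e = \<kappa>" by metis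
  show ?thesis
  proof (rule that)
    fix z w assume zw: "poly (pderiv F) z = 0" "poly (pderiv G) w = 0"
      "edge_of_zero (d - 2) (pderiv F) z = edge_of_zero (d - 2) (pderiv G) w"
    then have e: "F.edge z = G.edge w" by (simp add: F.edge_def G.edge_def)
    have "F.edge z \<in> F.edges" using zw(1) unfolding F.edges_def by blast
    then have "D (F.edge z) = \<kappa>" by (rule \<kappa>)
    then show "poly F z = poly G w + \<kappa>"
      unfolding D_def F.zero_on_edge_edge[OF zw(1)] unfolding e G.zero_on_edge_edge[OF zw(2)]
      by (simp add: algebra_simps)
  qed
qed

lemma ex_poly_primitive: "\<exists>F :: complex poly. pderiv F = P"
proof -
  define F where "F = Poly (0 # map (\<lambda>i. coeff P i / of_nat (Suc i)) [0..<Suc (degree P)])"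
  have "pderiv F = P"
  proof (rule poly_eqI)
    fix n
    have "coeff F (Suc n) = coeff P n / of_nat (Suc n)"
      unfolding F_def coeff_Poly_eq nth_default_Cons_Suc nth_default_def
      by (auto simp: coeff_eq_0 simp del: of_nat_Suc upt_Suc)
    then show "coeff (pderiv F) n = coeff P n" by (simp add: coeff_pderiv del: of_nat_Suc)
  qed
  then show ?thesis by blast
qed

lemma generic_poly_of_primitive:
  assumes P: "monic_centred k (pderiv F)" and gen: "generic (pderiv F)"
  shows "generic_poly F (k + 2)" "coeff F (k + 1) = 0"
proof -
  have degP: "degree (pderiv F) = k + 1" "coeff (pderiv F) (k + 1) = 1" "coeff (pderiv F) k = 0"
    using P unfolding monic_centred_def by auto
  have degF: "degree F = k + 2" using degP(1) by (simp add: degree_pderiv)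
  show "coeff F (k + 1) = 0" using degP(3) by (simp add: coeff_pderiv del: of_nat_Suc)
  have lead: "coeff F (k + 2) = 1 / of_nat (k + 2)"
  proof -
    have "of_nat (k + 2) * coeff F (k + 2) = (1 :: complex)" using degP(2) by (simp add: coeff_pderiv)
    moreover have "of_nat (k + 2) \<noteq> (0 :: complex)" unfolding of_nat_eq_0_iff by simp
    ultimately show ?thesis by (metis nonzero_mult_div_cancel_left)
  qed
  have nz: "pderiv F \<noteq> 0" using degP(1) by auto
  show "generic_poly F (k + 2)"
  proof
    show "poly (pderiv (pderiv F)) z \<noteq> 0" if "poly (pderiv F) z = 0" for z
    proof -
      have "rsquarefree (pderiv F)" unfolding rsquarefree_def
        using gen nz unfolding generic_def by (metis order_root)
      then show ?thesis using that unfolding rsquarefree_roots by blast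
    qed
    show "\<not> heteroclinic_connection (pderiv F) I \<gamma>" for I \<gamma> using gen unfolding generic_def by blast
  qed (use degF lead in auto)
qed

theorem theorem4p4:
  fixes k :: nat and P1 P2 :: "complex poly"
  assumes "monic_centred k P1" and "monic_centred k P2"
    and "generic P1" and "generic P2"
    and "combinatorial_invariant k P1 = combinatorial_invariant k P2"
    and "analytic_invariant k P1 = analytic_invariant k P2"
  shows "analytically_equivalent (vfield P1) (vfield P2)"
proof -
  obtain F G0 where F: "pderiv F = P1" and G0: "pderiv G0 = P2" using ex_poly_primitive by metis
  have gF: "generic_poly F (k + 2)" "coeff F (k + 1) = 0"
    using generic_poly_of_primitive[of k F] assms F by auto
  have gG0: "generic_poly G0 (k + 2)"
    using generic_poly_of_primitive[of k G0] assms G0 by auto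
  \<comment> \<open>The primitives are determined up to constants; choose them so that corresponding critical
    values agree.\<close>
  obtain \<kappa> where \<kappa>: "\<And>z w. poly P1 z = 0 \<Longrightarrow> poly P2 w = 0 \<Longrightarrow>
      edge_of_zero k P1 z = edge_of_zero k P2 w \<Longrightarrow> poly F z = poly G0 w + \<kappa>"
    using same_periods_imp_critical_values_differ_by_constant[OF gF(1) gG0] assms(5,6) F G0 by auto
  define G where "G = G0 + [:\<kappa>:]"
  have G: "pderiv G = P2" unfolding G_def using G0 by (simp add: pderiv_add pderiv_pCons)
  have gG: "generic_poly G (k + 2)" "coeff G (k + 1) = 0"
    using generic_poly_of_primitive[of k G] assms G by auto
  interpret F: generic_poly F "k + 2" by (rule gF)
  interpret G: generic_poly G "k + 2" by (rule gG)
  have match: "poly F z = poly G w" if "poly P1 z = 0" "poly P2 w = 0" "F.edge z = G.edge w" for z w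
    using \<kappa>[OF that(1,2)] that(3) unfolding F.edge_def G.edge_def F G by (simp add: G_def)
  have edges: "F.edge ` {z. poly P1 z = 0} = G.edge ` {z. poly P2 z = 0}"
    using assms(5) unfolding combinatorial_invariant_def F.edge_def[abs_def] G.edge_def[abs_def] F G by simp
  have "F.crit_data = G.crit_data"
  proof (intro equalityI subsetI)
    fix x assume "x \<in> F.crit_data"
    then obtain z where z: "poly P1 z = 0" "x = (F.edge z, poly F z)" unfolding F.crit_data_def F by blast
    have "F.edge z \<in> G.edge ` {z. poly P2 z = 0}" unfolding edges[symmetric] using z(1) by (intro imageI) simp
    then obtain w where w: "poly P2 w = 0" "F.edge z = G.edge w" by (elim imageE) simp
    then show "x \<in> G.crit_data" unfolding G.crit_data_def G z(2)
      by (intro image_eqI[of _ _ w]) (simp_all add: match[OF z(1) w] w)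
  next
    fix x assume "x \<in> G.crit_data"
    then obtain w where w: "poly P2 w = 0" "x = (G.edge w, poly G w)" unfolding G.crit_data_def G by blast
    have "G.edge w \<in> F.edge ` {z. poly P1 z = 0}" unfolding edges using w(1) by (intro imageI) simp
    then obtain z where z: "poly P1 z = 0" "F.edge z = G.edge w" by (elim imageE) simp
    then show "x \<in> F.crit_data" unfolding F.crit_data_def F w(2)
      by (intro image_eqI[of _ _ z]) (simp_all add: match[OF z(1) w(1) z(2)] z)
  qed
  then have "two_generic_polys F G (k + 2)"
    using gF gG by (intro two_generic_polys.intro two_generic_polys_axioms.intro) simp_all
  then have "F = G" by (rule two_generic_polys.polys_equal)
  then have "P1 = P2" using F G by simp
  then show ?thesis unfolding analytically_equivalent_def
    by (intro exI[of _ "\<lambda>z. z"]) (auto simp: bij_id[unfolded id_def])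
qed

end
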